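(* Let $N=2^n$, let $k,T\ge 0$ be integers, and let $\lvert\psi\rangle$ be a Haar-random state in $\mathbb{C}^N$. Any algorithm that is given $k$ copies of $\lvert\psi\rangle$, makes at most $T$ queries to $C_{\lvert\psi\rangle}Z$, and outputs a state $\rho_\psi$ on $k+1$ registers satisfies $$\mathbb{E}_{\lvert\psi\rangle}\operatorname{Tr}\left[(\lvert\psi\rangle\langle\psi\rvert)^{\otimes(k+1)}\rho_\psi\right]\le O\left(\frac{T^2}{N}+\frac{k+1}{N}\right),$$ where $\rho_\psi$ includes the algorithm's internal randomness. Consequently, when $k=o(N)$, the query complexity of producing one additional copy with probability at least $2/3$, averaged over the Haar-random state, is $\Theta(\sqrt N)$. Moreover, the bound is asymptotically tight.
   Context: For a unit vector $\lvert\psi\rangle\in\mathbb{C}^N$, the controlled reflection oracle is the unitary on $\mathbb{C}^2\otimes\mathbb{C}^N$ $$C_{\lvert\psi\rangle}Z = I\otimes(I-\lvert\psi\rangle\langle\psi\rvert)+Z\otimes\lvert\psi\rangle\langle\psi\rvert = I-2\lvert1\rangle\langle1\rvert\otimes\lvert\psi\rangle\langle\psi\rvert .$$ An algorithm starts with $\lvert\psi\rangle^{\otimes k}$ (and ancillas in a fixed state) and may apply arbitrary oracle-independent quantum operations, which are free, interleaved with oracle queries; only oracle queries are counted. Each of the $k+1$ output registers has space $\mathbb{C}^N$, and the output $\rho_\psi$ may be entangled across them. The algorithm succeeds in producing one additional copy if all $k+1$ output registers pass the projection onto $\lvert\psi\rangle$, so its success probability averaged over the Haar-random state is the left-hand side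 of the displayed inequality. *)

theory Defs
  imports
    "HOL-Probability.Probability_Measure"
    "HOL-Library.Landau_Symbols"
    "Jordan_Normal_Form.Schur_Decomposition"
begin

unbundle no vec_syntax
hide_const (open) Finite_Cartesian_Product.vec Finite_Cartesian_Product.mat
  Finite_Cartesian_Product.row Determinants.det Determinants.trace

text \<open>Operators on \<open>\<complex>\<^sup>a \<otimes> \<complex>\<^sup>b\<close> are matrices of size \<open>a * b\<close>; the basis vector
  \<open>|i\<rangle> \<otimes> |j\<rangle>\<close> has index \<open>i * b + j\<close>.\<close>

definition tensor_mat :: "complex mat \<Rightarrow> complex mat \<Rightarrow> complex mat" (infixr \<open>\<otimes>\<^sub>m\<close> 71) where
  "A \<otimes>\<^sub>m B = Matrix.mat (dim_row A * dim_row B) (dim_col A * dim_col B)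
     (\<lambda>(i, j). A $$ (i div dim_row B, j div dim_col B) * B $$ (i mod dim_row B, j mod dim_col B))"

primrec tensor_power :: "complex mat \<Rightarrow> nat \<Rightarrow> complex mat" where
  "tensor_power A 0 = 1\<^sub>m 1"
| "tensor_power A (Suc m) = A \<otimes>\<^sub>m tensor_power A m"

definition mat_trace :: "complex mat \<Rightarrow> complex" where
  "mat_trace A = (\<Sum>i<dim_row A. A $$ (i, i))"

definition unitary_mat :: "nat \<Rightarrow> complex mat \<Rightarrow> bool" where
  "unitary_mat d U \<longleftrightarrow> U \<in> carrier_mat d d \<and> mat_adjoint U * U = 1\<^sub>m d \<and> U * mat_adjoint U = 1\<^sub>m d"

text \<open>\<open>ket_bra \<psi>\<close> is \<open>|\<psi>\<rangle>\<langle>\<psi>|\<close>.\<close>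

definition ket_bra :: "complex vec \<Rightarrow> complex mat" where
  "ket_bra \<psi> = Matrix.mat (dim_vec \<psi>) (dim_vec \<psi>) (\<lambda>(i, j). \<psi> $ i * cnj (\<psi> $ j))"


section \<open>Haar-random states\<close>

definition unit_vecs :: "nat \<Rightarrow> complex vec set" where
  "unit_vecs N = {\<psi> \<in> carrier_vec N. \<psi> \<bullet>c \<psi> = 1}"

text \<open>The Borel structure of the unit sphere of \<open>\<complex>\<^sup>N\<close>: \<open>complex vec\<close> carries no topology, so we
  take the \<open>\<sigma>\<close>-algebra generated by the coordinates.\<close>

definition borel_sphere :: "nat \<Rightarrow> complex vec measure" where
  "borel_sphere N = vimage_algebra (unit_vecs N) (\<lambda>\<psi>. \<lambda>i\<in>{..<N}. \<psi> $ i) (Pi\<^sub>M {..<N} (\<lambda>_. borel))"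

text \<open>The Haar measure on pure states is characterised as the (unique) unitarily invariant Borel
  probability measure on the unit sphere.\<close>

definition haar_state_measure :: "nat \<Rightarrow> complex vec measure \<Rightarrow> bool" where
  "haar_state_measure N \<mu> \<longleftrightarrow> prob_space \<mu> \<and>
     space \<mu> = unit_vecs N \<and> sets \<mu> = sets (borel_sphere N) \<and>
     (\<forall>U. unitary_mat N U \<longrightarrow> distr \<mu> \<mu> (\<lambda>\<psi>. U *\<^sub>v \<psi>) = \<mu>)"


section \<open>Quantum operations and oracle algorithms\<close>

text \<open>Quantum operations (completely positive trace-preserving maps) from operators on
  \<open>\<complex>\<^sup>a\<close> to operators on \<open>\<complex>\<^sup>b\<close>, in operator-sum form.\<close>

definition kraus_family :: "nat \<Rightarrow> nat \<Rightarrow> complex mat list \<Rightarrow> bool" where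
  "kraus_family a b Ks \<longleftrightarrow> set Ks \<subseteq> carrier_mat b a \<and>
     foldr (\<lambda>K S. mat_adjoint K * K + S) Ks (0\<^sub>m a a) = 1\<^sub>m a"

definition quantum_op :: "nat \<Rightarrow> nat \<Rightarrow> (complex mat \<Rightarrow> complex mat) \<Rightarrow> bool" where
  "quantum_op a b E \<longleftrightarrow> (\<exists>Ks. kraus_family a b Ks \<and>
     E = (\<lambda>\<rho>. foldr (\<lambda>K S. K * \<rho> * mat_adjoint K + S) Ks (0\<^sub>m b b)))"

definition pauli_Z :: "complex mat" where
  "pauli_Z = mat_of_rows_list 2 [[1, 0], [0, -1]]"

definition ctrl_reflection :: "nat \<Rightarrow> complex vec \<Rightarrow> complex mat" where
  "ctrl_reflection N \<psi> = 1\<^sub>m 2 \<otimes>\<^sub>m (1\<^sub>m N - ket_bra \<psi>) + pauli_Z \<otimes>\<^sub>m ket_bra \<psi>"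

text \<open>The oracle acting on \<open>\<complex>\<^sup>2 \<otimes> \<complex>\<^sup>N \<otimes> \<complex>\<^sup>w\<close>, where \<open>\<complex>\<^sup>w\<close> is the workspace.\<close>

definition apply_oracle :: "nat \<Rightarrow> nat \<Rightarrow> complex vec \<Rightarrow> complex mat \<Rightarrow> complex mat" where
  "apply_oracle N w \<psi> \<rho> =
     (ctrl_reflection N \<psi> \<otimes>\<^sub>m 1\<^sub>m w) * \<rho> * mat_adjoint (ctrl_reflection N \<psi> \<otimes>\<^sub>m 1\<^sub>m w)"

text \<open>\<open>oracle_alg N a t b A\<close>: the map \<open>A\<close>, depending on the state \<open>\<psi>\<close> behind the oracle and on the
  input density matrix on \<open>\<complex>\<^sup>a\<close>, arises from \<open>t\<close> oracle queries interleaved with quantum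
  operations chosen independently of \<open>\<psi>\<close>, with output on \<open>\<complex>\<^sup>b\<close>. The operations may adjoin ancillas
  in fixed states, measure, randomise and discard, so no separate ancilla register is needed. In
  particular a query can be made conditionally on earlier outcomes, by resetting the control qubit
  to \<open>|0\<rangle>\<close> when it is to be skipped.\<close>

inductive oracle_alg ::
  "nat \<Rightarrow> nat \<Rightarrow> nat \<Rightarrow> nat \<Rightarrow> (complex vec \<Rightarrow> complex mat \<Rightarrow> complex mat) \<Rightarrow> bool"
  for N a :: nat where
  no_query: "quantum_op a b E \<Longrightarrow> oracle_alg N a 0 b (\<lambda>\<psi> \<rho>. E \<rho>)"
| query: "oracle_alg N a t (2 * N * w) A \<Longrightarrow> quantum_op (2 * N * w) b E \<Longrightarrow>
    oracle_alg N a (Suc t) b (\<lambda>\<psi> \<rho>. E (apply_oracle N w \<psi> (A \<psi> \<rho>)))"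

text \<open>Algorithms taking \<open>k\<close> registers \<open>\<complex>\<^sup>N\<close> to \<open>k + 1\<close> registers with at most \<open>T\<close> queries.\<close>

definition cloner :: "nat \<Rightarrow> nat \<Rightarrow> nat \<Rightarrow> (complex vec \<Rightarrow> complex mat \<Rightarrow> complex mat) \<Rightarrow> bool" where
  "cloner N k T A \<longleftrightarrow> (\<exists>t\<le>T. oracle_alg N (N ^ k) t (N ^ (k + 1)) A)"

definition output_state ::
  "nat \<Rightarrow> (complex vec \<Rightarrow> complex mat \<Rightarrow> complex mat) \<Rightarrow> complex vec \<Rightarrow> complex mat" where
  "output_state k A \<psi> = A \<psi> (tensor_power (ket_bra \<psi>) k)"

text \<open>The trace below is real (a probability), so taking its real part loses nothing.\<close>

definition avg_success ::
  "complex vec measure \<Rightarrow> nat \<Rightarrow> (complex vec \<Rightarrow> complex mat \<Rightarrow> complex mat) \<Rightarrow> real" where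
  "avg_success \<mu> k A =
     (\<integral>\<psi>. Re (mat_trace (tensor_power (ket_bra \<psi>) (k + 1) * output_state k A \<psi>)) \<partial>\<mu>)"

definition queries_suffice :: "complex vec measure \<Rightarrow> nat \<Rightarrow> nat \<Rightarrow> nat \<Rightarrow> bool" where
  "queries_suffice \<mu> N k T \<longleftrightarrow> (\<exists>A. cloner N k T A \<and> avg_success \<mu> k A \<ge> 2 / 3)"

definition query_complexity :: "complex vec measure \<Rightarrow> nat \<Rightarrow> nat \<Rightarrow> nat" where
  "query_complexity \<mu> N k = (LEAST T. queries_suffice \<mu> N k T)"

end

theory Submission
  imports Defs
begin

text \<open>
  Upper bound. Expand everything in the Hilbert space of functions of \<open>\<psi>\<close> on the sphere. The input
  \<open>\<psi>\<^bsup>\<otimes>k\<^esup>\<close> is a vector of homogeneous holomorphic polynomials of degree \<open>k\<close>, and the oracle is the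
  reflection in \<open>\<psi>\<close>. Integration by parts, which is the infinitesimal form of unitary invariance, shows
  that on a polynomial vector field \<open>\<phi>\<close> of degree \<open>k\<close> the projection onto \<open>\<psi>\<close> agrees with the
  divergence projection \<open>\<phi> \<mapsto> \<psi> (div \<phi>) / (N + k - 1)\<close> up to an error of squared norm at most
  \<open>\<parallel>\<phi>\<parallel>\<^sup>2 / N\<close>. Replacing every query by the corresponding degree-preserving reflection costs an error of
  order \<open>T / sqrt N\<close> in norm, and a state of degree \<open>k\<close> has squared overlap at most \<open>(k + 1) / N\<close> with
  \<open>\<psi>\<^bsup>\<otimes>(k+1)\<^esup>\<close>.

  Tightness. If \<open>T\<^sup>2 \<ge> k + 1\<close>, ignore the copies and run amplitude amplification from a maximally
  entangled state; otherwise use the optimal cloner, whose success probability is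
  \<open>(k + 1) / (N + k)\<close>.\<close>

section \<open>Homogeneous holomorphic polynomials\<close>

text \<open>A query brings in \<open>cnj (x j)\<close>, so the true state is no longer holomorphic
  in \<open>\<psi>\<close>, while the overlap bound \<open>(k + 1) / N\<close> is available only for
  holomorphic states of degree \<open>k\<close>. For this reason each branch carries a second vector
  that is holomorphic of degree \<open>k\<close> throughout, and the number of queries affects
  nothing but the distance between the two. One fact controls both the replacement of a query and
  the final overlap: for a divergence-free field of degree \<open>k\<close>, the mean square of the
  radial component is exactly \<open>1 / (N + k)\<close> of the mean square of the field, and
  subtracting \<open>x d\<close> makes a field divergence free, because the divergence of
  \<open>x d\<close> is \<open>N + k - 1\<close> times \<open>d\<close>. No density and no moments
  of the Haar measure are computed; invariance under phase changes along a single vector suffices.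
  Distances are compared as mean squares with adjustable weights, so that no square roots occur. In
  the tightness part the success probability is the same for every \<open>\<psi>\<close>, so that
  nothing remains to be integrated there.\<close>

inductive hpoly :: "nat \<Rightarrow> nat \<Rightarrow> ((nat \<Rightarrow> complex) \<Rightarrow> complex) \<Rightarrow> bool" for N where
  hpoly_const: "hpoly N 0 (\<lambda>_. c)"
| hpoly_zero: "hpoly N k (\<lambda>_. 0)"
| hpoly_times: "i < N \<Longrightarrow> hpoly N k f \<Longrightarrow> hpoly N (Suc k) (\<lambda>x. x i * f x)"
| hpoly_add: "hpoly N k f \<Longrightarrow> hpoly N k g \<Longrightarrow> hpoly N k (\<lambda>x. f x + g x)"

text \<open>Polynomials are functions here, not lists of coefficients, so the derivative is taken
  analytically, one coordinate at a time; the product rule then makes it accessible to induction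
  over \<open>hpoly\<close>.\<close>

definition pd :: "nat \<Rightarrow> ((nat \<Rightarrow> complex) \<Rightarrow> complex) \<Rightarrow> (nat \<Rightarrow> complex) \<Rightarrow> complex" where
  "pd j f x = deriv (\<lambda>z. f (x(j := z))) (x j)"

lemma hpoly_cmult: "hpoly N k f \<Longrightarrow> hpoly N k (\<lambda>x. c * f x)"
proof (induction rule: hpoly.induct)
  case (hpoly_times i k f)
  then show ?case
    using hpoly.hpoly_times[of i N k "\<lambda>x. c * f x"] by (simp add: mult.left_commute)
qed (auto intro: hpoly.intros simp: distrib_left)

lemma hpoly_diff: "hpoly N k f \<Longrightarrow> hpoly N k g \<Longrightarrow> hpoly N k (\<lambda>x. f x - g x)"
  using hpoly_add[of N k f "\<lambda>x. (-1) * g x"] hpoly_cmult[of N k g "-1"] by simp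

lemma hpoly_sum: "(\<And>i. i \<in> I \<Longrightarrow> hpoly N k (f i)) \<Longrightarrow> hpoly N k (\<lambda>x. \<Sum>i\<in>I. f i x)"
  by (induction I rule: infinite_finite_induct) (auto intro: hpoly.intros)

lemma hpoly_0_const: "hpoly N k f \<Longrightarrow> k = 0 \<Longrightarrow> \<exists>c. f = (\<lambda>_. c)"
  by (induction rule: hpoly.induct) auto

lemma hpoly_differentiable:
  "hpoly N k f \<Longrightarrow> (\<lambda>z. f (x(j := z))) field_differentiable at w"
proof (induction rule: hpoly.induct)
  case (hpoly_times i k f)
  have "(\<lambda>z. (x(j := z)) i) field_differentiable at w"
    by (cases "i = j") (auto simp: field_differentiable_ident field_differentiable_const)
  then show ?case
    using hpoly_times.IH by (rule field_differentiable_mult)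
qed (auto intro: field_differentiable_add field_differentiable_const)

lemma pd_const [simp]: "pd j (\<lambda>_. c) x = 0"
  by (simp add: pd_def)

lemma pd_add: "hpoly N k f \<Longrightarrow> hpoly N l g \<Longrightarrow> pd j (\<lambda>x. f x + g x) x = pd j f x + pd j g x"
  unfolding pd_def by (rule deriv_add) (rule hpoly_differentiable, assumption)+

lemma pd_diff: "hpoly N k f \<Longrightarrow> hpoly N l g \<Longrightarrow> pd j (\<lambda>x. f x - g x) x = pd j f x - pd j g x"
  unfolding pd_def by (rule deriv_diff) (rule hpoly_differentiable, assumption)+

lemma pd_times:
  assumes "hpoly N k f"
  shows "pd j (\<lambda>x. x i * f x) x = (if i = j then f x else 0) + x i * pd j f x"
proof -
  have d: "(\<lambda>z. (x(j := z)) i) field_differentiable at w" for w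
    by (cases "i = j") (auto simp: field_differentiable_ident field_differentiable_const)
  have "deriv (\<lambda>z. (x(j := z)) i) w = (if i = j then 1 else 0)" for w
    by (cases "i = j") (auto simp: deriv_ident deriv_const)
  with deriv_mult[OF d hpoly_differentiable[OF assms, of x j "x j"]] show ?thesis
    unfolding pd_def by (simp add: add.commute)
qed

lemma hpoly_pd: "hpoly N k f \<Longrightarrow> hpoly N (k - 1) (pd j f)"
proof (induction rule: hpoly.induct)
  case (hpoly_times i k f)
  have eq: "pd j (\<lambda>x. x i * f x) = (\<lambda>x. (if i = j then f x else 0) + x i * pd j f x)"
    using pd_times[OF hpoly_times.hyps(2)] by blast
  have "hpoly N k (\<lambda>x. x i * pd j f x)"
  \<comment> \<open>In degree 0 the truncated \<open>k - 1\<close> is again 0, and multiplication by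
    \<open>x i\<close> would raise the degree too far; there the derivative vanishes.\<close>
  proof (cases k)
    case 0
    with hpoly_0_const[OF hpoly_times.hyps(2)] obtain c where "f = (\<lambda>_. c)" by auto
    then show ?thesis by (simp add: hpoly_zero)
  next
    case (Suc m)
    then show ?thesis using hpoly.hpoly_times[OF hpoly_times.hyps(1) hpoly_times.IH] by simp
  qed
  moreover have "hpoly N k (\<lambda>x. if i = j then f x else 0)"
    using hpoly_times.hyps(2) by (cases "i = j") (auto intro: hpoly_zero)
  ultimately show ?case unfolding eq by (simp add: hpoly_add)
next
  case (hpoly_add k f g)
  have "pd j (\<lambda>x. f x + g x) = (\<lambda>x. pd j f x + pd j g x)"
    using pd_add[OF hpoly_add.hyps] by blast
  then show ?case using hpoly.hpoly_add[OF hpoly_add.IH] by simp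
qed (auto intro: hpoly.intros simp: pd_def[abs_def])

lemma euler_identity: "hpoly N k f \<Longrightarrow> (\<Sum>j<N. x j * pd j f x) = of_nat k * f x"
proof (induction rule: hpoly.induct)
  case (hpoly_times i k f)
  have "(\<Sum>j<N. x j * pd j (\<lambda>x. x i * f x) x) =
     (\<Sum>j<N. (if i = j then x i * f x else 0) + x i * (x j * pd j f x))"
    by (intro sum.cong refl) (simp add: pd_times[OF hpoly_times.hyps(2)] algebra_simps)
  also have "\<dots> = x i * f x + x i * (\<Sum>j<N. x j * pd j f x)"
    using hpoly_times.hyps(1) by (simp add: sum.distrib sum_distrib_left)
  finally show ?case by (simp add: hpoly_times.IH algebra_simps)
next
  case (hpoly_add k f g)
  then show ?case by (simp add: pd_add[OF hpoly_add.hyps] distrib_left sum.distrib)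
qed simp_all

text \<open>Two vectors that agree below \<open>N\<close> may differ as functions under
  \<open>vec_index\<close> from \<open>N\<close> on; polynomials do not notice.\<close>

lemma hpoly_cong: "hpoly N k f \<Longrightarrow> (\<And>i. i < N \<Longrightarrow> x i = y i) \<Longrightarrow> f x = f y"
  by (induction rule: hpoly.induct) auto

lemma hpoly_bounded:
  "hpoly N k f \<Longrightarrow> \<exists>B\<ge>0. \<forall>x. (\<forall>i<N. cmod (x i) \<le> 1) \<longrightarrow> cmod (f x) \<le> B"
proof (induction rule: hpoly.induct)
  case (hpoly_const c)
  show ?case by (intro exI[of _ "cmod c"]) auto
next
  case (hpoly_times i k f)
  then obtain B where B: "B \<ge> 0" "\<forall>x. (\<forall>i<N. cmod (x i) \<le> 1) \<longrightarrow> cmod (f x) \<le> B" by blast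
  have "cmod (x i * f x) \<le> 1 * B" if "\<forall>i<N. cmod (x i) \<le> 1" for x
    unfolding norm_mult using that B hpoly_times.hyps by (intro mult_mono) auto
  with B show ?case by (intro exI[of _ B]) auto
next
  case (hpoly_add k f g)
  then obtain B C where "B \<ge> 0" "\<forall>x. (\<forall>i<N. cmod (x i) \<le> 1) \<longrightarrow> cmod (f x) \<le> B"
    "C \<ge> 0" "\<forall>x. (\<forall>i<N. cmod (x i) \<le> 1) \<longrightarrow> cmod (g x) \<le> C" by blast
  then show ?case
    by (intro exI[of _ "B + C"]) (auto intro!: norm_triangle_le add_mono)
qed auto

text \<open>The displaced point is the image of \<open>x\<close> under
  \<open>phase_mat N (1 + s) v\<close>, so the sum is a derivative along an infinitesimal rotation.
  The remainder has to be uniform in \<open>x\<close> to survive integration; the bound 2 on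
  \<open>cmod s\<close> covers \<open>s = z - 1\<close> for every \<open>z\<close> on the unit
  circle.\<close>

lemma hpoly_taylor:
  assumes "hpoly N k f"
  shows "\<exists>B. \<forall>s x. cmod s \<le> 2 \<longrightarrow> (\<forall>i<N. cmod (x i) \<le> 1) \<longrightarrow>
    cmod (f (\<lambda>a. x a + s * (v a * (\<Sum>b<N. cnj (v b) * x b))) - f x
      - s * (\<Sum>a<N. v a * (\<Sum>b<N. cnj (v b) * x b) * pd a f x)) \<le> B * (cmod s)\<^sup>2"
proof -
  define c where "c x = (\<Sum>b<N. cnj (v b) * x b)" for x
  define L where "L = (\<Sum>b<N. cmod (v b))"
  have L0: "L \<ge> 0" by (simp add: L_def sum_nonneg)
  have Lv: "cmod (v a) \<le> L" if "a < N" for a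
    unfolding L_def using that by (intro member_le_sum) auto
  have Lc: "cmod (c x) \<le> L" if "\<forall>i<N. cmod (x i) \<le> 1" for x
    unfolding c_def L_def using that
    by (intro sum_norm_le) (auto simp: norm_mult intro: mult_left_le)
  have "\<exists>B\<ge>0. \<forall>s x. cmod s \<le> 2 \<longrightarrow> (\<forall>i<N. cmod (x i) \<le> 1) \<longrightarrow>
    cmod (f (\<lambda>a. x a + s * (v a * c x)) - f x - s * (\<Sum>a<N. v a * c x * pd a f x)) \<le> B * (cmod s)\<^sup>2"
    using assms
  proof (induction rule: hpoly.induct)
    case (hpoly_const c)
    show ?case by (intro exI[of _ 0]) simp
  next
    case (hpoly_zero k)
    show ?case by (intro exI[of _ 0]) simp
  next
    case (hpoly_times i k f)
    define f1 where "f1 x = (\<Sum>a<N. v a * c x * pd a f x)" for x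
    obtain B where B: "B \<ge> 0" "\<And>s x. cmod s \<le> 2 \<Longrightarrow> (\<forall>i<N. cmod (x i) \<le> 1) \<Longrightarrow>
      cmod (f (\<lambda>a. x a + s * (v a * c x)) - f x - s * f1 x) \<le> B * (cmod s)\<^sup>2"
      using hpoly_times.IH unfolding f1_def by blast
    have "\<forall>a. \<exists>M\<ge>0. \<forall>x. (\<forall>i<N. cmod (x i) \<le> 1) \<longrightarrow> cmod (pd a f x) \<le> M"
      by (rule allI, rule hpoly_bounded, rule hpoly_pd, rule hpoly_times.hyps(2))
    then obtain M where M: "\<And>a. M a \<ge> 0"
      "\<And>a x. (\<forall>i<N. cmod (x i) \<le> 1) \<Longrightarrow> cmod (pd a f x) \<le> M a" by metis
    define F where "F = (\<Sum>a<N. L * L * M a)"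
    have F0: "F \<ge> 0" unfolding F_def using M L0 by (intro sum_nonneg) auto
    have F: "cmod (f1 x) \<le> F" if x: "\<forall>i<N. cmod (x i) \<le> 1" for x
      unfolding f1_def F_def
    proof (rule sum_norm_le)
      fix a assume "a \<in> {..<N}"
      then show "cmod (v a * c x * pd a f x) \<le> L * L * M a"
        unfolding norm_mult using M x Lv Lc[OF x] L0 by (intro mult_mono) auto
    qed
    show ?case
    proof (intro exI[of _ "B + L * L * (F + 2 * B)"] conjI allI impI)
      show "0 \<le> B + L * L * (F + 2 * B)" using B L0 F0 by simp
      fix s x assume s: "cmod s \<le> 2" and x: "\<forall>i<N. cmod (x i) \<le> 1"
      let ?y = "\<lambda>a. x a + s * (v a * c x)"
      have D: "(\<Sum>a<N. v a * c x * pd a (\<lambda>x. x i * f x) x) = v i * c x * f x + x i * f1 x"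
      proof -
        have "(\<Sum>a<N. v a * c x * pd a (\<lambda>x. x i * f x) x) =
          (\<Sum>a<N. (if i = a then v a * c x * f x else 0) + x i * (v a * c x * pd a f x))"
          by (intro sum.cong refl) (simp add: pd_times[OF hpoly_times.hyps(2)] algebra_simps)
        then show ?thesis using hpoly_times.hyps(1)
          by (simp add: sum.distrib f1_def sum_distrib_left)
      qed
      have "cmod (f ?y - f x) \<le> cmod (f ?y - f x - s * f1 x) + cmod (s * f1 x)"
        using norm_triangle_ineq[of "f ?y - f x - s * f1 x" "s * f1 x"] by simp
      also have "\<dots> \<le> B * (cmod s)\<^sup>2 + cmod s * F"
        using B(2)[OF s x] F[OF x] by (auto simp: norm_mult intro!: add_mono mult_left_mono)
      also have "\<dots> \<le> B * (2 * cmod s) + cmod s * F"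
        using s B(1) by (intro add_mono mult_left_mono) (auto simp: power2_eq_square intro: mult_right_mono)
      finally have d1: "cmod (f ?y - f x) \<le> cmod s * (F + 2 * B)" by (simp add: algebra_simps)
      \<comment> \<open>Product rule with remainder: the second summand is of second order, because
        both the displacement of \<open>x i\<close> and \<open>f ?y - f x\<close> are of first
        order.\<close>
      have "cmod (?y i * f ?y - x i * f x - s * (v i * c x * f x + x i * f1 x))
          = cmod (x i * (f ?y - f x - s * f1 x) + s * (v i * c x) * (f ?y - f x))"
        by (rule arg_cong[where f = cmod]) (simp add: algebra_simps)
      also have "\<dots> \<le> cmod (x i) * cmod (f ?y - f x - s * f1 x)
          + cmod s * (cmod (v i) * cmod (c x)) * cmod (f ?y - f x)"
        using norm_triangle_ineq[of "x i * (f ?y - f x - s * f1 x)" "s * (v i * c x) * (f ?y - f x)"]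
        by (simp only: norm_mult)
      also have "\<dots> \<le> 1 * (B * (cmod s)\<^sup>2) + cmod s * (L * L) * (cmod s * (F + 2 * B))"
      proof (rule add_mono)
        have "cmod (x i) \<le> 1" using x hpoly_times.hyps(1) by blast
        then show "cmod (x i) * cmod (f ?y - f x - s * f1 x) \<le> 1 * (B * (cmod s)\<^sup>2)"
          by (rule mult_mono'[OF _ B(2)[OF s x]]) simp_all
        have "cmod (v i) * cmod (c x) \<le> L * L"
          by (rule mult_mono'[OF Lv[OF hpoly_times.hyps(1)] Lc[OF x]]) simp_all
        then have "cmod s * (cmod (v i) * cmod (c x)) \<le> cmod s * (L * L)"
          by (rule mult_left_mono) simp
        then show "cmod s * (cmod (v i) * cmod (c x)) * cmod (f ?y - f x) \<le> cmod s * (L * L) * (cmod s * (F + 2 * B))"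
          by (rule mult_mono'[OF _ d1]) simp_all
      qed
      also have "\<dots> = (B + L * L * (F + 2 * B)) * (cmod s)\<^sup>2"
        by (simp add: algebra_simps power2_eq_square)
      finally show "cmod (?y i * f ?y - x i * f x - s * (\<Sum>a<N. v a * c x * pd a (\<lambda>x. x i * f x) x))
          \<le> (B + L * L * (F + 2 * B)) * (cmod s)\<^sup>2" unfolding D .
    qed
  next
    case (hpoly_add k f g)
    obtain B where B: "B \<ge> 0" "\<And>s x. cmod s \<le> 2 \<Longrightarrow> (\<forall>i<N. cmod (x i) \<le> 1) \<Longrightarrow>
      cmod (f (\<lambda>a. x a + s * (v a * c x)) - f x - s * (\<Sum>a<N. v a * c x * pd a f x)) \<le> B * (cmod s)\<^sup>2"
      using hpoly_add.IH(1) by blast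
    obtain C where C: "C \<ge> 0" "\<And>s x. cmod s \<le> 2 \<Longrightarrow> (\<forall>i<N. cmod (x i) \<le> 1) \<Longrightarrow>
      cmod (g (\<lambda>a. x a + s * (v a * c x)) - g x - s * (\<Sum>a<N. v a * c x * pd a g x)) \<le> C * (cmod s)\<^sup>2"
      using hpoly_add.IH(2) by blast
    show ?case
    proof (intro exI[of _ "B + C"] conjI allI impI)
      fix s :: complex and x :: "nat \<Rightarrow> complex" assume s: "cmod s \<le> 2" and x: "\<forall>i<N. cmod (x i) \<le> 1"
      let ?y = "\<lambda>a. x a + s * (v a * c x)"
      have "f ?y + g ?y - (f x + g x) - s * (\<Sum>a<N. v a * c x * pd a (\<lambda>x. f x + g x) x)
        = (f ?y - f x - s * (\<Sum>a<N. v a * c x * pd a f x)) + (g ?y - g x - s * (\<Sum>a<N. v a * c x * pd a g x))"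
        by (simp add: pd_add[OF hpoly_add.hyps] algebra_simps sum.distrib)
      then show "cmod (f ?y + g ?y - (f x + g x) - s * (\<Sum>a<N. v a * c x * pd a (\<lambda>x. f x + g x) x))
          \<le> (B + C) * (cmod s)\<^sup>2"
        using norm_triangle_le[OF add_mono[OF B(2)[OF s x] C(2)[OF s x]]] by (simp only: distrib_right)
    qed (use B(1) C(1) in simp)
  qed
  then show ?thesis unfolding c_def by blast
qed

section \<open>The Haar measure and integration by parts\<close>

lemma mat_adjoint_carrier: "A \<in> carrier_mat n m \<Longrightarrow> mat_adjoint A \<in> carrier_mat m n"
  for A :: "complex mat"
  by (auto simp: mat_adjoint_def mat_of_rows_def)

lemma mat_adjoint_index:
  "i < dim_col A \<Longrightarrow> j < dim_row A \<Longrightarrow> mat_adjoint A $$ (i, j) = cnj (A $$ (j, i))" for A :: "complex mat"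
  by (auto simp: mat_adjoint_def mat_of_rows_def)

lemma index_mult_mat_sum:
  "i < dim_row A \<Longrightarrow> j < dim_col B \<Longrightarrow> dim_row B = dim_col A \<Longrightarrow>
    (A * B) $$ (i, j) = (\<Sum>l<dim_col A. A $$ (i, l) * B $$ (l, j))"
  by (auto simp: scalar_prod_def lessThan_atLeast0 intro!: sum.cong)

text \<open>The unitary that multiplies the unit vector \<open>v\<close> by the phase \<open>z\<close> and fixes its orthogonal complement.\<close>

definition phase_mat :: "nat \<Rightarrow> complex \<Rightarrow> (nat \<Rightarrow> complex) \<Rightarrow> complex mat" where
  "phase_mat N z v = Matrix.mat N N (\<lambda>(a, b). (if a = b then 1 else 0) + (z - 1) * v a * cnj (v b))"

lemma phase_mat_mult:
  assumes "(\<Sum>a<N. v a * cnj (v a)) = 1"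
  shows "phase_mat N z v * phase_mat N w v = phase_mat N (z * w) v"
proof (rule eq_matI)
  fix a b assume ab: "a < dim_row (phase_mat N (z * w) v)" "b < dim_col (phase_mat N (z * w) v)"
  then have ab': "a < N" "b < N" by (auto simp: phase_mat_def)
  have "(phase_mat N z v * phase_mat N w v) $$ (a, b) =
    (\<Sum>l<N. ((if a = l then 1 else 0) + (z - 1) * v a * cnj (v l)) * ((if l = b then 1 else 0) + (w - 1) * v l * cnj (v b)))"
    using ab' by (subst index_mult_mat_sum) (auto simp: phase_mat_def)
  also have "\<dots> = (\<Sum>l<N. (if a = l then (if l = b then 1 else 0) + (w - 1) * v l * cnj (v b) else 0)
     + (if l = b then (z - 1) * v a * cnj (v l) else 0) + (z - 1) * (w - 1) * v a * cnj (v b) * (v l * cnj (v l)))"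
    by (intro sum.cong refl) (auto simp: algebra_simps)
  also have "\<dots> = (if a = b then 1 else 0) + (w - 1) * v a * cnj (v b) + (z - 1) * v a * cnj (v b)
      + (z - 1) * (w - 1) * v a * cnj (v b)"
    using ab' assms by (simp add: sum.distrib flip: sum_distrib_left)
  also have "\<dots> = phase_mat N (z * w) v $$ (a, b)"
    using ab' by (simp add: phase_mat_def algebra_simps)
  finally show "(phase_mat N z v * phase_mat N w v) $$ (a, b) = phase_mat N (z * w) v $$ (a, b)" .
qed (auto simp: phase_mat_def)

lemma unitary_phase_mat:
  assumes "(\<Sum>a<N. v a * cnj (v a)) = 1" "cmod z = 1"
  shows "unitary_mat N (phase_mat N z v)"
proof -
  have adj: "mat_adjoint (phase_mat N z v) = phase_mat N (cnj z) v"
  proof (rule eq_matI)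
    show "dim_row (mat_adjoint (phase_mat N z v)) = dim_row (phase_mat N (cnj z) v)"
      "dim_col (mat_adjoint (phase_mat N z v)) = dim_col (phase_mat N (cnj z) v)"
      using mat_adjoint_carrier[of "phase_mat N z v" N N] by (auto simp: phase_mat_def)
  qed (auto simp: phase_mat_def mat_adjoint_index)
  have one: "phase_mat N 1 v = 1\<^sub>m N"
    by (rule eq_matI) (auto simp: phase_mat_def)
  have z: "z * cnj z = 1" using assms(2) by (simp add: complex_norm_square[symmetric])
  show ?thesis unfolding unitary_mat_def adj
    by (auto simp: phase_mat_mult[OF assms(1)] z mult.commute[of "cnj z"] one) (simp add: phase_mat_def)
qed

section \<open>Expectations of bounded functions on the sphere\<close>

locale haar_states =
  fixes N :: nat and \<mu> :: "complex vec measure"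
  assumes haar: "haar_state_measure N \<mu>" and N_pos: "N > 0"
begin

sublocale prob_space \<mu>
  using haar by (simp add: haar_state_measure_def)

lemma space_haar: "space \<mu> = unit_vecs N"
  using haar by (simp add: haar_state_measure_def)

lemma sets_haar: "sets \<mu> = sets (borel_sphere N)"
  using haar by (simp add: haar_state_measure_def)

lemma unit_vecs_carrier: "\<psi> \<in> unit_vecs N \<Longrightarrow> \<psi> \<in> carrier_vec N"
  by (simp add: unit_vecs_def)

lemma unit_vec_norm:
  assumes "\<psi> \<in> unit_vecs N"
  shows "(\<Sum>i<N. (cmod (\<psi> $ i))\<^sup>2) = 1" "(\<Sum>i<N. \<psi> $ i * cnj (\<psi> $ i)) = 1"
proof -
  have "(\<Sum>i<N. \<psi> $ i * cnj (\<psi> $ i)) = \<psi> \<bullet>c \<psi>"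
    using assms by (auto simp: unit_vecs_def scalar_prod_def lessThan_atLeast0)
  then show *: "(\<Sum>i<N. \<psi> $ i * cnj (\<psi> $ i)) = 1"
    using assms by (simp add: unit_vecs_def)
  have "complex_of_real (\<Sum>i<N. (cmod (\<psi> $ i))\<^sup>2) = (\<Sum>i<N. \<psi> $ i * cnj (\<psi> $ i))"
    unfolding of_real_sum by (intro sum.cong refl) (simp only: complex_norm_square)
  then show "(\<Sum>i<N. (cmod (\<psi> $ i))\<^sup>2) = 1" using * by (metis of_real_eq_1_iff)
qed

lemma unit_vec_coord_le:
  assumes "\<psi> \<in> unit_vecs N" "i < N"
  shows "cmod (\<psi> $ i) \<le> 1"
proof -
  have "(cmod (\<psi> $ i))\<^sup>2 \<le> (\<Sum>i<N. (cmod (\<psi> $ i))\<^sup>2)"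
    using assms(2) by (intro member_le_sum) auto
  then show ?thesis using unit_vec_norm[OF assms(1)] by (simp add: power_le_one_iff abs_square_le_1)
qed

lemma measurable_coord:
  assumes "i < N"
  shows "(\<lambda>\<psi>. \<psi> $ i) \<in> borel_measurable \<mu>"
proof -
  have "(\<lambda>\<psi>. \<lambda>i\<in>{..<N}. \<psi> $ i) \<in> measurable (borel_sphere N) (Pi\<^sub>M {..<N} (\<lambda>_. borel))"
    unfolding borel_sphere_def by (rule measurable_vimage_algebra1) (auto simp: space_PiM)
  then have "(\<lambda>\<psi>. (\<lambda>i\<in>{..<N}. \<psi> $ i) i) \<in> measurable (borel_sphere N) borel"
    by (rule measurable_compose) (use assms in \<open>auto intro: measurable_component_singleton\<close>)
  then show ?thesis using assms by (simp cong: measurable_cong_sets[OF sets_haar refl])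
qed

lemma measurable_into_haar:
  assumes "\<And>\<psi>. \<psi> \<in> space M \<Longrightarrow> T \<psi> \<in> unit_vecs N"
    and "\<And>i. i < N \<Longrightarrow> (\<lambda>\<psi>. T \<psi> $ i) \<in> borel_measurable M"
  shows "T \<in> measurable M \<mu>"
proof -
  have "T \<in> measurable M (borel_sphere N)"
    unfolding borel_sphere_def
    by (rule measurable_vimage_algebra2) (use assms in \<open>auto intro!: measurable_restrict\<close>)
  then show ?thesis by (simp cong: measurable_cong_sets[OF refl sets_haar])
qed

text \<open>Boundedness is required instead of integrability because it is closed under products; on
  a probability space it gives integrability back.\<close>

definition nice :: "((nat \<Rightarrow> complex) \<Rightarrow> complex) \<Rightarrow> bool" where
  "nice f \<longleftrightarrow> (\<lambda>\<psi>. f (vec_index \<psi>)) \<in> borel_measurable \<mu> \<and>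
     (\<exists>B. \<forall>\<psi>\<in>unit_vecs N. cmod (f (vec_index \<psi>)) \<le> B)"

definition E :: "((nat \<Rightarrow> complex) \<Rightarrow> complex) \<Rightarrow> complex" where
  "E f = (\<integral>\<psi>. f (vec_index \<psi>) \<partial>\<mu>)"

lemma nice_integrable: "nice f \<Longrightarrow> integrable \<mu> (\<lambda>\<psi>. f (vec_index \<psi>))"
  unfolding nice_def by (auto intro!: integrable_const_bound AE_I2 simp: space_haar)

lemma nice_const [intro, simp]: "nice (\<lambda>_. c)"
  by (auto simp: nice_def)

lemma nice_coord: "i < N \<Longrightarrow> nice (\<lambda>x. x i)"
  by (auto simp: nice_def intro: measurable_coord unit_vec_coord_le)

lemma nice_cnj: "nice f \<Longrightarrow> nice (\<lambda>x. cnj (f x))"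
  unfolding nice_def
  by (auto intro: measurable_compose[OF _ borel_measurable_continuous_onI[OF continuous_on_cnj[OF continuous_on_id]]])

lemma nice_add:
  assumes "nice f" "nice g" shows "nice (\<lambda>x. f x + g x)"
proof -
  from assms obtain B C where B: "\<forall>\<psi>\<in>unit_vecs N. cmod (f (vec_index \<psi>)) \<le> B"
    "\<forall>\<psi>\<in>unit_vecs N. cmod (g (vec_index \<psi>)) \<le> C" unfolding nice_def by blast
  then have "\<forall>\<psi>\<in>unit_vecs N. cmod (f (vec_index \<psi>) + g (vec_index \<psi>)) \<le> B + C"
    by (auto intro: norm_triangle_le add_mono)
  moreover have "(\<lambda>\<psi>. f (vec_index \<psi>) + g (vec_index \<psi>)) \<in> borel_measurable \<mu>"
    using assms unfolding nice_def by (intro borel_measurable_add) auto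
  ultimately show ?thesis unfolding nice_def by blast
qed

lemma nice_mult:
  assumes "nice f" "nice g" shows "nice (\<lambda>x. f x * g x)"
proof -
  from assms obtain B C where B: "\<forall>\<psi>\<in>unit_vecs N. cmod (f (vec_index \<psi>)) \<le> B"
    "\<forall>\<psi>\<in>unit_vecs N. cmod (g (vec_index \<psi>)) \<le> C" unfolding nice_def by blast
  have "\<forall>\<psi>\<in>unit_vecs N. cmod (f (vec_index \<psi>) * g (vec_index \<psi>)) \<le> B * C"
  proof
    fix \<psi> assume "\<psi> \<in> unit_vecs N"
    with B have "cmod (f (vec_index \<psi>)) \<le> B" "cmod (g (vec_index \<psi>)) \<le> C" by auto
    then show "cmod (f (vec_index \<psi>) * g (vec_index \<psi>)) \<le> B * C"
      unfolding norm_mult by (intro mult_mono) (auto intro: order_trans[OF norm_ge_zero])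
  qed
  moreover have "(\<lambda>\<psi>. f (vec_index \<psi>) * g (vec_index \<psi>)) \<in> borel_measurable \<mu>"
    using assms unfolding nice_def by (intro borel_measurable_times) auto
  ultimately show ?thesis unfolding nice_def by blast
qed

lemma nice_diff: "nice f \<Longrightarrow> nice g \<Longrightarrow> nice (\<lambda>x. f x - g x)"
  using nice_add[of f "\<lambda>x. (-1) * g x"] nice_mult[of "\<lambda>_. -1" g] by simp

lemma nice_sum: "(\<And>i. i \<in> I \<Longrightarrow> nice (f i)) \<Longrightarrow> nice (\<lambda>x. \<Sum>i\<in>I. f i x)"
  by (induction I rule: infinite_finite_induct) (auto intro: nice_add)

lemma nice_hpoly: "hpoly N k f \<Longrightarrow> nice f"
  by (induction rule: hpoly.induct) (auto intro: nice_add nice_mult nice_coord)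

lemmas nice_intros = nice_const nice_coord nice_cnj nice_add nice_mult nice_diff nice_sum

lemma E_add: "nice f \<Longrightarrow> nice g \<Longrightarrow> E (\<lambda>x. f x + g x) = E f + E g"
  unfolding E_def by (intro Bochner_Integration.integral_add nice_integrable)

lemma E_diff: "nice f \<Longrightarrow> nice g \<Longrightarrow> E (\<lambda>x. f x - g x) = E f - E g"
  unfolding E_def by (intro Bochner_Integration.integral_diff nice_integrable)

lemma E_cmult: "E (\<lambda>x. c * f x) = c * E f"
  unfolding E_def by simp

lemma E_sum: "(\<And>i. i \<in> I \<Longrightarrow> nice (f i)) \<Longrightarrow> E (\<lambda>x. \<Sum>i\<in>I. f i x) = (\<Sum>i\<in>I. E (f i))"
  unfolding E_def by (intro Bochner_Integration.integral_sum nice_integrable)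

lemma E_cnj: "E (\<lambda>x. cnj (f x)) = cnj (E f)"
  unfolding E_def by simp

lemma E_cong: "(\<And>\<psi>. \<psi> \<in> unit_vecs N \<Longrightarrow> f (vec_index \<psi>) = g (vec_index \<psi>)) \<Longrightarrow> E f = E g"
  unfolding E_def by (intro Bochner_Integration.integral_cong) (auto simp: space_haar)

lemma unitary_unit_vecs:
  assumes U: "unitary_mat N U" and "\<psi> \<in> unit_vecs N"
  shows "U *\<^sub>v \<psi> \<in> unit_vecs N"
proof -
  have c: "U \<in> carrier_mat N N" "\<psi> \<in> carrier_vec N" "mat_adjoint U * U = 1\<^sub>m N"
    using assms by (auto simp: unitary_mat_def unit_vecs_def)
  have UU: "(\<Sum>a<N. cnj (U $$ (a, b)) * U $$ (a, c)) = (if b = c then 1 else 0)" if "b < N" "c < N" for b c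
  proof -
    have "(mat_adjoint U * U) $$ (b, c) = (\<Sum>a<N. cnj (U $$ (a, b)) * U $$ (a, c))"
      using c that mat_adjoint_carrier[OF c(1)]
      by (subst index_mult_mat_sum) (auto simp: mat_adjoint_index)
    then show ?thesis using c that by simp
  qed
  have ix: "(U *\<^sub>v \<psi>) $ a = (\<Sum>b<N. U $$ (a, b) * \<psi> $ b)" if "a < N" for a
    using c that by (auto simp: scalar_prod_def lessThan_atLeast0 intro!: sum.cong)
  have "(U *\<^sub>v \<psi>) \<bullet>c (U *\<^sub>v \<psi>) = (\<Sum>a<N. (U *\<^sub>v \<psi>) $ a * cnj ((U *\<^sub>v \<psi>) $ a))"
    using c by (auto simp: scalar_prod_def lessThan_atLeast0)
  also have "\<dots> = (\<Sum>a<N. (\<Sum>c<N. \<Sum>b<N. cnj (U $$ (a, b)) * U $$ (a, c) * (\<psi> $ c * cnj (\<psi> $ b))))"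
    by (intro sum.cong refl) (simp add: ix sum_product mult_ac)
  also have "\<dots> = (\<Sum>c<N. \<Sum>b<N. \<Sum>a<N. cnj (U $$ (a, b)) * U $$ (a, c) * (\<psi> $ c * cnj (\<psi> $ b)))"
    by (subst sum.swap, rule sum.cong[OF refl], rule sum.swap)
  also have "\<dots> = (\<Sum>c<N. \<Sum>b<N. (if b = c then 1 else 0) * (\<psi> $ c * cnj (\<psi> $ b)))"
    by (intro sum.cong refl) (simp add: UU flip: sum_distrib_right)
  also have "\<dots> = (\<Sum>c<N. \<psi> $ c * cnj (\<psi> $ c))"
    by (intro sum.cong refl) (simp add: if_distrib[of "\<lambda>u. u * _"] cong: if_cong)
  finally show ?thesis using c unit_vec_norm[OF assms(2)] by (simp add: unit_vecs_def)
qed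

lemma E_unitary:
  assumes U: "unitary_mat N U" and f: "nice f"
  shows "E f = (\<integral>\<psi>. f (vec_index (U *\<^sub>v \<psi>)) \<partial>\<mu>)"
    and "(\<lambda>\<psi>. f (vec_index (U *\<^sub>v \<psi>))) \<in> borel_measurable \<mu>"
proof -
  have c: "U \<in> carrier_mat N N" using U by (auto simp: unitary_mat_def)
  have T: "(\<lambda>\<psi>. U *\<^sub>v \<psi>) \<in> measurable \<mu> \<mu>"
  proof (rule measurable_into_haar)
    fix i assume i: "i < N"
    have "(\<lambda>\<psi>. \<Sum>b<N. U $$ (i, b) * \<psi> $ b) \<in> borel_measurable \<mu>"
      by (intro borel_measurable_sum borel_measurable_times measurable_coord) auto
    then show "(\<lambda>\<psi>. (U *\<^sub>v \<psi>) $ i) \<in> borel_measurable \<mu>"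
      by (rule measurable_cong[THEN iffD1, rotated])
        (use c i in \<open>auto simp: space_haar unit_vecs_def scalar_prod_def lessThan_atLeast0 intro!: sum.cong\<close>)
  qed (use unitary_unit_vecs[OF U] in \<open>auto simp: space_haar\<close>)
  have m: "(\<lambda>\<psi>. f (vec_index \<psi>)) \<in> borel_measurable \<mu>" using f by (simp add: nice_def)
  have d: "distr \<mu> \<mu> (\<lambda>\<psi>. U *\<^sub>v \<psi>) = \<mu>"
    using haar U by (auto simp: haar_state_measure_def)
  have "E f = (\<integral>\<psi>. f (vec_index \<psi>) \<partial>(distr \<mu> \<mu> (\<lambda>\<psi>. U *\<^sub>v \<psi>)))"
    unfolding d E_def ..
  also have "\<dots> = (\<integral>\<psi>. f (vec_index (U *\<^sub>v \<psi>)) \<partial>\<mu>)"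
    by (rule integral_distr[OF T m])
  finally show "E f = (\<integral>\<psi>. f (vec_index (U *\<^sub>v \<psi>)) \<partial>\<mu>)" .
  show "(\<lambda>\<psi>. f (vec_index (U *\<^sub>v \<psi>))) \<in> borel_measurable \<mu>"
    using measurable_compose[OF T m] .
qed

text \<open>Invariance under \<open>phase_mat N z v\<close>, to first order as \<open>z \<longlongrightarrow> 1\<close>: with \<open>s = z - 1\<close> it gives
  \<open>s A + cnj s B = O(\<bar>s\<bar>\<^sup>2)\<close>, and \<open>cnj s = - s cnj z\<close> on the unit circle.\<close>

lemma hpoly_adjoint_phase:
  assumes f: "hpoly N p f" and g: "hpoly N q g" and v: "(\<Sum>a<N. v a * cnj (v a)) = 1"
  defines "c \<equiv> \<lambda>x. \<Sum>b<N. cnj (v b) * x b"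
  shows "E (\<lambda>x. (\<Sum>a<N. v a * c x * pd a f x) * cnj (g x)) =
         E (\<lambda>x. f x * cnj (\<Sum>a<N. v a * c x * pd a g x))"
proof -
  define f1 where "f1 x = (\<Sum>a<N. v a * c x * pd a f x)" for x
  define g1 where "g1 x = (\<Sum>a<N. v a * c x * pd a g x)" for x
  define A where "A = E (\<lambda>x. f1 x * cnj (g x))"
  define B where "B = E (\<lambda>x. f x * cnj (g1 x))"
  have nc: "nice c" unfolding c_def by (intro nice_intros) auto
  have nf: "nice f" "nice g" using f g by (auto intro: nice_hpoly)
  have nf1: "nice f1" "nice g1" unfolding f1_def g1_def
    by (intro nice_intros nc nice_hpoly[OF hpoly_pd[OF f]] nice_hpoly[OF hpoly_pd[OF g]])+
  obtain Mf where Mf: "\<And>\<psi>. \<psi> \<in> unit_vecs N \<Longrightarrow> cmod (f (vec_index \<psi>)) \<le> Mf"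
    using nf(1) unfolding nice_def by blast
  obtain Mg where Mg: "\<And>\<psi>. \<psi> \<in> unit_vecs N \<Longrightarrow> cmod (g (vec_index \<psi>)) \<le> Mg"
    using nf(2) unfolding nice_def by blast
  obtain F1 where F1: "\<And>\<psi>. \<psi> \<in> unit_vecs N \<Longrightarrow> cmod (f1 (vec_index \<psi>)) \<le> F1"
    using nf1(1) unfolding nice_def by blast
  obtain G1 where G1: "\<And>\<psi>. \<psi> \<in> unit_vecs N \<Longrightarrow> cmod (g1 (vec_index \<psi>)) \<le> G1"
    using nf1(2) unfolding nice_def by blast
  obtain Bf where Bf: "\<And>s x. cmod s \<le> 2 \<Longrightarrow> (\<forall>i<N. cmod (x i) \<le> 1) \<Longrightarrow>
      cmod (f (\<lambda>a. x a + s * (v a * c x)) - f x - s * f1 x) \<le> Bf * (cmod s)\<^sup>2"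
    using hpoly_taylor[OF f, of v] unfolding f1_def c_def by blast
  obtain Bg where Bg: "\<And>s x. cmod s \<le> 2 \<Longrightarrow> (\<forall>i<N. cmod (x i) \<le> 1) \<Longrightarrow>
      cmod (g (\<lambda>a. x a + s * (v a * c x)) - g x - s * g1 x) \<le> Bg * (cmod s)\<^sup>2"
    using hpoly_taylor[OF g, of v] unfolding g1_def c_def by blast
  define C where "C = F1 * G1 + Bf * Mg + (Mf + 2 * F1) * Bg"
  have key: "cmod ((z - 1) * A + cnj (z - 1) * B) \<le> C * (cmod (z - 1))\<^sup>2" if z: "cmod z = 1" for z
  proof -
    define s where "s = z - 1"
    define y where "y x = (\<lambda>a. x a + s * (v a * c x))" for x
    define U where "U = phase_mat N z v"
    have U: "unitary_mat N U" unfolding U_def by (rule unitary_phase_mat[OF v z])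
    have s2: "cmod s \<le> 2" unfolding s_def using norm_triangle_ineq4[of z 1] z by simp
    have Ui: "vec_index (U *\<^sub>v \<psi>) a = y (vec_index \<psi>) a" if "\<psi> \<in> unit_vecs N" "a < N" for \<psi> a
    proof -
      have "vec_index (U *\<^sub>v \<psi>) a = (\<Sum>b<N. ((if a = b then 1 else 0) + s * v a * cnj (v b)) * \<psi> $ b)"
        using that by (auto simp: U_def phase_mat_def s_def scalar_prod_def lessThan_atLeast0 unit_vecs_def)
      also have "\<dots> = (\<Sum>b<N. (if a = b then \<psi> $ b else 0) + s * v a * (cnj (v b) * \<psi> $ b))"
        by (intro sum.cong refl) (simp add: algebra_simps)
      finally show ?thesis using that(2)
        by (simp add: sum.distrib y_def c_def mult.assoc flip: sum_distrib_left)
    qed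
    have fU: "f (vec_index (U *\<^sub>v \<psi>)) = f (y (vec_index \<psi>))" "g (vec_index (U *\<^sub>v \<psi>)) = g (y (vec_index \<psi>))"
      if "\<psi> \<in> unit_vecs N" for \<psi>
      using Ui[OF that] by (intro hpoly_cong[OF f] hpoly_cong[OF g]; simp)+
    define H where "H x = f (y x) * cnj (g (y x))" for x
    define R where "R x = H x - f x * cnj (g x) - s * (f1 x * cnj (g x)) - cnj s * (f x * cnj (g1 x))" for x
    have nfg: "nice (\<lambda>x. f x * cnj (g x))" by (intro nice_intros nf)
    have EH: "E H = E (\<lambda>x. f x * cnj (g x))"
      unfolding E_unitary(1)[OF U nfg] unfolding E_def H_def
      by (intro Bochner_Integration.integral_cong refl) (simp add: fU space_haar)
    have nH: "nice H" unfolding nice_def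
    proof
      show "(\<lambda>\<psi>. H (vec_index \<psi>)) \<in> borel_measurable \<mu>"
        by (rule measurable_cong[THEN iffD1, OF _ E_unitary(2)[OF U nfg]])
          (simp add: H_def fU space_haar)
      have "cmod (H (vec_index \<psi>)) \<le> Mf * Mg" if "\<psi> \<in> unit_vecs N" for \<psi>
        unfolding H_def fU[OF that, symmetric] norm_mult complex_mod_cnj
        by (rule mult_mono'[OF Mf Mg]) (use unitary_unit_vecs[OF U that] in auto)
      then show "\<exists>B. \<forall>\<psi>\<in>unit_vecs N. cmod (H (vec_index \<psi>)) \<le> B" by blast
    qed
    have nR: "nice R" unfolding R_def by (intro nice_intros nH nf nf1)
    have ER: "E R = - (s * A + cnj s * B)"
    proof -
      have "E R = E H - E (\<lambda>x. f x * cnj (g x)) - s * E (\<lambda>x. f1 x * cnj (g x)) - cnj s * E (\<lambda>x. f x * cnj (g1 x))"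
        unfolding R_def by (subst E_diff E_cmult, (intro nice_intros nH nf nf1)+)+ (simp add: E_cmult)
      then show ?thesis by (simp add: EH A_def B_def)
    qed
    have "cmod (R (vec_index \<psi>)) \<le> C * (cmod s)\<^sup>2" if psi: "\<psi> \<in> unit_vecs N" for \<psi>
    proof -
      define x where "x = vec_index \<psi>"
      have x1: "\<forall>i<N. cmod (x i) \<le> 1" using unit_vec_coord_le[OF psi] by (simp add: x_def)
      \<comment> \<open>The terms of order zero and one cancel exactly. Each remaining summand is of
        order \<open>(cmod s)^2\<close>: a product of two first-order terms, or a Taylor remainder
        of \<open>f\<close> or \<open>g\<close> times a bounded factor.\<close>
      have e: "R x = (s * cnj s) * (f1 x * cnj (g1 x)) + (f (y x) - f x - s * f1 x) * cnj (g (y x))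
         + (f x + s * f1 x) * cnj (g (y x) - g x - s * g1 x)"
        unfolding R_def H_def by (simp add: algebra_simps)
      have gy: "cmod (cnj (g (y x))) \<le> Mg"
        using Mg[OF unitary_unit_vecs[OF U psi]] fU[OF psi] by (simp add: x_def)
      have b1: "cmod ((s * cnj s) * (f1 x * cnj (g1 x))) \<le> (cmod s)\<^sup>2 * (F1 * G1)"
        unfolding norm_mult complex_mod_cnj power2_eq_square x_def
        by (intro mult_left_mono mult_mono' F1 G1 psi) auto
      have b2: "cmod ((f (y x) - f x - s * f1 x) * cnj (g (y x))) \<le> (Bf * (cmod s)\<^sup>2) * Mg"
        unfolding norm_mult using gy Bf[OF s2 x1] by (intro mult_mono') (auto simp: y_def)
      have "cmod (f x + s * f1 x) \<le> Mf + 2 * F1"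
        using norm_triangle_ineq[of "f x" "s * f1 x"] Mf[OF psi]
          mult_mono'[OF s2 F1[OF psi]] by (auto simp: norm_mult x_def)
      then have b3: "cmod ((f x + s * f1 x) * cnj (g (y x) - g x - s * g1 x)) \<le> (Mf + 2 * F1) * (Bg * (cmod s)\<^sup>2)"
        unfolding norm_mult complex_mod_cnj using Bg[OF s2 x1] by (intro mult_mono') (auto simp: y_def)
      have "cmod (R x) \<le> (cmod s)\<^sup>2 * (F1 * G1) + (Bf * (cmod s)\<^sup>2) * Mg + (Mf + 2 * F1) * (Bg * (cmod s)\<^sup>2)"
        unfolding e by (intro norm_triangle_le add_mono b1 b2 b3)
      then show ?thesis by (simp add: C_def algebra_simps x_def)
    qed
    then have "cmod (E R) \<le> C * (cmod s)\<^sup>2"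
      unfolding E_def
      by (intro order_trans[OF integral_norm_bound] integral_le_const integrable_norm nice_integrable nR AE_I2)
        (auto simp: space_haar)
    then show ?thesis unfolding ER norm_minus_cancel s_def .
  qed
  have bd: "cmod (A - B) \<le> (C + cmod B) * cmod (cis e - 1)" if e: "0 < e" "e < 1" for e :: real
  proof -
    define z where "z = cis e"
    have z: "cmod z = 1" "z * cnj z = 1" by (auto simp: z_def cis_mult cis_cnj)
    have "sin e > 0" using e pi_gt3 by (intro sin_gt_zero) auto
    then have z1: "z \<noteq> 1" by (auto simp: z_def complex_eq_iff)
    have "(z - 1) * (A - cnj z * B) = (z - 1) * A + cnj (z - 1) * B"
      using z(2) by (simp add: algebra_simps)
    then have "cmod (z - 1) * cmod (A - cnj z * B) \<le> C * (cmod (z - 1))\<^sup>2"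
      using key[OF z(1)] by (simp flip: norm_mult)
    then have 1: "cmod (A - cnj z * B) \<le> C * cmod (z - 1)"
      using z1 by (simp add: power2_eq_square field_simps)
    have "cmod (A - B) \<le> cmod (A - cnj z * B) + cmod (z - 1) * cmod B"
      using norm_triangle_ineq[of "A - cnj z * B" "cnj (z - 1) * B"]
      by (simp only: norm_mult complex_mod_cnj) (simp add: algebra_simps)
    then show ?thesis using 1 unfolding z_def distrib_right by (simp only: mult.commute[of "cmod (cis e - 1)"])
  qed
  have lim: "((\<lambda>e. (C + cmod B) * cmod (cis e - 1)) \<longlongrightarrow> (C + cmod B) * cmod (cis 0 - 1)) (at_right 0)"
    by (intro tendsto_intros)
  have "eventually (\<lambda>e. cmod (A - B) \<le> (C + cmod B) * cmod (cis e - 1)) (at_right 0)"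
    unfolding eventually_at_right_field by (intro exI[of _ 1]) (use bd in auto)
  then have "cmod (A - B) \<le> (C + cmod B) * cmod (cis 0 - 1)"
    by (intro tendsto_lowerbound[OF lim]) auto
  then show ?thesis by (simp add: A_def B_def f1_def g1_def)
qed

text \<open>By polarisation: the operators \<open>x\<^sub>j \<partial>\<^sub>i\<close> and \<open>x\<^sub>i \<partial>\<^sub>j\<close> are adjoint in \<open>L\<^sup>2\<close> of the sphere.\<close>

lemma hpoly_adjoint:
  assumes f: "hpoly N p f" and g: "hpoly N q g" and ij: "i < N" "j < N"
  shows "E (\<lambda>x. x j * pd i f x * cnj (g x)) = E (\<lambda>x. f x * cnj (x i * pd j g x))"
proof -
  define Z where "Z a b = E (\<lambda>x. x b * pd a f x * cnj (g x)) - E (\<lambda>x. f x * cnj (x a * pd b g x))" for a b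
  have nf: "nice f" "nice g" "nice (pd a f)" "nice (pd a g)" for a
    using f g by (auto intro: nice_hpoly hpoly_pd)
  have Q: "(\<Sum>a<N. \<Sum>b<N. v a * cnj (v b) * Z a b) = 0" if v: "(\<Sum>a<N. v a * cnj (v a)) = 1" for v
  proof -
    have "E (\<lambda>x. (\<Sum>a<N. v a * (\<Sum>b<N. cnj (v b) * x b) * pd a f x) * cnj (g x))
        = E (\<lambda>x. \<Sum>a<N. \<Sum>b<N. v a * cnj (v b) * (x b * pd a f x * cnj (g x)))"
      by (intro E_cong) (simp add: sum_distrib_left sum_distrib_right mult_ac)
    also have "\<dots> = (\<Sum>a<N. \<Sum>b<N. v a * cnj (v b) * E (\<lambda>x. x b * pd a f x * cnj (g x)))"
      by (subst E_sum, intro nice_intros nf, simp)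
        (intro sum.cong refl, subst E_sum, intro nice_intros nf, auto simp: E_cmult)
    finally have 1: "E (\<lambda>x. (\<Sum>a<N. v a * (\<Sum>b<N. cnj (v b) * x b) * pd a f x) * cnj (g x)) = \<dots>" .
    have "E (\<lambda>x. f x * cnj (\<Sum>b<N. v b * (\<Sum>a<N. cnj (v a) * x a) * pd b g x))
        = E (\<lambda>x. \<Sum>b<N. \<Sum>a<N. v a * cnj (v b) * (f x * cnj (x a * pd b g x)))"
      by (intro E_cong) (simp add: sum_distrib_left sum_distrib_right mult_ac)
    also have "\<dots> = (\<Sum>b<N. \<Sum>a<N. v a * cnj (v b) * E (\<lambda>x. f x * cnj (x a * pd b g x)))"
      by (subst E_sum, intro nice_intros nf, simp)
        (intro sum.cong refl, subst E_sum, intro nice_intros nf, auto simp: E_cmult)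
    also have "\<dots> = (\<Sum>a<N. \<Sum>b<N. v a * cnj (v b) * E (\<lambda>x. f x * cnj (x a * pd b g x)))"
      by (rule sum.swap)
    finally have 2: "E (\<lambda>x. f x * cnj (\<Sum>b<N. v b * (\<Sum>a<N. cnj (v a) * x a) * pd b g x)) = \<dots>" .
    show ?thesis
      using hpoly_adjoint_phase[OF f g v] unfolding 1 2 Z_def
      by (simp add: right_diff_distrib sum_subtractf)
  qed
  have diag: "Z a a = 0" if "a < N" for a
  proof -
    have "(\<Sum>b<N. (if b = a then 1 else 0) * cnj (if b = a then 1 else 0)) = (1 :: complex)"
      using that by (simp add: if_distrib[of "\<lambda>u. u * _"] cong: if_cong)
    from Q[OF this] show ?thesis
      using that by (simp add: if_distrib[of "\<lambda>u. u * _"] if_distrib[of cnj] if_distrib[of "\<lambda>u. _ * u"] cong: if_cong)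
  qed
  have "Z i j = 0"
  proof (cases "i = j")
    case True
    with diag ij show ?thesis by simp
  next
    case False
    have off: "cnj w * Z i j + w * Z j i = 0" if w: "cmod w = 1" for w
    proof -
      \<comment> \<open>With this unit vector the diagonal terms of the quadratic form vanish by
        \<open>diag\<close>, and only the two mixed terms remain.\<close>
      define v where "v a = (if a = i then 1 / sqrt 2 else 0) + (if a = j then w / sqrt 2 else 0)" for a
      have ww: "w * cnj w = 1" using w by (simp add: complex_norm_square[symmetric])
      have sq: "complex_of_real (sqrt 2) * complex_of_real (sqrt 2) = 2"
        by (metis of_real_mult of_real_numeral real_sqrt_mult_self abs_numeral)
      have two: "(\<Sum>a<N. h a) = h i + h j" if "\<And>a. a \<noteq> i \<Longrightarrow> a \<noteq> j \<Longrightarrow> h a = 0" for h :: "nat \<Rightarrow> complex"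
      proof -
        have "(\<Sum>a<N. h a) = (\<Sum>a\<in>{i, j}. h a)"
          using ij that by (intro sum.mono_neutral_right) auto
        then show ?thesis using False by simp
      qed
      have vij: "v i = 1 / sqrt 2" "v j = w / sqrt 2" "\<And>a. a \<noteq> i \<Longrightarrow> a \<noteq> j \<Longrightarrow> v a = 0"
        using False by (auto simp: v_def)
      have v1: "(\<Sum>a<N. v a * cnj (v a)) = 1"
        by (subst two) (auto simp: vij sq ww)
      have "(\<Sum>b<N. v a * cnj (v b) * Z a b) = v a * cnj (v i) * Z a i + v a * cnj (v j) * Z a j" for a
        by (rule two) (simp add: vij)
      with Q[OF v1] have "(\<Sum>a<N. v a * cnj (v i) * Z a i + v a * cnj (v j) * Z a j) = 0" by simp
      then have "v i * cnj (v i) * Z i i + v i * cnj (v j) * Z i j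
          + (v j * cnj (v i) * Z j i + v j * cnj (v j) * Z j j) = 0"
        by (subst (asm) two) (simp_all add: vij)
      then show ?thesis using diag ij by (simp add: vij sq add_divide_distrib[symmetric])
    qed
    \<comment> \<open>The phase \<open>w = 1\<close> controls the sum of the two mixed terms and
      \<open>w = \<i>\<close> their difference, so both vanish.\<close>
    from off[of 1] off[of \<i>] have "Z i j + Z j i = 0" "- \<i> * Z i j + \<i> * Z j i = 0" by auto
    then have "\<i> * (Z i j + Z j i) - (- \<i> * Z i j + \<i> * Z j i) = 0" by simp
    then have "2 * \<i> * Z i j = 0" by (simp add: algebra_simps)
    then show ?thesis by simp
  qed
  then show ?thesis by (simp add: Z_def)
qed

text \<open>Inserting the factor 1 as the sum of all \<open>x j * cnj (x j)\<close> creates terms to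
  which \<open>hpoly_adjoint\<close> applies. The derivative of \<open>f\<close> in direction
  \<open>i\<close> is thereby traded for the sum of \<open>pd j\<close> of \<open>x j * g\<close>,
  which Euler's identity evaluates to \<open>N + p\<close> times \<open>g\<close>.\<close>

lemma hpoly_parts:
  assumes f: "hpoly N (Suc p) f" and g: "hpoly N p g" and i: "i < N"
  shows "of_nat (N + p) * E (\<lambda>x. cnj (x i) * f x * cnj (g x)) = E (\<lambda>x. pd i f x * cnj (g x))"
proof -
  have nf: "nice f" "nice g" "nice (pd a f)" "nice (pd a g)" for a
    using f g by (auto intro: nice_hpoly hpoly_pd)
  have "E (\<lambda>x. pd i f x * cnj (g x)) = E (\<lambda>x. \<Sum>j<N. x j * pd i f x * cnj (x j * g x))"
  proof (rule E_cong)
    fix \<psi> assume "\<psi> \<in> unit_vecs N"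
    let ?x = "vec_index \<psi>"
    have "(\<Sum>j<N. ?x j * pd i f ?x * cnj (?x j * g ?x)) = pd i f ?x * cnj (g ?x) * (\<Sum>j<N. ?x j * cnj (?x j))"
      by (simp add: sum_distrib_left mult_ac)
    then show "pd i f ?x * cnj (g ?x) = (\<Sum>j<N. ?x j * pd i f ?x * cnj (?x j * g ?x))"
      using unit_vec_norm(2)[OF \<open>\<psi> \<in> unit_vecs N\<close>] by simp
  qed
  also have "\<dots> = (\<Sum>j<N. E (\<lambda>x. x j * pd i f x * cnj (x j * g x)))"
    by (rule E_sum) (intro nice_intros nf, auto)
  also have "\<dots> = (\<Sum>j<N. E (\<lambda>x. f x * cnj (x i * pd j (\<lambda>x. x j * g x) x)))"
    by (intro sum.cong refl) (rule hpoly_adjoint[OF f hpoly_times[OF _ g] i], auto)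
  also have "\<dots> = (\<Sum>j<N. E (\<lambda>x. f x * cnj (x i * (g x + x j * pd j g x))))"
    by (simp add: pd_times[OF g])
  also have "\<dots> = E (\<lambda>x. \<Sum>j<N. f x * cnj (x i * (g x + x j * pd j g x)))"
    by (rule E_sum[symmetric]) (intro nice_intros nf i, auto)
  also have "\<dots> = E (\<lambda>x. of_nat (N + p) * (cnj (x i) * f x * cnj (g x)))"
  proof (rule E_cong)
    fix \<psi> :: "complex vec"
    let ?x = "vec_index \<psi>"
    have "(\<Sum>j<N. f ?x * cnj (?x i * (g ?x + ?x j * pd j g ?x)))
        = f ?x * cnj (?x i * (\<Sum>j<N. g ?x + ?x j * pd j g ?x))"
      by (simp only: sum_distrib_left cnj_sum)
    moreover have "(\<Sum>j<N. g ?x + ?x j * pd j g ?x) = of_nat (N + p) * g ?x"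
      by (simp add: sum.distrib euler_identity[OF g] algebra_simps)
    ultimately show "(\<Sum>j<N. f ?x * cnj (?x i * (g ?x + ?x j * pd j g ?x))) = of_nat (N + p) * (cnj (?x i) * f ?x * cnj (g ?x))"
      by (simp add: mult_ac)
  qed
  finally show ?thesis by (simp add: E_cmult)
qed

end

section \<open>Projecting vector fields onto the state\<close>

lemma sum_lessThan_mult: "(\<Sum>x<a * b. f x) = (\<Sum>i<a. \<Sum>j<b. f (i * b + j))" for f :: "nat \<Rightarrow> 'a::comm_monoid_add"
proof (induction a)
  case (Suc a)
  have "(\<Sum>x<Suc a * b. f x) = (\<Sum>x<a * b. f x) + (\<Sum>x\<in>{a * b..<a * b + b}. f x)"
    unfolding lessThan_atLeast0 by (subst sum.atLeastLessThan_concat) (auto simp: add.commute)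
  also have "(\<Sum>x\<in>{a * b..<a * b + b}. f x) = (\<Sum>j<b. f (a * b + j))"
    using sum.shift_bounds_nat_ivl[of f 0 "a * b" b] by (simp add: lessThan_atLeast0 add.commute)
  finally show ?case using Suc by simp
qed simp

lemma mult_add_less: "i < a \<Longrightarrow> j < b \<Longrightarrow> i * b + j < a * (b :: nat)"
proof -
  assume "i < a" "j < b"
  then have "i * b + j < Suc i * b" "Suc i * b \<le> a * b" by (simp, intro mult_le_mono1, simp)
  then show ?thesis by linarith
qed

lemma div_mult_add: "j < b \<Longrightarrow> (i * b + j) div b = i" for b :: nat
  by (simp add: add.commute div_plus_div_distrib_dvd_right)

lemma mod_mult_add: "j < b \<Longrightarrow> (i * b + j) mod b = j" for b :: nat
  by simp

lemma cauchy_schwarz_complex: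
  "(cmod (\<Sum>i\<in>I. f i * g i))\<^sup>2 \<le> (\<Sum>i\<in>I. (cmod (f i))\<^sup>2) * (\<Sum>i\<in>I. (cmod (g i))\<^sup>2)"
proof -
  have "cmod (\<Sum>i\<in>I. f i * g i) \<le> (\<Sum>i\<in>I. cmod (f i) * cmod (g i))"
    by (intro sum_norm_le) (simp add: norm_mult)
  then have "(cmod (\<Sum>i\<in>I. f i * g i))\<^sup>2 \<le> (\<Sum>i\<in>I. cmod (f i) * cmod (g i))\<^sup>2"
    by (intro power_mono) auto
  also have "\<dots> \<le> (\<Sum>i\<in>I. (cmod (f i))\<^sup>2) * (\<Sum>i\<in>I. (cmod (g i))\<^sup>2)"
    by (rule Cauchy_Schwarz_ineq_sum)
  finally show ?thesis .
qed

text \<open>Coordinates of the \<open>k\<close>-fold tensor power of \<open>x\<close>. The most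
  significant digit of the index belongs to the first factor, as in
  \<open>tensor_power\<close>.\<close>

primrec tpow :: "nat \<Rightarrow> (nat \<Rightarrow> complex) \<Rightarrow> nat \<Rightarrow> nat \<Rightarrow> complex" where
  "tpow N x 0 I = 1"
| "tpow N x (Suc k) I = x (I div N ^ k) * tpow N x k (I mod N ^ k)"

lemma hpoly_tpow: "I < N ^ k \<Longrightarrow> hpoly N k (\<lambda>x. tpow N x k I)"
proof (induction k arbitrary: I)
  case (Suc k)
  then have "I div N ^ k < N" "N ^ k > 0"
    by (auto simp: less_mult_imp_div_less intro: gr0I)
  then show ?case using Suc.IH[of "I mod N ^ k"] by (auto intro: hpoly_times)
qed (simp add: hpoly_const)

lemma tpow_Suc_index: "J < N ^ k \<Longrightarrow> tpow N x (Suc k) (j * N ^ k + J) = x j * tpow N x k J"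
  by (simp only: tpow.simps div_mult_add mod_mult_add)

lemma sum_tpow: "(\<Sum>I<N ^ k. tpow N x k I * cnj (tpow N y k I)) = (\<Sum>i<N. x i * cnj (y i)) ^ k"
proof (induction k)
  case (Suc k)
  have "(\<Sum>I<N ^ Suc k. tpow N x (Suc k) I * cnj (tpow N y (Suc k) I))
      = (\<Sum>i<N. \<Sum>J<N ^ k. x i * cnj (y i) * (tpow N x k J * cnj (tpow N y k J)))"
    unfolding power_Suc sum_lessThan_mult
    by (intro sum.cong refl) (simp add: mult_ac)
  then show ?case using Suc by (simp add: flip: sum_distrib_left sum_distrib_right)
qed simp

section \<open>Mean squares, divergence-free fields and the cloning bound\<close>

context haar_states begin

lemma E_sum2:
  assumes "\<And>i j. i \<in> I \<Longrightarrow> j \<in> J \<Longrightarrow> nice (f i j)"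
  shows "E (\<lambda>x. \<Sum>i\<in>I. \<Sum>j\<in>J. f i j x) = (\<Sum>i\<in>I. \<Sum>j\<in>J. E (f i j))"
  using assms by (subst E_sum) (auto intro!: nice_sum sum.cong E_sum)

definition msq :: "((nat \<Rightarrow> complex) \<Rightarrow> complex) \<Rightarrow> real" where
  "msq f = (\<integral>\<psi>. (cmod (f (vec_index \<psi>)))\<^sup>2 \<partial>\<mu>)"

lemma integrable_msq:
  assumes "nice f" shows "integrable \<mu> (\<lambda>\<psi>. (cmod (f (vec_index \<psi>)))\<^sup>2)"
proof -
  have "integrable \<mu> (\<lambda>\<psi>. Re (f (vec_index \<psi>) * cnj (f (vec_index \<psi>))))"
    using assms by (intro integrable_Re nice_integrable[where f = "\<lambda>x. f x * cnj (f x)"] nice_intros)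
  then show ?thesis by (simp flip: complex_norm_square)
qed

lemma msq_E: "complex_of_real (msq f) = E (\<lambda>x. f x * cnj (f x))"
  unfolding msq_def E_def by (simp only: integral_complex_of_real[symmetric] complex_norm_square)

lemma msq_nonneg: "msq f \<ge> 0"
  unfolding msq_def by (intro integral_nonneg_AE) auto

lemma msq_zero [simp]: "msq (\<lambda>_. 0) = 0"
  by (simp add: msq_def)

lemma tpow_norm:
  assumes "\<psi> \<in> unit_vecs N"
  shows "(\<Sum>I<N ^ k. (cmod (tpow N (vec_index \<psi>) k I))\<^sup>2) = 1"
proof -
  have "complex_of_real (\<Sum>I<N ^ k. (cmod (tpow N (vec_index \<psi>) k I))\<^sup>2) = 1"
    using sum_tpow[of N "vec_index \<psi>" k "vec_index \<psi>"] unit_vec_norm(2)[OF assms]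
    by (simp add: complex_norm_square del: of_real_power)
  then show ?thesis by (metis of_real_eq_1_iff)
qed

text \<open>Expand the square and integrate by parts in \<open>cnj (x i)\<close>, differentiating
  \<open>x j * \<phi> i\<close>, which has degree \<open>k + 1\<close>. The derivative of the factor
  \<open>x j\<close> leaves the squared norm of the field; the derivatives of
  \<open>\<phi> i\<close> add up to a multiple of the divergence.\<close>

lemma msq_divergence_free:
  assumes phi: "\<And>i. i < N \<Longrightarrow> hpoly N k (\<phi> i)"
    and div: "\<And>x. (\<Sum>i<N. pd i (\<phi> i) x) = 0"
  shows "real (N + k) * msq (\<lambda>x. \<Sum>i<N. cnj (x i) * \<phi> i x) = (\<Sum>i<N. msq (\<phi> i))"
proof -
  have nf: "nice (\<phi> i)" "nice (pd j (\<phi> i))" if "i < N" for i j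
    using phi[OF that] by (auto intro: nice_hpoly hpoly_pd)
  have "E (\<lambda>x. (\<Sum>i<N. cnj (x i) * \<phi> i x) * cnj (\<Sum>i<N. cnj (x i) * \<phi> i x))
      = E (\<lambda>x. \<Sum>i<N. \<Sum>j<N. cnj (x i) * (x j * \<phi> i x) * cnj (\<phi> j x))"
    by (simp only: cnj_sum sum_product) (simp add: mult_ac)
  also have "\<dots> = (\<Sum>i<N. \<Sum>j<N. E (\<lambda>x. cnj (x i) * (x j * \<phi> i x) * cnj (\<phi> j x)))"
    by (rule E_sum2) (auto intro!: nice_intros nf)
  finally have "of_nat (N + k) * E (\<lambda>x. (\<Sum>i<N. cnj (x i) * \<phi> i x) * cnj (\<Sum>i<N. cnj (x i) * \<phi> i x))
      = (\<Sum>i<N. \<Sum>j<N. of_nat (N + k) * E (\<lambda>x. cnj (x i) * (x j * \<phi> i x) * cnj (\<phi> j x)))"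
    by (simp only: sum_distrib_left)
  also have "\<dots> = (\<Sum>i<N. \<Sum>j<N. E (\<lambda>x. pd i (\<lambda>x. x j * \<phi> i x) x * cnj (\<phi> j x)))"
    by (intro sum.cong refl hpoly_parts hpoly_times phi) auto
  also have "\<dots> = (\<Sum>i<N. \<Sum>j<N. E (\<lambda>x. ((if j = i then \<phi> i x else 0) + x j * pd i (\<phi> i) x) * cnj (\<phi> j x)))"
    by (intro sum.cong refl) (simp add: pd_times[OF phi])
  also have "\<dots> = E (\<lambda>x. \<Sum>i<N. \<Sum>j<N. ((if j = i then \<phi> i x else 0) + x j * pd i (\<phi> i) x) * cnj (\<phi> j x))"
  proof -
    have "nice (\<lambda>x. ((if j = i then \<phi> i x else 0) + x j * pd i (\<phi> i) x) * cnj (\<phi> j x))" if "i < N" "j < N" for i j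
      using that by (cases "j = i") (auto intro!: nice_intros nf)
    then show ?thesis
      by (intro E_sum2[symmetric]) auto
  qed
  also have "\<dots> = E (\<lambda>x. \<Sum>i<N. \<phi> i x * cnj (\<phi> i x))"
  proof (rule E_cong)
    fix \<psi> :: "complex vec"
    let ?x = "vec_index \<psi>"
    have "(\<Sum>i<N. \<Sum>j<N. ((if j = i then \<phi> i ?x else 0) + ?x j * pd i (\<phi> i) ?x) * cnj (\<phi> j ?x))
      = (\<Sum>i<N. \<Sum>j<N. (if j = i then \<phi> i ?x * cnj (\<phi> i ?x) else 0))
        + (\<Sum>i<N. pd i (\<phi> i) ?x * (\<Sum>j<N. ?x j * cnj (\<phi> j ?x)))"
      by (subst sum.distrib[symmetric], rule sum.cong[OF refl], simp only: sum_distrib_left,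
          subst sum.distrib[symmetric], rule sum.cong[OF refl]) (simp add: algebra_simps)
    also have "(\<Sum>i<N. pd i (\<phi> i) ?x * (\<Sum>j<N. ?x j * cnj (\<phi> j ?x))) = 0"
      by (simp only: sum_distrib_right[symmetric] div mult_zero_left)
    finally show "(\<Sum>i<N. \<Sum>j<N. ((if j = i then \<phi> i ?x else 0) + ?x j * pd i (\<phi> i) ?x) * cnj (\<phi> j ?x))
      = (\<Sum>i<N. \<phi> i ?x * cnj (\<phi> i ?x))" by simp
  qed
  also have "\<dots> = (\<Sum>i<N. E (\<lambda>x. \<phi> i x * cnj (\<phi> i x)))"
    by (rule E_sum) (auto intro!: nice_intros nf)
  finally have "complex_of_real (real (N + k) * msq (\<lambda>x. \<Sum>i<N. cnj (x i) * \<phi> i x)) = complex_of_real (\<Sum>i<N. msq (\<phi> i))"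
    by (simp only: of_real_mult of_real_sum msq_E of_real_of_nat_eq)
  then show ?thesis by (simp only: of_real_eq_iff)
qed

text \<open>Here \<open>d\<close> is \<open>(\<Sum>i<N. pd i (\<phi> i)) / (N + k - 1)\<close>, the orthogonal projection of \<open>\<langle>x, \<phi>\<rangle>\<close> to the
  holomorphic polynomials. The reflection in \<open>x\<close> thus nearly coincides on \<open>\<phi>\<close> with the isometry
  \<open>\<phi> \<mapsto> \<phi> - 2 x d\<close>, which preserves the degree.\<close>

lemma hpoly_split:
  assumes phi: "\<And>i. i < N \<Longrightarrow> hpoly N k (\<phi> i)"
  obtains d where "hpoly N (k - 1) d" "k = 0 \<Longrightarrow> d = (\<lambda>_. 0)" "\<And>i. i < N \<Longrightarrow> hpoly N k (\<lambda>x. x i * d x)"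
    "(\<Sum>i<N. msq (\<lambda>x. \<phi> i x - 2 * (x i * d x))) = (\<Sum>i<N. msq (\<phi> i))"
    "real N * msq (\<lambda>x. (\<Sum>i<N. cnj (x i) * \<phi> i x) - d x) \<le> (\<Sum>i<N. msq (\<phi> i)) - msq d"
proof (cases k)
  case 0
  \<comment> \<open>A field of degree 0 is constant and hence already divergence free, so there is
    nothing to subtract and \<open>d = 0\<close> serves.\<close>
  have "pd i (\<phi> i) x = 0" if "i < N" for i x
    using hpoly_0_const[OF phi[OF that] 0] by auto
  then have "real (N + k) * msq (\<lambda>x. \<Sum>i<N. cnj (x i) * \<phi> i x) = (\<Sum>i<N. msq (\<phi> i))"
    by (intro msq_divergence_free phi) auto
  then show thesis using 0
    by (intro that[of "\<lambda>_. 0"]) (auto intro: hpoly_zero)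
next
  case (Suc m)
  define d where "d x = inverse (of_nat (N + m)) * (\<Sum>i<N. pd i (\<phi> i) x)" for x
  have phi': "hpoly N (Suc m) (\<phi> i)" if "i < N" for i using phi[OF that] Suc by simp
  have hd: "hpoly N m d" unfolding d_def
    using hpoly_pd[OF phi'] by (intro hpoly_cmult hpoly_sum) auto
  have hxd: "hpoly N (Suc m) (\<lambda>x. x i * d x)" if "i < N" for i
    using that hd by (rule hpoly_times)
  have Nd: "of_nat (N + m) * d x = (\<Sum>i<N. pd i (\<phi> i) x)" for x
    using N_pos unfolding d_def by (simp del: of_nat_add)
  have nf: "nice (\<phi> i)" "nice (pd i (\<phi> i))" if "i < N" for i
    using phi'[OF that] by (auto intro: nice_hpoly hpoly_pd)
  have nd: "nice d" by (rule nice_hpoly[OF hd])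
  \<comment> \<open>This is the orthogonality behind the projection: the inner product of
    \<open>\<phi>\<close> with \<open>x d\<close> equals the squared norm of \<open>x d\<close>,
    which is \<open>msq d\<close> on the sphere.\<close>
  have cross: "(\<Sum>i<N. E (\<lambda>x. \<phi> i x * cnj (x i * d x))) = of_real (msq d)"
  proof -
    have "of_nat (N + m) * (\<Sum>i<N. E (\<lambda>x. \<phi> i x * cnj (x i * d x)))
        = (\<Sum>i<N. of_nat (N + m) * E (\<lambda>x. cnj (x i) * \<phi> i x * cnj (d x)))"
      by (simp add: sum_distrib_left mult_ac)
    also have "\<dots> = (\<Sum>i<N. E (\<lambda>x. pd i (\<phi> i) x * cnj (d x)))"
      by (intro sum.cong refl hpoly_parts phi' hd) auto
    also have "\<dots> = E (\<lambda>x. (\<Sum>i<N. pd i (\<phi> i) x) * cnj (d x))"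
      unfolding sum_distrib_right by (rule E_sum[symmetric]) (auto intro!: nice_intros nf nd)
    also have "\<dots> = of_nat (N + m) * of_real (msq d)"
      by (simp only: Nd[symmetric] msq_E mult.assoc E_cmult)
    finally show ?thesis using N_pos by (simp del: of_nat_add)
  qed
  \<comment> \<open>The value \<open>c = 1\<close> gives the Pythagorean loss \<open>msq d\<close>.
    For \<open>c = 2\<close> the coefficient \<open>c^2 - 2 * c\<close> vanishes, so the reflected
    field keeps its norm.\<close>
  have shift: "(\<Sum>i<N. msq (\<lambda>x. \<phi> i x - of_real c * (x i * d x))) = (\<Sum>i<N. msq (\<phi> i)) + (c\<^sup>2 - 2 * c) * msq d" for c :: real
  proof -
    define u where "u i = E (\<lambda>x. \<phi> i x * cnj (x i * d x))" for i
    have "E (\<lambda>x. (\<phi> i x - of_real c * (x i * d x)) * cnj (\<phi> i x - of_real c * (x i * d x))) =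
       of_real (msq (\<phi> i)) - of_real c * u i - of_real c * cnj (u i) + (of_real c)\<^sup>2 * E (\<lambda>x. x i * cnj (x i) * (d x * cnj (d x)))"
      (is "_ = ?r i") if "i < N" for i
    proof -
      have "E (\<lambda>x. (\<phi> i x - of_real c * (x i * d x)) * cnj (\<phi> i x - of_real c * (x i * d x))) =
         E (\<lambda>x. \<phi> i x * cnj (\<phi> i x) - of_real c * (\<phi> i x * cnj (x i * d x)) - of_real c * cnj (\<phi> i x * cnj (x i * d x))
          + (of_real c)\<^sup>2 * (x i * cnj (x i) * (d x * cnj (d x))))"
        by (intro E_cong) (simp add: algebra_simps power2_eq_square)
      also have "\<dots> = E (\<lambda>x. \<phi> i x * cnj (\<phi> i x)) - of_real c * u i - of_real c * cnj (u i)
          + (of_real c)\<^sup>2 * E (\<lambda>x. x i * cnj (x i) * (d x * cnj (d x)))"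
        unfolding u_def E_cnj[symmetric] E_cmult[symmetric]
        by (subst E_add E_diff, (intro nice_intros nf nd that)+)+ simp
      finally show ?thesis by (simp only: msq_E)
    qed
    then have "complex_of_real (\<Sum>i<N. msq (\<lambda>x. \<phi> i x - of_real c * (x i * d x))) = (\<Sum>i<N. ?r i)"
      unfolding of_real_sum by (intro sum.cong refl) (simp only: msq_E lessThan_iff)
    also have "\<dots> = of_real (\<Sum>i<N. msq (\<phi> i)) - of_real c * (\<Sum>i<N. u i) - of_real c * cnj (\<Sum>i<N. u i)
       + (of_real c)\<^sup>2 * (\<Sum>i<N. E (\<lambda>x. x i * cnj (x i) * (d x * cnj (d x))))"
      by (simp only: of_real_sum sum.distrib sum_subtractf sum_distrib_left cnj_sum)
    also have "(\<Sum>i<N. E (\<lambda>x. x i * cnj (x i) * (d x * cnj (d x)))) = of_real (msq d)"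
    proof -
      have "(\<Sum>i<N. E (\<lambda>x. x i * cnj (x i) * (d x * cnj (d x)))) = E (\<lambda>x. (\<Sum>i<N. x i * cnj (x i)) * (d x * cnj (d x)))"
        unfolding sum_distrib_right by (rule E_sum[symmetric]) (auto intro!: nice_intros nd)
      also have "\<dots> = E (\<lambda>x. d x * cnj (d x))"
        by (intro E_cong) (simp add: unit_vec_norm)
      finally show ?thesis by (simp only: msq_E)
    qed
    also have "(\<Sum>i<N. u i) = of_real (msq d)" using cross by (simp add: u_def)
    finally have "complex_of_real (\<Sum>i<N. msq (\<lambda>x. \<phi> i x - of_real c * (x i * d x))) =
      of_real ((\<Sum>i<N. msq (\<phi> i)) + (c\<^sup>2 - 2 * c) * msq d)" by (simp add: algebra_simps)
    then show ?thesis by (simp only: of_real_eq_iff)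
  qed
  \<comment> \<open>The divergence of \<open>x d\<close> is \<open>N d\<close> plus the Euler term
    \<open>m d\<close>; the denominator \<open>N + m\<close> of \<open>d\<close> is chosen so that
    this equals the divergence of \<open>\<phi>\<close>.\<close>
  have free: "real (N + Suc m) * msq (\<lambda>x. \<Sum>i<N. cnj (x i) * (\<phi> i x - x i * d x)) = (\<Sum>i<N. msq (\<lambda>x. \<phi> i x - x i * d x))"
  proof (rule msq_divergence_free)
    fix x
    have "(\<Sum>i<N. pd i (\<lambda>x. \<phi> i x - x i * d x) x) = (\<Sum>i<N. pd i (\<phi> i) x - (d x + x i * pd i d x))"
      by (intro sum.cong refl) (simp add: pd_diff[OF phi' hxd] pd_times[OF hd])
    also have "\<dots> = of_nat (N + m) * d x - (of_nat N * d x + of_nat m * d x)"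
      by (simp only: sum_subtractf sum.distrib Nd euler_identity[OF hd]) simp
    finally show "(\<Sum>i<N. pd i (\<lambda>x. \<phi> i x - x i * d x) x) = 0" by (simp add: algebra_simps)
  qed (auto intro: hpoly_diff phi' hxd)
  have eq: "msq (\<lambda>x. (\<Sum>i<N. cnj (x i) * \<phi> i x) - d x) = msq (\<lambda>x. \<Sum>i<N. cnj (x i) * (\<phi> i x - x i * d x))"
    unfolding msq_def
  proof (intro Bochner_Integration.integral_cong refl)
    fix \<psi> assume "\<psi> \<in> space \<mu>"
    then have "(\<Sum>i<N. \<psi> $ i * cnj (\<psi> $ i)) = 1" by (simp add: space_haar unit_vec_norm)
    moreover have "(\<Sum>i<N. cnj (\<psi> $ i) * (\<phi> i (vec_index \<psi>) - \<psi> $ i * d (vec_index \<psi>)))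
      = (\<Sum>i<N. cnj (\<psi> $ i) * \<phi> i (vec_index \<psi>)) - d (vec_index \<psi>) * (\<Sum>i<N. \<psi> $ i * cnj (\<psi> $ i))"
      by (simp add: right_diff_distrib sum_subtractf sum_distrib_left mult_ac)
    ultimately show "(cmod ((\<Sum>i<N. cnj (\<psi> $ i) * \<phi> i (vec_index \<psi>)) - d (vec_index \<psi>)))\<^sup>2
      = (cmod (\<Sum>i<N. cnj (\<psi> $ i) * (\<phi> i (vec_index \<psi>) - \<psi> $ i * d (vec_index \<psi>))))\<^sup>2" by simp
  qed
  show thesis
  proof (rule that[of d])
    show "real N * msq (\<lambda>x. (\<Sum>i<N. cnj (x i) * \<phi> i x) - d x) \<le> (\<Sum>i<N. msq (\<phi> i)) - msq d"
    proof -
      let ?M = "msq (\<lambda>x. \<Sum>i<N. cnj (x i) * (\<phi> i x - x i * d x))"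
      have "real N * ?M \<le> real (N + Suc m) * ?M"
        by (intro mult_right_mono msq_nonneg) simp
      also have "\<dots> = (\<Sum>i<N. msq (\<phi> i)) - msq d"
        unfolding free using shift[of 1] by simp
      finally show ?thesis unfolding eq .
    qed
    show "(\<Sum>i<N. msq (\<lambda>x. \<phi> i x - 2 * (x i * d x))) = (\<Sum>i<N. msq (\<phi> i))"
      using shift[of 2] by simp
  qed (use hd hxd Suc in auto)
qed

lemma msq_mono_sum:
  assumes "nice f" "\<And>i. i \<in> I \<Longrightarrow> nice (g i)"
    and "\<And>\<psi>. \<psi> \<in> unit_vecs N \<Longrightarrow> (cmod (f (vec_index \<psi>)))\<^sup>2 \<le> (\<Sum>i\<in>I. c i * (cmod (g i (vec_index \<psi>)))\<^sup>2)"
  shows "msq f \<le> (\<Sum>i\<in>I. c i * msq (g i))"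
proof -
  have "msq f \<le> (\<integral>\<psi>. (\<Sum>i\<in>I. c i * (cmod (g i (vec_index \<psi>)))\<^sup>2) \<partial>\<mu>)"
    unfolding msq_def using assms
    by (intro integral_mono Bochner_Integration.integrable_sum integrable_mult_right integrable_msq)
      (auto simp: space_haar)
  also have "\<dots> = (\<Sum>i\<in>I. c i * msq (g i))"
    unfolding msq_def using assms(2)
    by (subst Bochner_Integration.integral_sum) (auto intro!: integrable_mult_right integrable_msq)
  finally show ?thesis .
qed

text \<open>The weight \<open>l\<close> stays free because it decides how constants accumulate:
  \<open>l = 1\<close> gives the usual factor 2, while a weight growing with the number of steps
  prevents the factors from multiplying up.\<close>

lemma msq_add_le:
  assumes nA: "nice A" and nB: "nice B" and l: "l > 0"
  shows "msq (\<lambda>x. A x + B x) \<le> (l + 1) / l * msq A + (l + 1) * msq B"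
proof -
  \<comment> \<open>The two summands are indexed by Booleans to bring the estimate into the form of
    \<open>msq_mono_sum\<close>.\<close>
  have "msq (\<lambda>x. A x + B x) \<le> (\<Sum>i\<in>{True, False}. (if i then (l + 1) / l else l + 1) * msq (if i then A else B))"
  proof (rule msq_mono_sum)
    fix \<psi> :: "complex vec"
    define a where "a = cmod (A (vec_index \<psi>))"
    define b where "b = cmod (B (vec_index \<psi>))"
    have "(a + b)\<^sup>2 \<le> (l + 1) / l * a\<^sup>2 + (l + 1) * b\<^sup>2"
    proof -
      have "(l + 1) / l * a\<^sup>2 + (l + 1) * b\<^sup>2 - (a + b)\<^sup>2 = (a - l * b)\<^sup>2 / l"
        using l by (simp add: field_simps power2_eq_square)
      also have "\<dots> \<ge> 0" using l by simp
      finally show ?thesis by simp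
    qed
    moreover have "(cmod (A (vec_index \<psi>) + B (vec_index \<psi>)))\<^sup>2 \<le> (a + b)\<^sup>2"
      unfolding a_def b_def by (intro power_mono norm_triangle_ineq) auto
    ultimately have "(cmod (A (vec_index \<psi>) + B (vec_index \<psi>)))\<^sup>2 \<le> (l + 1) / l * a\<^sup>2 + (l + 1) * b\<^sup>2"
      by (rule order_trans[rotated])
    then show "(cmod (A (vec_index \<psi>) + B (vec_index \<psi>)))\<^sup>2 \<le>
      (\<Sum>i\<in>{True, False}. (if i then (l + 1) / l else l + 1) * (cmod ((if i then A else B) (vec_index \<psi>)))\<^sup>2)"
      by (simp add: a_def b_def)
  qed (use nA nB in \<open>auto intro!: nice_intros\<close>)
  then show ?thesis by simp
qed

lemma nice_tpow: "I < N ^ k \<Longrightarrow> nice (\<lambda>x. tpow N x k I)"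
  using nice_hpoly[OF hpoly_tpow] .

text \<open>Cauchy-Schwarz: on the sphere the tensor power is a unit vector, so projecting onto it
  is a contraction.\<close>

lemma msq_project_tpow:
  assumes "\<And>J. J < N ^ k \<Longrightarrow> nice (f J)"
  shows "msq (\<lambda>x. \<Sum>J<N ^ k. cnj (tpow N x k J) * f J x) \<le> (\<Sum>J<N ^ k. msq (f J))"
proof -
  have "msq (\<lambda>x. \<Sum>J<N ^ k. cnj (tpow N x k J) * f J x) \<le> (\<Sum>J<N ^ k. 1 * msq (f J))"
  proof (rule msq_mono_sum)
    fix \<psi> assume "\<psi> \<in> unit_vecs N"
    then show "(cmod (\<Sum>J<N ^ k. cnj (tpow N (vec_index \<psi>) k J) * f J (vec_index \<psi>)))\<^sup>2
        \<le> (\<Sum>J<N ^ k. 1 * (cmod (f J (vec_index \<psi>)))\<^sup>2)"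
      using cauchy_schwarz_complex[of "\<lambda>J. cnj (tpow N (vec_index \<psi>) k J)" "\<lambda>J. f J (vec_index \<psi>)" "{..<N ^ k}"]
      by (simp add: tpow_norm)
  qed (auto intro!: nice_intros nice_tpow assms)
  then show ?thesis by simp
qed

text \<open>The optimal cloning bound without representation theory: split off one register with
  \<open>hpoly_split\<close>, and combine the two orthogonal parts by
  \<open>(a + b)\<^sup>2 \<le> (\<lambda> + \<mu>) (a\<^sup>2 / \<lambda> + b\<^sup>2 / \<mu>)\<close>, so that the constants \<open>k / N\<close> and \<open>1 / N\<close> add up.\<close>

lemma cloning_bound:
  assumes "\<And>J. J < N ^ Suc k \<Longrightarrow> hpoly N k (G J)"
  shows "real N * msq (\<lambda>x. \<Sum>J<N ^ Suc k. cnj (tpow N x (Suc k) J) * G J x)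
    \<le> real (Suc k) * (\<Sum>J<N ^ Suc k. msq (G J))"
  using assms
proof (induction k arbitrary: G)
  case (0 G)
  obtain d where "d = (\<lambda>_. 0)"
    "real N * msq (\<lambda>x. (\<Sum>i<N. cnj (x i) * G i x) - d x) \<le> (\<Sum>i<N. msq (G i)) - msq d"
    using hpoly_split[of 0 G] 0 by auto
  then show ?case by simp
next
  case (Suc m G)
  define M where "M = N ^ Suc m"
  have G: "hpoly N (Suc m) (G (j * M + J))" if "j < N" "J < M" for j J
    using Suc.prems[of "j * M + J"] mult_add_less[OF that] by (simp add: M_def)
  \<comment> \<open>For each content \<open>J\<close> of the other registers, the functions
    \<open>G (j * M + J)\<close> with \<open>j < N\<close> form a vector field of degree
    \<open>m + 1\<close> in the first register.\<close>
  define Q where "Q J d \<longleftrightarrow> hpoly N m d \<and>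
    real N * msq (\<lambda>x. (\<Sum>j<N. cnj (x j) * G (j * M + J) x) - d x) \<le> (\<Sum>j<N. msq (G (j * M + J))) - msq d" for J d
  have "\<forall>J\<in>{..<M}. \<exists>d. Q J d"
  proof
    fix J assume "J \<in> {..<M}"
    then have "\<And>j. j < N \<Longrightarrow> hpoly N (Suc m) (G (j * M + J))" by (intro G) simp_all
    then show "\<exists>d. Q J d"
    proof (rule hpoly_split[of "Suc m" "\<lambda>j. G (j * M + J)"])
      fix d assume "hpoly N (Suc m - 1) d"
        "real N * msq (\<lambda>x. (\<Sum>j<N. cnj (x j) * G (j * M + J) x) - d x) \<le> (\<Sum>j<N. msq (G (j * M + J))) - msq d"
      then show "\<exists>d. Q J d" unfolding Q_def by (intro exI[of _ d]) simp
    qed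
  qed
  from bchoice[OF this] obtain d where "\<forall>J\<in>{..<M}. Q J (d J)" ..
  then have d: "\<And>J. J < M \<Longrightarrow> hpoly N m (d J)"
    "\<And>J. J < M \<Longrightarrow> real N * msq (\<lambda>x. (\<Sum>j<N. cnj (x j) * G (j * M + J) x) - d J x)
        \<le> (\<Sum>j<N. msq (G (j * M + J))) - msq (d J)"
    by (auto simp: Q_def)
  \<comment> \<open>The holomorphic parts \<open>d J\<close> have degree \<open>m\<close> on
    \<open>m + 1\<close> registers and fall under the induction hypothesis. The remainders
    \<open>e J\<close> already carry the factor \<open>1 / N\<close>, so Cauchy-Schwarz suffices for
    them.\<close>
  define e where "e J x = (\<Sum>j<N. cnj (x j) * G (j * M + J) x) - d J x" for J x
  define A where "A x = (\<Sum>J<M. cnj (tpow N x (Suc m) J) * d J x)" for x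
  define B where "B x = (\<Sum>J<M. cnj (tpow N x (Suc m) J) * e J x)" for x
  have nt: "nice (\<lambda>x. tpow N x (Suc m) J)" if "J < M" for J using that by (auto simp only: M_def intro: nice_tpow)
  have nd: "nice (d J)" if "J < M" for J using d(1)[OF that] by (rule nice_hpoly)
  have ne: "nice (e J)" if "J < M" for J unfolding e_def
    by (intro nice_intros nice_hpoly[OF G] nd that) auto
  have nA: "nice A" unfolding A_def by (intro nice_intros nt nd) auto
  have nB: "nice B" unfolding B_def by (intro nice_intros nt ne) auto
  have AB: "(\<Sum>J<N ^ Suc (Suc m). cnj (tpow N x (Suc (Suc m)) J) * G J x) = A x + B x" for x
  proof -
    have "(\<Sum>J<N ^ Suc (Suc m). cnj (tpow N x (Suc (Suc m)) J) * G J x)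
        = (\<Sum>j<N. \<Sum>J<M. cnj (x j) * cnj (tpow N x (Suc m) J) * G (j * M + J) x)"
      unfolding power_Suc[of N "Suc m"] sum_lessThan_mult M_def[symmetric]
      by (intro sum.cong refl) (simp only: M_def tpow_Suc_index lessThan_iff complex_cnj_mult)
    also have "\<dots> = (\<Sum>J<M. cnj (tpow N x (Suc m) J) * (\<Sum>j<N. cnj (x j) * G (j * M + J) x))"
      by (subst sum.swap) (simp only: sum_distrib_left mult_ac)
    also have "\<dots> = A x + B x"
      unfolding A_def B_def e_def by (simp only: sum.distrib[symmetric] right_diff_distrib add_diff_cancel_left' add_diff_eq)
    finally show ?thesis .
  qed
  have IH: "real N * msq A \<le> real (Suc m) * (\<Sum>J<M. msq (d J))"
    using Suc.IH[of d] d(1) unfolding A_def M_def by simp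
  have "real N * msq B \<le> real N * (\<Sum>J<M. msq (e J))"
    using msq_project_tpow[of "Suc m" e] ne unfolding B_def M_def by (intro mult_left_mono) auto
  also have "\<dots> \<le> (\<Sum>J<M. (\<Sum>j<N. msq (G (j * M + J))) - msq (d J))"
    unfolding sum_distrib_left e_def by (intro sum_mono d(2)) auto
  also have "\<dots> = (\<Sum>J<N ^ Suc (Suc m). msq (G J)) - (\<Sum>J<M. msq (d J))"
    unfolding power_Suc[of N "Suc m"] sum_lessThan_mult M_def[symmetric]
    by (simp only: sum_subtractf sum.swap[of _ "{..<N}" "{..<M}"])
  finally have B: "real N * msq B \<le> \<dots>" .
  \<comment> \<open>With this weight the norms of the \<open>d J\<close> appear with the factor
    \<open>l + 1\<close> in both parts and cancel, so it does not matter how the norm of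
    \<open>G\<close> is divided between them.\<close>
  define l where "l = real (Suc m)"
  have l: "l > 0" by (simp add: l_def)
  have "msq (\<lambda>x. A x + B x) \<le> (l + 1) / l * msq A + (l + 1) * msq B"
    by (rule msq_add_le[OF nA nB l])
  then have "real N * msq (\<lambda>x. A x + B x) \<le> real N * ((l + 1) / l * msq A + (l + 1) * msq B)"
    by (intro mult_left_mono) auto
  also have "\<dots> = (l + 1) / l * (real N * msq A) + (l + 1) * (real N * msq B)"
    by (simp add: algebra_simps)
  also have "\<dots> \<le> (l + 1) / l * (l * (\<Sum>J<M. msq (d J)))
      + (l + 1) * ((\<Sum>J<N ^ Suc (Suc m). msq (G J)) - (\<Sum>J<M. msq (d J)))"
    using IH B l unfolding l_def[symmetric] by (intro add_mono mult_left_mono) auto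
  also have "\<dots> = real (Suc (Suc m)) * (\<Sum>J<N ^ Suc (Suc m). msq (G J))"
  proof -
    have "(l + 1) / l * (l * D) + (l + 1) * (X - D) = (l + 1) * X" for D X
      using l by (simp add: field_simps)
    then show ?thesis by (simp only: l_def) simp
  qed
  finally show ?case unfolding AB .
qed

end

section \<open>Kraus families and oracle algorithms in coordinates\<close>

lemma sum_list_map_nth: "sum_list (map f xs) = (\<Sum>n<length xs. f (xs ! n))" for f :: "'a \<Rightarrow> 'b::comm_monoid_add"
  by (simp add: sum_list_sum_nth atLeast0LessThan)

lemma sum_list_map_concat: "(\<Sum>x\<leftarrow>concat (map g xs). f x) = (\<Sum>y\<leftarrow>xs. \<Sum>x\<leftarrow>g y. f x)"
  for f :: "'a \<Rightarrow> 'b::comm_monoid_add"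
  by (induction xs) auto

lemma tensor_power_ket_bra:
  assumes "\<psi> \<in> carrier_vec N"
  shows "tensor_power (ket_bra \<psi>) k \<in> carrier_mat (N ^ k) (N ^ k)"
    and "I < N ^ k \<Longrightarrow> J < N ^ k \<Longrightarrow>
      tensor_power (ket_bra \<psi>) k $$ (I, J) = tpow N (vec_index \<psi>) k I * cnj (tpow N (vec_index \<psi>) k J)"
proof -
  have kb: "ket_bra \<psi> \<in> carrier_mat N N" using assms by (simp add: ket_bra_def)
  have c: "tensor_power (ket_bra \<psi>) k \<in> carrier_mat (N ^ k) (N ^ k)" for k
    by (induction k) (use kb in \<open>auto simp: tensor_mat_def\<close>)
  then show "tensor_power (ket_bra \<psi>) k \<in> carrier_mat (N ^ k) (N ^ k)" .
  show "I < N ^ k \<Longrightarrow> J < N ^ k \<Longrightarrow>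
      tensor_power (ket_bra \<psi>) k $$ (I, J) = tpow N (vec_index \<psi>) k I * cnj (tpow N (vec_index \<psi>) k J)"
  proof (induction k arbitrary: I J)
    case (Suc k)
    then have "N ^ k > 0" by (auto intro: gr0I)
    then have "I mod N ^ k < N ^ k" "J mod N ^ k < N ^ k" "I div N ^ k < N" "J div N ^ k < N"
      using Suc.prems by (auto simp: less_mult_imp_div_less)
    then show ?case
      using Suc.IH[of "I mod N ^ k" "J mod N ^ k"] Suc.prems c[of k] kb assms
      by (auto simp: tensor_mat_def ket_bra_def)
  qed auto
qed

lemma kraus_family_iff:
  assumes "set Ks \<subseteq> carrier_mat b a"
  shows "kraus_family a b Ks \<longleftrightarrow> (\<forall>j<a. \<forall>l<a.
    (\<Sum>K\<leftarrow>Ks. \<Sum>i<b. cnj (K $$ (i, j)) * K $$ (i, l)) = (if j = l then 1 else 0))"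
proof -
  have ind: "set Ks \<subseteq> carrier_mat b a \<Longrightarrow> foldr (\<lambda>K S. mat_adjoint K * K + S) Ks (0\<^sub>m a a) \<in> carrier_mat a a \<and>
    (\<forall>j<a. \<forall>l<a. foldr (\<lambda>K S. mat_adjoint K * K + S) Ks (0\<^sub>m a a) $$ (j, l) = (\<Sum>K\<leftarrow>Ks. \<Sum>i<b. cnj (K $$ (i, j)) * K $$ (i, l)))"
    for Ks
  proof (induction Ks)
    case (Cons K Ks)
    then have K: "K \<in> carrier_mat b a" by simp
    have "(mat_adjoint K * K) $$ (j, l) = (\<Sum>i<b. cnj (K $$ (i, j)) * K $$ (i, l))" if "j < a" "l < a" for j l
      using K mat_adjoint_carrier[OF K] that by (subst index_mult_mat_sum) (auto simp: mat_adjoint_index)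
    then show ?case using Cons K mat_adjoint_carrier[OF K] by auto
  qed auto
  define S where "S = foldr (\<lambda>K S. mat_adjoint K * K + S) Ks (0\<^sub>m a a)"
  have S: "S \<in> carrier_mat a a" "\<And>j l. j < a \<Longrightarrow> l < a \<Longrightarrow> S $$ (j, l) = (\<Sum>K\<leftarrow>Ks. \<Sum>i<b. cnj (K $$ (i, j)) * K $$ (i, l))"
    using ind[OF assms] unfolding S_def by blast+
  have "S = 1\<^sub>m a \<longleftrightarrow> (\<forall>j<a. \<forall>l<a. S $$ (j, l) = (if j = l then 1 else 0))"
    using S(1) by (auto simp: mat_eq_iff)
  then show ?thesis using assms S(2) unfolding kraus_family_def S_def[symmetric] by auto
qed

lemma kraus_family_gram:
  assumes "kraus_family a b Ks" "j < a" "l < a"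
  shows "(\<Sum>n<length Ks. \<Sum>i<b. cnj (Ks ! n $$ (i, j)) * Ks ! n $$ (i, l)) = (if j = l then 1 else 0)"
proof -
  have "set Ks \<subseteq> carrier_mat b a" using assms(1) by (simp add: kraus_family_def)
  from kraus_family_iff[OF this] assms show ?thesis by (simp add: sum_list_map_nth)
qed

definition mv :: "complex mat \<Rightarrow> (nat \<Rightarrow> (nat \<Rightarrow> complex) \<Rightarrow> complex) \<Rightarrow> nat \<Rightarrow> (nat \<Rightarrow> complex) \<Rightarrow> complex" where
  "mv K F i x = (\<Sum>j<dim_col K. K $$ (i, j) * F j x)"

lemma kraus_family_norm:
  assumes K: "kraus_family a b Ks"
  shows "(\<Sum>n<length Ks. \<Sum>i<b. (cmod (mv (Ks ! n) F i x))\<^sup>2) = (\<Sum>j<a. (cmod (F j x))\<^sup>2)"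
proof -
  have dc: "dim_col (Ks ! n) = a" if "n < length Ks" for n
    using K that by (auto simp: kraus_family_def dest!: nth_mem)
  have "complex_of_real (\<Sum>n<length Ks. \<Sum>i<b. (cmod (mv (Ks ! n) F i x))\<^sup>2)
    = (\<Sum>n<length Ks. \<Sum>i<b. (\<Sum>l<a. \<Sum>j<a. cnj (Ks ! n $$ (i, j)) * Ks ! n $$ (i, l) * (F l x * cnj (F j x))))"
    unfolding of_real_sum
    by (intro sum.cong refl, simp only: complex_norm_square mv_def dc lessThan_iff cnj_sum sum_product)
      (simp add: mult_ac)
  also have "\<dots> = (\<Sum>n<length Ks. \<Sum>l<a. \<Sum>j<a. (\<Sum>i<b. cnj (Ks ! n $$ (i, j)) * Ks ! n $$ (i, l)) * (F l x * cnj (F j x)))"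
    unfolding sum_distrib_right
    by (rule sum.cong[OF refl], subst sum.swap, rule sum.cong[OF refl], rule sum.swap)
  also have "\<dots> = (\<Sum>l<a. \<Sum>j<a. (\<Sum>n<length Ks. \<Sum>i<b. cnj (Ks ! n $$ (i, j)) * Ks ! n $$ (i, l)) * (F l x * cnj (F j x)))"
    unfolding sum_distrib_right[of _ "{..<length Ks}"]
    by (subst sum.swap, rule sum.cong[OF refl], rule sum.swap)
  also have "\<dots> = (\<Sum>l<a. \<Sum>j<a. (if j = l then F l x * cnj (F j x) else 0))"
    by (intro sum.cong refl) (simp add: kraus_family_gram[OF K])
  also have "\<dots> = complex_of_real (\<Sum>l<a. (cmod (F l x))\<^sup>2)"
    by (simp add: complex_norm_square del: of_real_power)
  finally show ?thesis by (simp only: of_real_eq_iff)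
qed

text \<open>Density matrices are represented as finite sums of rank-one operators, one per branch;
  conjugation by \<open>K\<close> just applies \<open>K\<close> to the vector of each
  branch.\<close>

lemma conj_index:
  assumes K: "K \<in> carrier_mat b a" and R: "R \<in> carrier_mat a a" and ij: "i < b" "j < b"
    and ent: "\<And>l m. l < a \<Longrightarrow> m < a \<Longrightarrow> R $$ (l, m) = (\<Sum>f\<leftarrow>fs. fst f l x * cnj (fst f m x))"
  shows "(K * R * mat_adjoint K) $$ (i, j) = (\<Sum>f\<leftarrow>fs. mv K (fst f) i x * cnj (mv K (fst f) j x))"
proof -
  have d: "dim_row K = b" "dim_col K = a" "dim_row R = a" "dim_col R = a" using K R by auto
  have "(K * R * mat_adjoint K) $$ (i, j) = (\<Sum>m<a. (\<Sum>l<a. K $$ (i, l) * R $$ (l, m)) * cnj (K $$ (j, m)))"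
  proof -
    have "dim_row (mat_adjoint K) = a" "dim_col (mat_adjoint K) = b" using mat_adjoint_carrier[OF K] by auto
    then have "(K * R * mat_adjoint K) $$ (i, j) = (\<Sum>m<a. (K * R) $$ (i, m) * mat_adjoint K $$ (m, j))"
      using d ij by (subst index_mult_mat_sum) simp_all
    also have "\<dots> = (\<Sum>m<a. (\<Sum>l<a. K $$ (i, l) * R $$ (l, m)) * cnj (K $$ (j, m)))"
      using d ij by (intro sum.cong refl) (simp only: mat_adjoint_index index_mult_mat_sum lessThan_iff)
    finally show ?thesis .
  qed
  also have "\<dots> = (\<Sum>m<a. \<Sum>l<a. \<Sum>n<length fs. (K $$ (i, l) * fst (fs ! n) l x) * cnj (K $$ (j, m) * fst (fs ! n) m x))"
    by (intro sum.cong refl)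
      (simp add: ent sum_list_map_nth sum_distrib_left sum_distrib_right mult_ac)
  also have "\<dots> = (\<Sum>n<length fs. \<Sum>m<a. \<Sum>l<a. (K $$ (i, l) * fst (fs ! n) l x) * cnj (K $$ (j, m) * fst (fs ! n) m x))"
    by (simp only: sum.swap[where A = "{..<a}" and B = "{..<length fs}"])
  also have "\<dots> = (\<Sum>n<length fs. mv K (fst (fs ! n)) i x * cnj (mv K (fst (fs ! n)) j x))"
    unfolding mv_def d cnj_sum sum_product
    by (rule sum.cong[OF refl], rule sum.swap)
  finally show ?thesis by (simp add: sum_list_map_nth)
qed

definition kraus_op :: "complex mat list \<Rightarrow> nat \<Rightarrow> complex mat \<Rightarrow> complex mat" where
  "kraus_op Ks b \<rho> = foldr (\<lambda>K S. K * \<rho> * mat_adjoint K + S) Ks (0\<^sub>m b b)"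

lemma quantum_op_iff: "quantum_op a b E \<longleftrightarrow> (\<exists>Ks. kraus_family a b Ks \<and> E = kraus_op Ks b)"
  by (simp add: quantum_op_def kraus_op_def[abs_def])

lemma quantum_op_kraus: "kraus_family a b Ks \<Longrightarrow> quantum_op a b (kraus_op Ks b)"
  unfolding quantum_op_iff by blast

lemma kraus_op_index:
  assumes "set Ks \<subseteq> carrier_mat b a" and R: "R \<in> carrier_mat a a"
    and ent: "\<And>l m. l < a \<Longrightarrow> m < a \<Longrightarrow> R $$ (l, m) = (\<Sum>f\<leftarrow>fs. fst f l x * cnj (fst f m x))"
  shows "kraus_op Ks b R \<in> carrier_mat b b"
    and "i < b \<Longrightarrow> j < b \<Longrightarrow> kraus_op Ks b R $$ (i, j) =
         (\<Sum>K\<leftarrow>Ks. \<Sum>f\<leftarrow>fs. mv K (fst f) i x * cnj (mv K (fst f) j x))"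
proof -
  have "kraus_op Ks b R \<in> carrier_mat b b \<and>
    (\<forall>i<b. \<forall>j<b. kraus_op Ks b R $$ (i, j) =
         (\<Sum>K\<leftarrow>Ks. \<Sum>f\<leftarrow>fs. mv K (fst f) i x * cnj (mv K (fst f) j x)))"
    using assms(1)
  proof (induction Ks)
    case (Cons L Ls)
    then have L: "L \<in> carrier_mat b a" by simp
    show ?case using Cons L mat_adjoint_carrier[OF L] R conj_index[OF L R _ _ ent]
      by (auto simp: kraus_op_def)
  qed (auto simp: kraus_op_def)
  then show "kraus_op Ks b R \<in> carrier_mat b b"
    "i < b \<Longrightarrow> j < b \<Longrightarrow> kraus_op Ks b R $$ (i, j) =
         (\<Sum>K\<leftarrow>Ks. \<Sum>f\<leftarrow>fs. mv K (fst f) i x * cnj (mv K (fst f) j x))" by blast+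
qed

context haar_states begin

text \<open>The list holds, for each sequence of Kraus operators, the unnormalised output state as a function
  of \<open>\<psi>\<close> (first component) and its simulation by a polynomial of degree \<open>k\<close> (second component).\<close>

definition tracked :: "nat \<Rightarrow> nat \<Rightarrow> nat \<Rightarrow> (complex vec \<Rightarrow> complex mat) \<Rightarrow>
    ((nat \<Rightarrow> (nat \<Rightarrow> complex) \<Rightarrow> complex) \<times> (nat \<Rightarrow> (nat \<Rightarrow> complex) \<Rightarrow> complex)) list \<Rightarrow> bool" where
  "tracked k t b \<rho> fs \<longleftrightarrow>
    (\<forall>\<psi>\<in>unit_vecs N. \<rho> \<psi> \<in> carrier_mat b b \<and>
      (\<forall>i<b. \<forall>j<b. \<rho> \<psi> $$ (i, j) = (\<Sum>f\<leftarrow>fs. fst f i (vec_index \<psi>) * cnj (fst f j (vec_index \<psi>))))) \<and>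
    (\<forall>f\<in>set fs. \<forall>i<b. nice (fst f i) \<and> hpoly N k (snd f i)) \<and>
    (\<Sum>f\<leftarrow>fs. \<Sum>i<b. msq (snd f i)) = 1 \<and>
    real N * (\<Sum>f\<leftarrow>fs. \<Sum>i<b. msq (\<lambda>x. fst f i x - snd f i x)) \<le> 4 * real t * (real t + 1)"

lemma msq_kraus:
  assumes K: "kraus_family a b Ks" and F: "\<And>j. j < a \<Longrightarrow> nice (F j)"
  shows "(\<Sum>K\<leftarrow>Ks. \<Sum>i<b. msq (mv K F i)) = (\<Sum>j<a. msq (F j))"
proof -
  have dc: "dim_col (Ks ! n) = a" if "n < length Ks" for n
    using K that by (auto simp: kraus_family_def dest!: nth_mem)
  have n: "nice (mv (Ks ! n) F i)" if "n < length Ks" for n i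
    unfolding mv_def using dc[OF that] by (intro nice_intros F) auto
  have "(\<Sum>K\<leftarrow>Ks. \<Sum>i<b. msq (mv K F i)) = (\<integral>\<psi>. (\<Sum>n<length Ks. \<Sum>i<b. (cmod (mv (Ks ! n) F i (vec_index \<psi>)))\<^sup>2) \<partial>\<mu>)"
    unfolding msq_def sum_list_map_nth
    by (subst Bochner_Integration.integral_sum, force intro!: Bochner_Integration.integrable_sum integrable_msq n,
        rule sum.cong[OF refl], subst Bochner_Integration.integral_sum, auto intro!: integrable_msq n)
  also have "\<dots> = (\<Sum>j<a. msq (F j))"
    unfolding kraus_family_norm[OF K] msq_def
    by (subst Bochner_Integration.integral_sum) (auto intro!: integrable_msq F)
  finally show ?thesis .
qed

text \<open>Every branch splits into one branch per Kraus operator. These have constant entries, so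
  the degree does not change, and trace preservation keeps both the total norm and the total
  distance.\<close>

lemma tracked_kraus:
  assumes tr: "tracked k t a \<rho> fs" and K: "kraus_family a b Ks"
  shows "tracked k t b (\<lambda>\<psi>. kraus_op Ks b (\<rho> \<psi>))
    (concat (map (\<lambda>f. map (\<lambda>K. (mv K (fst f), mv K (snd f))) Ks) fs))" (is "tracked k t b ?\<rho> ?fs")
  unfolding tracked_def
proof (intro conjI ballI allI impI)
  have carr: "K' \<in> carrier_mat b a" if "K' \<in> set Ks" for K' using K that by (auto simp: kraus_family_def)
  have sums: "(\<Sum>f\<leftarrow>?fs. h (fst f) (snd f)) = (\<Sum>f\<leftarrow>fs. \<Sum>K\<leftarrow>Ks. h (mv K (fst f)) (mv K (snd f)))"
    for h :: "_ \<Rightarrow> _ \<Rightarrow> 'b::comm_monoid_add"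
    by (simp add: sum_list_map_concat comp_def)
  note tr' = tr[unfolded tracked_def]
  {
    fix \<psi> assume psi: "\<psi> \<in> unit_vecs N"
    let ?x = "vec_index \<psi>"
    have R: "\<rho> \<psi> \<in> carrier_mat a a" "\<And>l m. l < a \<Longrightarrow> m < a \<Longrightarrow> \<rho> \<psi> $$ (l, m) = (\<Sum>f\<leftarrow>fs. fst f l ?x * cnj (fst f m ?x))"
      using tr' psi by auto
    have sub: "set Ks \<subseteq> carrier_mat b a" using carr by blast
    show "?\<rho> \<psi> \<in> carrier_mat b b" by (rule kraus_op_index(1)[OF sub R])
    fix i j assume "i < b" "j < b"
    then show "?\<rho> \<psi> $$ (i, j) = (\<Sum>f\<leftarrow>?fs. fst f i ?x * cnj (fst f j ?x))"
      using kraus_op_index(2)[OF sub R] unfolding sums[of "\<lambda>F G. F i ?x * cnj (F j ?x)"]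
      by (simp add: sum_list_map_nth) (rule sum.swap)
  }
  {
    fix f i assume "f \<in> set ?fs" "i < b"
    then obtain K' g where f: "K' \<in> set Ks" "g \<in> set fs" "f = (mv K' (fst g), mv K' (snd g))" by auto
    have dK: "dim_col K' = a" using carr[OF f(1)] by auto
    have g: "nice (fst g j)" "hpoly N k (snd g j)" if "j < a" for j using tr' f(2) that by auto
    show "nice (fst f i)" unfolding f(3) fst_conv mv_def dK by (intro nice_intros g) auto
    have "hpoly N k (\<lambda>x. \<Sum>j<a. K' $$ (i, j) * snd g j x)"
      using g(2) by (intro hpoly_sum hpoly_cmult) auto
    then show "hpoly N k (snd f i)" unfolding f(3) snd_conv mv_def dK .
  }
  have nG: "nice (snd f j)" "nice (fst f j)" if "f \<in> set fs" "j < a" for f j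
    using tr' that nice_hpoly[of k "snd f j"] by auto
  have "(\<Sum>f\<leftarrow>?fs. \<Sum>i<b. msq (snd f i)) = (\<Sum>f\<leftarrow>fs. \<Sum>i<a. msq (snd f i))"
    unfolding sums[of "\<lambda>F G. \<Sum>i<b. msq (G i)"]
    by (intro arg_cong[where f = sum_list] map_cong refl msq_kraus[OF K] nG)
  then show "(\<Sum>f\<leftarrow>?fs. \<Sum>i<b. msq (snd f i)) = 1" using tr' by simp
  have "(\<Sum>f\<leftarrow>?fs. \<Sum>i<b. msq (\<lambda>x. fst f i x - snd f i x)) = (\<Sum>f\<leftarrow>fs. \<Sum>i<a. msq (\<lambda>x. fst f i x - snd f i x))"
    unfolding sums[of "\<lambda>F G. \<Sum>i<b. msq (\<lambda>x. F i x - G i x)"]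
  proof (intro arg_cong[where f = sum_list] map_cong refl)
    fix f assume f: "f \<in> set fs"
    have "(\<lambda>x. mv K (fst f) i x - mv K (snd f) i x) = mv K (\<lambda>i x. fst f i x - snd f i x) i" for K i
      by (simp add: mv_def fun_eq_iff right_diff_distrib sum_subtractf)
    then show "(\<Sum>K\<leftarrow>Ks. \<Sum>i<b. msq (\<lambda>x. mv K (fst f) i x - mv K (snd f) i x)) = (\<Sum>i<a. msq (\<lambda>x. fst f i x - snd f i x))"
      using msq_kraus[OF K, of "\<lambda>i x. fst f i x - snd f i x"] f by (simp add: nice_diff nG)
  qed
  then show "real N * (\<Sum>f\<leftarrow>?fs. \<Sum>i<b. msq (\<lambda>x. fst f i x - snd f i x)) \<le> 4 * real t * (real t + 1)"
    using tr' by simp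
qed

end

section \<open>The oracle in coordinates\<close>

lemma index_decompose:
  assumes "y < 2 * N * (w::nat)"
  obtains c i r where "y = (c * N + i) * w + r" "c < 2" "i < N" "r < w"
proof -
  have pos: "w > 0" "N > 0" using assms by (auto intro: gr0I)
  have "y div w < 2 * N" using assms by (simp add: less_mult_imp_div_less)
  then have "y div w div N < 2" by (simp add: less_mult_imp_div_less)
  then show thesis
    by (intro that[of "y div w div N" "y div w mod N" "y mod w"]) (use pos in auto)
qed

lemma sum_index_decompose:
  "(\<Sum>y<2 * N * w. h y) = (\<Sum>i<N. \<Sum>r<w. h (i * w + r)) + (\<Sum>r<w. \<Sum>i<N. h ((N + i) * w + r))"
  for h :: "nat \<Rightarrow> 'a::comm_monoid_add"
  unfolding sum_lessThan_mult sum.swap[where A = "{..<w}" and B = "{..<N}"]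
  by (simp add: numeral_2_eq_2)

lemma tensor_mat_carrier:
  "A \<in> carrier_mat n m \<Longrightarrow> B \<in> carrier_mat p q \<Longrightarrow> A \<otimes>\<^sub>m B \<in> carrier_mat (n * p) (m * q)"
  by (auto simp: tensor_mat_def)

lemma tensor_mat_index:
  assumes "A \<in> carrier_mat n m" "B \<in> carrier_mat p q" "i < n" "j < m" "k < p" "l < q"
  shows "(A \<otimes>\<^sub>m B) $$ (i * p + k, j * q + l) = A $$ (i, j) * B $$ (k, l)"
  using assms mult_add_less[of i n k p] mult_add_less[of j m l q]
  by (simp add: tensor_mat_def div_mult_add)

lemma pauli_Z_carrier: "pauli_Z \<in> carrier_mat 2 2"
  by (rule carrier_matI) (simp_all add: pauli_Z_def mat_of_rows_list_def)

lemma ctrl_reflection_carrier: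
  assumes "\<psi> \<in> carrier_vec N"
  shows "ctrl_reflection N \<psi> \<in> carrier_mat (2 * N) (2 * N)"
proof -
  have "ket_bra \<psi> \<in> carrier_mat N N" using assms by (simp add: ket_bra_def)
  then show ?thesis unfolding ctrl_reflection_def
    by (intro add_carrier_mat tensor_mat_carrier pauli_Z_carrier)
qed

lemma ctrl_reflection_index:
  assumes psi: "\<psi> \<in> carrier_vec N" and ix: "c < 2" "c' < 2" "i < N" "j < N"
  shows "ctrl_reflection N \<psi> $$ (c * N + i, c' * N + j)
    = (if c = c' \<and> i = j then 1 else 0) - (if c = 1 \<and> c' = 1 then 2 * \<psi> $ i * cnj (\<psi> $ j) else 0)"
proof -
  have kb: "ket_bra \<psi> \<in> carrier_mat N N" "1\<^sub>m N - ket_bra \<psi> \<in> carrier_mat N N"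
    using psi by (simp_all add: ket_bra_def minus_carrier_mat)
  have lt: "c * N + i < 2 * N" "c' * N + j < 2 * N"
    using ix mult_add_less by auto
  have tc: "pauli_Z \<otimes>\<^sub>m ket_bra \<psi> \<in> carrier_mat (2 * N) (2 * N)"
    by (intro tensor_mat_carrier pauli_Z_carrier kb)
  have c: "c = 0 \<or> c = 1" "c' = 0 \<or> c' = 1" using ix by auto
  have "ctrl_reflection N \<psi> $$ (c * N + i, c' * N + j)
      = 1\<^sub>m 2 $$ (c, c') * (1\<^sub>m N - ket_bra \<psi>) $$ (i, j) + pauli_Z $$ (c, c') * ket_bra \<psi> $$ (i, j)"
    using lt tc tensor_mat_index[OF one_carrier_mat kb(2) ix] tensor_mat_index[OF pauli_Z_carrier kb(1) ix]
    by (simp add: ctrl_reflection_def)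
  then show ?thesis
    using kb c ix psi by (auto simp: ket_bra_def pauli_Z_def mat_of_rows_list_def)
qed

definition reflect :: "nat \<Rightarrow> nat \<Rightarrow> (nat \<Rightarrow> (nat \<Rightarrow> complex) \<Rightarrow> complex) \<Rightarrow> nat \<Rightarrow> (nat \<Rightarrow> complex) \<Rightarrow> complex" where
  "reflect N w F y x = F y x - (if y div w div N = 1
     then 2 * (x (y div w mod N) * (\<Sum>j<N. cnj (x j) * F ((N + j) * w + y mod w) x)) else 0)"

lemma reflect_index:
  assumes "c < 2" "i < N" "r < w"
  shows "reflect N w F ((c * N + i) * w + r) x = F ((c * N + i) * w + r) x - (if c = 1
     then 2 * (x i * (\<Sum>j<N. cnj (x j) * F ((N + j) * w + r) x)) else 0)"
  using assms by (simp only: reflect_def div_mult_add mod_mult_add)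

lemma mv_oracle:
  assumes psi: "\<psi> \<in> carrier_vec N" and y: "y < 2 * N * w"
  shows "mv (ctrl_reflection N \<psi> \<otimes>\<^sub>m 1\<^sub>m w) F y (vec_index \<psi>) = reflect N w F y (vec_index \<psi>)"
proof -
  obtain c i r where cir: "y = (c * N + i) * w + r" "c < 2" "i < N" "r < w"
    using index_decompose[OF y] .
  define O' where "O' = ctrl_reflection N \<psi> \<otimes>\<^sub>m 1\<^sub>m w"
  note cc = ctrl_reflection_carrier[OF psi]
  have O': "dim_col O' = 2 * N * w" using cc by (simp add: O'_def tensor_mat_def)
  have lt: "c * N + i < 2 * N" using cir mult_add_less by auto
  have ent: "O' $$ (y, (c' * N + j) * w + r') = (if r' = r then ctrl_reflection N \<psi> $$ (c * N + i, c' * N + j) else 0)"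
    if "c' < 2" "j < N" "r' < w" for c' j r'
  proof -
    have l: "c' * N + j < 2 * N" using that mult_add_less by auto
    show ?thesis using tensor_mat_index[OF cc one_carrier_mat lt l cir(4) that(3)] cir that
      by (simp add: O'_def)
  qed
  have ent0: "O' $$ (y, j * w + r') = (if r' = r then ctrl_reflection N \<psi> $$ (c * N + i, 0 * N + j) else 0)"
    if "j < N" "r' < w" for j r' using ent[of 0] that by simp
  have ent1: "O' $$ (y, (N + j) * w + r') = (if r' = r then ctrl_reflection N \<psi> $$ (c * N + i, 1 * N + j) else 0)"
    if "j < N" "r' < w" for j r' using ent[of 1] that by simp
  let ?x = "vec_index \<psi>"
  have d: "(\<Sum>r'<w. (if r' = r then a else 0) * h r') = a * h r" for a and h :: "nat \<Rightarrow> complex"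
    using cir by (simp add: if_distrib[of "\<lambda>u. u * _"] cong: if_cong)
  have d': "(\<Sum>r'<w. \<Sum>j<N. (if r' = r then a j else 0) * h j r') = (\<Sum>j<N. a j * h j r)" for a and h :: "nat \<Rightarrow> nat \<Rightarrow> complex"
    by (subst sum.swap) (simp only: d)
  have "mv O' F y ?x = (\<Sum>j<N. ctrl_reflection N \<psi> $$ (c * N + i, 0 * N + j) * F (j * w + r) ?x)
      + (\<Sum>j<N. ctrl_reflection N \<psi> $$ (c * N + i, 1 * N + j) * F ((N + j) * w + r) ?x)"
  proof -
    have "(\<Sum>j<N. \<Sum>r'<w. O' $$ (y, j * w + r') * F (j * w + r') ?x)
      = (\<Sum>j<N. \<Sum>r'<w. (if r' = r then ctrl_reflection N \<psi> $$ (c * N + i, 0 * N + j) else 0) * F (j * w + r') ?x)"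
      by (intro sum.cong refl) (simp only: ent0 lessThan_iff)
    moreover have "(\<Sum>r'<w. \<Sum>j<N. O' $$ (y, (N + j) * w + r') * F ((N + j) * w + r') ?x)
      = (\<Sum>r'<w. \<Sum>j<N. (if r' = r then ctrl_reflection N \<psi> $$ (c * N + i, 1 * N + j) else 0) * F ((N + j) * w + r') ?x)"
      by (intro sum.cong refl) (simp only: ent1 lessThan_iff)
    ultimately show ?thesis unfolding mv_def O' sum_index_decompose d d' by simp
  qed
  also have "\<dots> = reflect N w F y ?x"
  proof (cases "c = 0")
    case True
    have z: "ctrl_reflection N \<psi> $$ (c * N + i, 1 * N + j) = 0" if "j < N" for j
      using ctrl_reflection_index[OF psi, of c 1 i j] cir that True by simp
    have o: "ctrl_reflection N \<psi> $$ (c * N + i, 0 * N + j) * a = (if i = j then a else 0)" if "j < N" for j a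
      using ctrl_reflection_index[OF psi, of c 0 i j] cir that True by simp
    have "reflect N w F y ?x = F (i * w + r) ?x"
      using reflect_index[of c i N r w F ?x] cir True by simp
    moreover have "(\<Sum>j<N. ctrl_reflection N \<psi> $$ (c * N + i, 0 * N + j) * F (j * w + r) ?x) = (\<Sum>j<N. if i = j then F (j * w + r) ?x else 0)"
      by (intro sum.cong refl) (simp only: o lessThan_iff)
    moreover have "(\<Sum>j<N. ctrl_reflection N \<psi> $$ (c * N + i, 1 * N + j) * F ((N + j) * w + r) ?x) = 0"
      by (intro sum.neutral ballI) (simp only: z lessThan_iff, simp)
    ultimately show ?thesis using cir by (simp del: mult_0)
  next
    case False
    then have c1: "c = 1" using cir by simp
    have z: "ctrl_reflection N \<psi> $$ (c * N + i, 0 * N + j) = 0" if "j < N" for j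
      using ctrl_reflection_index[OF psi, of c 0 i j] cir that c1 by simp
    have o: "ctrl_reflection N \<psi> $$ (c * N + i, 1 * N + j) * a = (if i = j then a else 0) - 2 * (\<psi> $ i * (cnj (\<psi> $ j) * a))"
      if "j < N" for j a
      by (subst ctrl_reflection_index[OF psi]) (use cir that c1 in \<open>auto simp: left_diff_distrib\<close>)
    have "reflect N w F y ?x = F ((N + i) * w + r) ?x - 2 * (\<psi> $ i * (\<Sum>j<N. cnj (\<psi> $ j) * F ((N + j) * w + r) ?x))"
      using reflect_index[of c i N r w F ?x] cir c1 by simp
    moreover have "(\<Sum>j<N. ctrl_reflection N \<psi> $$ (c * N + i, 1 * N + j) * F ((N + j) * w + r) ?x)
      = (\<Sum>j<N. (if i = j then F ((N + j) * w + r) ?x else 0) - 2 * (\<psi> $ i * (cnj (\<psi> $ j) * F ((N + j) * w + r) ?x)))"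
      by (intro sum.cong refl) (simp only: o lessThan_iff)
    moreover have "(\<Sum>j<N. ctrl_reflection N \<psi> $$ (c * N + i, 0 * N + j) * F (j * w + r) ?x) = 0"
      by (intro sum.neutral ballI) (simp only: z lessThan_iff, simp)
    ultimately show ?thesis using cir by (simp add: sum_subtractf sum_distrib_left del: mult_0)
  qed
  finally show ?thesis by (simp add: O'_def)
qed

lemma apply_oracle_index:
  assumes psi: "\<psi> \<in> carrier_vec N" and R: "R \<in> carrier_mat (2 * N * w) (2 * N * w)"
    and ent: "\<And>l m. l < 2 * N * w \<Longrightarrow> m < 2 * N * w \<Longrightarrow>
      R $$ (l, m) = (\<Sum>f\<leftarrow>fs. fst f l (vec_index \<psi>) * cnj (fst f m (vec_index \<psi>)))"
  shows "apply_oracle N w \<psi> R \<in> carrier_mat (2 * N * w) (2 * N * w)"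
    and "i < 2 * N * w \<Longrightarrow> j < 2 * N * w \<Longrightarrow> apply_oracle N w \<psi> R $$ (i, j) =
      (\<Sum>f\<leftarrow>fs. reflect N w (fst f) i (vec_index \<psi>) * cnj (reflect N w (fst f) j (vec_index \<psi>)))"
proof -
  have O: "ctrl_reflection N \<psi> \<otimes>\<^sub>m 1\<^sub>m w \<in> carrier_mat (2 * N * w) (2 * N * w)"
    by (intro tensor_mat_carrier ctrl_reflection_carrier psi one_carrier_mat)
  show "apply_oracle N w \<psi> R \<in> carrier_mat (2 * N * w) (2 * N * w)"
    unfolding apply_oracle_def using O R mat_adjoint_carrier[OF O] by (metis mult_carrier_mat)
  assume ij: "i < 2 * N * w" "j < 2 * N * w"
  show "apply_oracle N w \<psi> R $$ (i, j) =
      (\<Sum>f\<leftarrow>fs. reflect N w (fst f) i (vec_index \<psi>) * cnj (reflect N w (fst f) j (vec_index \<psi>)))"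
    unfolding apply_oracle_def mv_oracle[OF psi ij(1), symmetric] mv_oracle[OF psi ij(2), symmetric]
    by (rule conj_index[OF O R ij]) (rule ent)
qed

lemma reflection_norm:
  assumes "(\<Sum>i<N. x i * cnj (x i)) = 1"
  shows "(\<Sum>i<N. (cmod (u i - 2 * (x i * (\<Sum>j<N. cnj (x j) * u j))))\<^sup>2) = (\<Sum>i<N. (cmod (u i))\<^sup>2)"
proof -
  define s where "s = (\<Sum>j<N. cnj (x j) * u j)"
  have "complex_of_real (\<Sum>i<N. (cmod (u i - 2 * (x i * s)))\<^sup>2)
      = (\<Sum>i<N. u i * cnj (u i) - 2 * cnj s * (cnj (x i) * u i) - 2 * s * cnj (cnj (x i) * u i) + 4 * s * cnj s * (x i * cnj (x i)))"
    unfolding of_real_sum complex_norm_square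
    by (intro sum.cong refl) (simp add: algebra_simps)
  also have "\<dots> = (\<Sum>i<N. u i * cnj (u i)) - 2 * cnj s * s - 2 * s * cnj s + 4 * s * cnj s * 1"
    unfolding sum.distrib sum_subtractf sum_distrib_left[symmetric] cnj_sum[symmetric] assms s_def[symmetric] ..
  also have "\<dots> = complex_of_real (\<Sum>i<N. (cmod (u i))\<^sup>2)"
    by (simp add: complex_norm_square algebra_simps del: of_real_power)
  finally show ?thesis unfolding s_def by (simp only: of_real_eq_iff)
qed

lemma reflect_norm:
  assumes "(\<Sum>i<N. x i * cnj (x i)) = 1"
  shows "(\<Sum>y<2 * N * w. (cmod (reflect N w F y x))\<^sup>2) = (\<Sum>y<2 * N * w. (cmod (F y x))\<^sup>2)"
proof -
  have r0: "reflect N w F (i * w + r) x = F (i * w + r) x" if "i < N" "r < w" for i r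
    using reflect_index[of 0 i N r w F x] that by simp
  have r1: "reflect N w F ((N + i) * w + r) x = F ((N + i) * w + r) x - 2 * (x i * (\<Sum>j<N. cnj (x j) * F ((N + j) * w + r) x))"
    if "i < N" "r < w" for i r
    using reflect_index[of 1 i N r w F x] that by simp
  have "(\<Sum>i<N. (cmod (reflect N w F ((N + i) * w + r) x))\<^sup>2) = (\<Sum>i<N. (cmod (F ((N + i) * w + r) x))\<^sup>2)"
    if "r < w" for r
    unfolding reflection_norm[OF assms, of "\<lambda>i. F ((N + i) * w + r) x", symmetric]
    by (intro sum.cong refl) (simp only: r1 that lessThan_iff)
  then have "(\<Sum>r<w. \<Sum>i<N. (cmod (reflect N w F ((N + i) * w + r) x))\<^sup>2) = (\<Sum>r<w. \<Sum>i<N. (cmod (F ((N + i) * w + r) x))\<^sup>2)"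
    by - (rule sum.cong[OF refl], simp)
  moreover have "(\<Sum>i<N. \<Sum>r<w. (cmod (reflect N w F (i * w + r) x))\<^sup>2) = (\<Sum>i<N. \<Sum>r<w. (cmod (F (i * w + r) x))\<^sup>2)"
    by (intro sum.cong refl) (simp only: r0 lessThan_iff)
  ultimately show ?thesis unfolding sum_index_decompose by simp
qed

section \<open>The hybrid argument\<close>

context haar_states begin

text \<open>A fixed choice of the polynomial \<open>d\<close> from \<open>hpoly_split\<close>, so
  that the simulated query can be defined as a function.\<close>

definition split_poly :: "nat \<Rightarrow> (nat \<Rightarrow> (nat \<Rightarrow> complex) \<Rightarrow> complex) \<Rightarrow> (nat \<Rightarrow> complex) \<Rightarrow> complex" where
  "split_poly k \<phi> = (SOME d. (\<forall>i<N. hpoly N k (\<lambda>x. x i * d x)) \<and> nice d \<and>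
     (\<Sum>i<N. msq (\<lambda>x. \<phi> i x - 2 * (x i * d x))) = (\<Sum>i<N. msq (\<phi> i)) \<and>
     real N * msq (\<lambda>x. (\<Sum>i<N. cnj (x i) * \<phi> i x) - d x) \<le> (\<Sum>i<N. msq (\<phi> i)))"

lemma split_poly:
  assumes phi: "\<And>i. i < N \<Longrightarrow> hpoly N k (\<phi> i)"
  shows "i < N \<Longrightarrow> hpoly N k (\<lambda>x. x i * split_poly k \<phi> x)" "nice (split_poly k \<phi>)"
    "(\<Sum>i<N. msq (\<lambda>x. \<phi> i x - 2 * (x i * split_poly k \<phi> x))) = (\<Sum>i<N. msq (\<phi> i))"
    "real N * msq (\<lambda>x. (\<Sum>i<N. cnj (x i) * \<phi> i x) - split_poly k \<phi> x) \<le> (\<Sum>i<N. msq (\<phi> i))"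
proof -
  have "\<exists>d. (\<forall>i<N. hpoly N k (\<lambda>x. x i * d x)) \<and> nice d \<and>
     (\<Sum>i<N. msq (\<lambda>x. \<phi> i x - 2 * (x i * d x))) = (\<Sum>i<N. msq (\<phi> i)) \<and>
     real N * msq (\<lambda>x. (\<Sum>i<N. cnj (x i) * \<phi> i x) - d x) \<le> (\<Sum>i<N. msq (\<phi> i))" (is "\<exists>d. ?P d")
    using phi
  proof (rule hpoly_split)
    fix d assume d: "hpoly N (k - 1) d" "\<And>i. i < N \<Longrightarrow> hpoly N k (\<lambda>x. x i * d x)"
      "(\<Sum>i<N. msq (\<lambda>x. \<phi> i x - 2 * (x i * d x))) = (\<Sum>i<N. msq (\<phi> i))"
      "real N * msq (\<lambda>x. (\<Sum>i<N. cnj (x i) * \<phi> i x) - d x) \<le> (\<Sum>i<N. msq (\<phi> i)) - msq d"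
    have "(\<Sum>i<N. msq (\<phi> i)) - msq d \<le> (\<Sum>i<N. msq (\<phi> i))" using msq_nonneg[of d] by simp
    with d(4) have "real N * msq (\<lambda>x. (\<Sum>i<N. cnj (x i) * \<phi> i x) - d x) \<le> (\<Sum>i<N. msq (\<phi> i))"
      by (rule order_trans)
    with d(2,3) nice_hpoly[OF d(1)] show "\<exists>d. ?P d" by (intro exI[of _ d] conjI allI impI)
  qed
  from someI_ex[OF this] have "?P (split_poly k \<phi>)" unfolding split_poly_def .
  then show "i < N \<Longrightarrow> hpoly N k (\<lambda>x. x i * split_poly k \<phi> x)" "nice (split_poly k \<phi>)"
    "(\<Sum>i<N. msq (\<lambda>x. \<phi> i x - 2 * (x i * split_poly k \<phi> x))) = (\<Sum>i<N. msq (\<phi> i))"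
    "real N * msq (\<lambda>x. (\<Sum>i<N. cnj (x i) * \<phi> i x) - split_poly k \<phi> x) \<le> (\<Sum>i<N. msq (\<phi> i))"
    by blast+
qed

text \<open>The query with the overlap between \<open>x\<close> and the register replaced by its
  holomorphic part; unlike \<open>reflect\<close> it does not leave degree \<open>k\<close>.\<close>

definition poly_reflect :: "nat \<Rightarrow> nat \<Rightarrow> (nat \<Rightarrow> (nat \<Rightarrow> complex) \<Rightarrow> complex) \<Rightarrow> nat \<Rightarrow> (nat \<Rightarrow> complex) \<Rightarrow> complex" where
  "poly_reflect k w G y x = G y x - (if y div w div N = 1
     then 2 * (x (y div w mod N) * split_poly k (\<lambda>j. G ((N + j) * w + y mod w)) x) else 0)"

lemma poly_reflect_index:
  assumes "c < 2" "i < N" "r < w"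
  shows "poly_reflect k w G ((c * N + i) * w + r) x = G ((c * N + i) * w + r) x - (if c = 1
     then 2 * (x i * split_poly k (\<lambda>j. G ((N + j) * w + r)) x) else 0)"
  using assms by (simp only: poly_reflect_def div_mult_add mod_mult_add)

lemma poly_reflect_low: "i < N \<Longrightarrow> r < w \<Longrightarrow> poly_reflect k w G (i * w + r) = G (i * w + r)"
  using poly_reflect_index[of 0 i r w k G] by (simp add: fun_eq_iff)

lemma poly_reflect_high: "i < N \<Longrightarrow> r < w \<Longrightarrow> poly_reflect k w G ((N + i) * w + r) =
   (\<lambda>x. G ((N + i) * w + r) x - 2 * (x i * split_poly k (\<lambda>j. G ((N + j) * w + r)) x))"
  using poly_reflect_index[of 1 i r w k G] by (simp add: fun_eq_iff)

lemma reflect_low: "i < N \<Longrightarrow> r < w \<Longrightarrow> reflect N w F (i * w + r) = F (i * w + r)"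
  using reflect_index[of 0 i N r w F] by (simp add: fun_eq_iff)

lemma reflect_high: "i < N \<Longrightarrow> r < w \<Longrightarrow> reflect N w F ((N + i) * w + r) =
   (\<lambda>x. F ((N + i) * w + r) x - 2 * (x i * (\<Sum>j<N. cnj (x j) * F ((N + j) * w + r) x)))"
  using reflect_index[of 1 i N r w F] by (simp add: fun_eq_iff)

lemma high_index_less: "i < N \<Longrightarrow> r < w \<Longrightarrow> (N + i) * w + r < 2 * N * w"
  by (intro mult_add_less) auto

lemma index_cases:
  assumes "y < 2 * N * w"
  obtains i r where "i < N" "r < w" "y = i * w + r" | i r where "i < N" "r < w" "y = (N + i) * w + r"
proof -
  obtain c i r where "y = (c * N + i) * w + r" "c < 2" "i < N" "r < w"
    using index_decompose[OF assms] .
  moreover from this have "c = 0 \<or> c = 1" by auto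
  ultimately show thesis using that by auto
qed

lemma nice_reflect:
  assumes F: "\<And>y. y < 2 * N * w \<Longrightarrow> nice (F y)" and y: "y < 2 * N * w"
  shows "nice (reflect N w F y)"
  using y
proof (cases rule: index_cases)
  case (1 i r)
  then show ?thesis using F y by (simp add: reflect_low)
next
  case (2 i r)
  show ?thesis unfolding 2(3) reflect_high[OF 2(1,2)]
    by (intro nice_intros F high_index_less 2) auto
qed

lemma hpoly_poly_reflect:
  assumes G: "\<And>y. y < 2 * N * w \<Longrightarrow> hpoly N k (G y)" and y: "y < 2 * N * w"
  shows "hpoly N k (poly_reflect k w G y)"
  using y
proof (cases rule: index_cases)
  case (1 i r)
  then show ?thesis using G y by (simp add: poly_reflect_low)
next
  case (2 i r)
  have "hpoly N k (\<lambda>x. x i * split_poly k (\<lambda>j. G ((N + j) * w + r)) x)"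
    using split_poly(1)[of k "\<lambda>j. G ((N + j) * w + r)" i] G high_index_less 2 by blast
  then show ?thesis unfolding 2(3) poly_reflect_high[OF 2(1,2)]
    by (intro hpoly_diff G high_index_less hpoly_cmult 2)
qed

lemma msq_poly_reflect:
  assumes G: "\<And>y. y < 2 * N * w \<Longrightarrow> hpoly N k (G y)"
  shows "(\<Sum>y<2 * N * w. msq (poly_reflect k w G y)) = (\<Sum>y<2 * N * w. msq (G y))"
proof -
  have "(\<Sum>i<N. msq (poly_reflect k w G ((N + i) * w + r))) = (\<Sum>i<N. msq (G ((N + i) * w + r)))" if r: "r < w" for r
  proof -
    have "(\<Sum>i<N. msq (poly_reflect k w G ((N + i) * w + r)))
      = (\<Sum>i<N. msq (\<lambda>x. G ((N + i) * w + r) x - 2 * (x i * split_poly k (\<lambda>j. G ((N + j) * w + r)) x)))"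
      by (intro sum.cong refl) (simp only: poly_reflect_high r lessThan_iff)
    also have "\<dots> = (\<Sum>i<N. msq (G ((N + i) * w + r)))"
      using r by (intro split_poly(3)[of k "\<lambda>i. G ((N + i) * w + r)"] G high_index_less)
    finally show ?thesis .
  qed
  then have "(\<Sum>r<w. \<Sum>i<N. msq (poly_reflect k w G ((N + i) * w + r))) = (\<Sum>r<w. \<Sum>i<N. msq (G ((N + i) * w + r)))"
    by - (rule sum.cong[OF refl], simp)
  moreover have "(\<Sum>i<N. \<Sum>r<w. msq (poly_reflect k w G (i * w + r))) = (\<Sum>i<N. \<Sum>r<w. msq (G (i * w + r)))"
    by (intro sum.cong refl) (simp only: poly_reflect_low lessThan_iff)
  ultimately show ?thesis unfolding sum_index_decompose by simp
qed

lemma msq_reflect: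
  assumes F: "\<And>y. y < 2 * N * w \<Longrightarrow> nice (F y)"
  shows "(\<Sum>y<2 * N * w. msq (reflect N w F y)) = (\<Sum>y<2 * N * w. msq (F y))"
proof -
  have "(\<Sum>y<2 * N * w. msq (reflect N w F y)) = (\<integral>\<psi>. (\<Sum>y<2 * N * w. (cmod (reflect N w F y (vec_index \<psi>)))\<^sup>2) \<partial>\<mu>)"
    unfolding msq_def by (rule Bochner_Integration.integral_sum[symmetric]) (auto intro!: integrable_msq nice_reflect F)
  also have "\<dots> = (\<integral>\<psi>. (\<Sum>y<2 * N * w. (cmod (F y (vec_index \<psi>)))\<^sup>2) \<partial>\<mu>)"
    by (intro Bochner_Integration.integral_cong refl reflect_norm) (simp add: space_haar unit_vec_norm)
  also have "\<dots> = (\<Sum>y<2 * N * w. msq (F y))"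
    unfolding msq_def by (rule Bochner_Integration.integral_sum) (auto intro!: integrable_msq F)
  finally show ?thesis .
qed

lemma msq_coord_mult:
  assumes "nice h"
  shows "(\<Sum>i<N. msq (\<lambda>x. a * (x i * h x))) = (cmod a)\<^sup>2 * msq h"
proof -
  have "(\<Sum>i<N. msq (\<lambda>x. a * (x i * h x))) = (\<integral>\<psi>. (\<Sum>i<N. (cmod (a * (\<psi> $ i * h (vec_index \<psi>))))\<^sup>2) \<partial>\<mu>)"
    unfolding msq_def
    by (rule Bochner_Integration.integral_sum[symmetric])
      (rule integrable_msq[of "\<lambda>x. a * (x _ * h x)"], intro nice_intros assms, simp)
  also have "\<dots> = (\<integral>\<psi>. (cmod a)\<^sup>2 * (cmod (h (vec_index \<psi>)))\<^sup>2 \<partial>\<mu>)"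
  proof (intro Bochner_Integration.integral_cong refl)
    fix \<psi> assume "\<psi> \<in> space \<mu>"
    then have "(\<Sum>i<N. (cmod (\<psi> $ i))\<^sup>2) = 1" by (simp add: space_haar unit_vec_norm)
    moreover have "(\<Sum>i<N. (cmod (a * (\<psi> $ i * h (vec_index \<psi>))))\<^sup>2) = (\<Sum>i<N. (cmod (\<psi> $ i))\<^sup>2) * ((cmod a)\<^sup>2 * (cmod (h (vec_index \<psi>)))\<^sup>2)"
      unfolding sum_distrib_right by (intro sum.cong refl) (simp add: norm_mult power_mult_distrib)
    ultimately show "(\<Sum>i<N. (cmod (a * (\<psi> $ i * h (vec_index \<psi>))))\<^sup>2) = (cmod a)\<^sup>2 * (cmod (h (vec_index \<psi>)))\<^sup>2"
      by simp
  qed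
  finally show ?thesis by (simp add: msq_def)
qed

text \<open>The two reflections differ only where the control is 1, by \<open>-2\<close> times
  \<open>x h\<close> with \<open>h\<close> the non-holomorphic remainder of the overlap; the factor
  4 is the square of this 2.\<close>

lemma msq_reflect_diff:
  assumes G: "\<And>y. y < 2 * N * w \<Longrightarrow> hpoly N k (G y)"
  shows "real N * (\<Sum>y<2 * N * w. msq (\<lambda>x. reflect N w G y x - poly_reflect k w G y x)) \<le> 4 * (\<Sum>y<2 * N * w. msq (G y))"
proof -
  define h where "h r x = (\<Sum>j<N. cnj (x j) * G ((N + j) * w + r) x) - split_poly k (\<lambda>j. G ((N + j) * w + r)) x" for r x
  have Gr: "hpoly N k (G ((N + j) * w + r))" if "j < N" "r < w" for j r
    using that by (intro G high_index_less)
  have nh: "nice (h r)" if "r < w" for r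
    unfolding h_def using that split_poly(2)[of k "\<lambda>j. G ((N + j) * w + r)"] Gr
    by (intro nice_intros nice_hpoly[of k "G _"]) auto
  have "(\<Sum>y<2 * N * w. msq (\<lambda>x. reflect N w G y x - poly_reflect k w G y x))
      = (\<Sum>i<N. \<Sum>r<w. 0) + (\<Sum>r<w. \<Sum>i<N. msq (\<lambda>x. (-2) * (x i * h r x)))"
    unfolding sum_index_decompose
  proof (intro arg_cong2[where f = "(+)"])
    show "(\<Sum>i<N. \<Sum>r<w. msq (\<lambda>x. reflect N w G (i * w + r) x - poly_reflect k w G (i * w + r) x)) = (\<Sum>i<N. \<Sum>r<w. 0)"
      by (intro sum.cong refl) (simp add: reflect_low poly_reflect_low)
    show "(\<Sum>r<w. \<Sum>i<N. msq (\<lambda>x. reflect N w G ((N + i) * w + r) x - poly_reflect k w G ((N + i) * w + r) x))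
        = (\<Sum>r<w. \<Sum>i<N. msq (\<lambda>x. (-2) * (x i * h r x)))"
      by (intro sum.cong refl arg_cong[where f = msq] ext)
        (simp only: reflect_high poly_reflect_high lessThan_iff h_def, simp add: algebra_simps)
  qed
  also have "\<dots> = (\<Sum>r<w. 4 * msq (h r))"
    by (simp only: sum.neutral_const add_0, rule sum.cong[OF refl], subst msq_coord_mult) (use nh in auto)
  finally have "real N * (\<Sum>y<2 * N * w. msq (\<lambda>x. reflect N w G y x - poly_reflect k w G y x)) = 4 * (\<Sum>r<w. real N * msq (h r))"
    by (simp add: sum_distrib_left mult_ac)
  also have "\<dots> \<le> 4 * (\<Sum>r<w. \<Sum>i<N. msq (G ((N + i) * w + r)))"
    unfolding h_def by (intro mult_left_mono sum_mono split_poly(4) Gr) auto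
  also have "\<dots> \<le> 4 * (\<Sum>y<2 * N * w. msq (G y))"
    unfolding sum_index_decompose by (simp add: sum_nonneg msq_nonneg)
  finally show ?thesis .
qed

text \<open>The old error passes through the true query, which is an isometry; the new error arises
  from replacing the query on the polynomial vector only. The estimate for polynomial fields is
  therefore never applied to the true state.\<close>

lemma tracked_oracle:
  assumes tr: "tracked k t (2 * N * w) \<rho> fs"
  shows "tracked k (Suc t) (2 * N * w) (\<lambda>\<psi>. apply_oracle N w \<psi> (\<rho> \<psi>))
    (map (\<lambda>f. (reflect N w (fst f), poly_reflect k w (snd f))) fs)" (is "tracked k _ ?d ?\<rho> ?fs")
  unfolding tracked_def
proof (intro conjI ballI allI impI)
  note tr' = tr[unfolded tracked_def]
  have F: "nice (fst f y)" and G: "hpoly N k (snd f y)" if "f \<in> set fs" "y < ?d" for f y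
    using tr' that by auto
  {
    fix \<psi> assume psi: "\<psi> \<in> unit_vecs N"
    let ?x = "vec_index \<psi>"
    have cv: "\<psi> \<in> carrier_vec N" using psi by (simp add: unit_vecs_def)
    have R: "\<rho> \<psi> \<in> carrier_mat ?d ?d" "\<And>l m. l < ?d \<Longrightarrow> m < ?d \<Longrightarrow> \<rho> \<psi> $$ (l, m) = (\<Sum>f\<leftarrow>fs. fst f l ?x * cnj (fst f m ?x))"
      using tr' psi by auto
    show "?\<rho> \<psi> \<in> carrier_mat ?d ?d" by (rule apply_oracle_index(1)[OF cv R])
    fix i j assume ij: "i < ?d" "j < ?d"
    have "?\<rho> \<psi> $$ (i, j) = (\<Sum>f\<leftarrow>fs. reflect N w (fst f) i ?x * cnj (reflect N w (fst f) j ?x))"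
      by (rule apply_oracle_index(2)[OF cv R ij])
    then show "?\<rho> \<psi> $$ (i, j) = (\<Sum>f\<leftarrow>?fs. fst f i ?x * cnj (fst f j ?x))"
      by (simp add: comp_def)
  }
  {
    fix f i assume "f \<in> set ?fs" "i < ?d"
    then obtain g where g: "g \<in> set fs" "f = (reflect N w (fst g), poly_reflect k w (snd g))" by auto
    show "nice (fst f i)" unfolding g(2) fst_conv
      by (rule nice_reflect) (use F[OF g(1)] \<open>i < ?d\<close> in auto)
    show "hpoly N k (snd f i)" unfolding g(2) snd_conv
      by (rule hpoly_poly_reflect) (use G[OF g(1)] \<open>i < ?d\<close> in auto)
  }
  have "(\<Sum>f\<leftarrow>fs. \<Sum>i<?d. msq (poly_reflect k w (snd f) i)) = (\<Sum>f\<leftarrow>fs. \<Sum>i<?d. msq (snd f i))"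
    by (intro arg_cong[where f = sum_list] map_cong refl msq_poly_reflect G)
  then show "(\<Sum>f\<leftarrow>?fs. \<Sum>i<?d. msq (snd f i)) = 1" using tr' by (simp add: comp_def)
  \<comment> \<open>If \<open>e\<close> bounds the old error, then
    \<open>(l + 1) / l * e + 4 * (l + 1)\<close> bounds the new one. For \<open>l = t + 1\<close>
    and initial value 0 this recurrence is solved by \<open>4 * t * (t + 1)\<close>.\<close>
  define l where "l = real t + 1"
  have l: "l > 0" by (simp add: l_def)
  have step: "real N * (\<Sum>i<?d. msq (\<lambda>x. reflect N w (fst f) i x - poly_reflect k w (snd f) i x))
     \<le> (l + 1) / l * (real N * (\<Sum>i<?d. msq (\<lambda>x. fst f i x - snd f i x))) + (l + 1) * (4 * (\<Sum>i<?d. msq (snd f i)))"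
    if f: "f \<in> set fs" for f
  proof -
    define H where "H y x = fst f y x - snd f y x" for y x
    define D where "D y x = reflect N w (snd f) y x - poly_reflect k w (snd f) y x" for y x
    have nG: "nice (snd f y)" if "y < ?d" for y using G[OF f that] by (rule nice_hpoly)
    have nH: "nice (H y)" if "y < ?d" for y
      unfolding H_def by (intro nice_diff F f nG that)
    have nD: "nice (D y)" if "y < ?d" for y
      unfolding D_def
      by (intro nice_diff nice_reflect nice_hpoly[OF hpoly_poly_reflect] nG G f that)
    have "(\<lambda>x. reflect N w (fst f) y x - poly_reflect k w (snd f) y x) = (\<lambda>x. reflect N w H y x + D y x)" for y
      by (simp add: fun_eq_iff D_def H_def reflect_def right_diff_distrib sum_subtractf)
    then have "(\<Sum>i<?d. msq (\<lambda>x. reflect N w (fst f) i x - poly_reflect k w (snd f) i x))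
        \<le> (\<Sum>i<?d. (l + 1) / l * msq (reflect N w H i) + (l + 1) * msq (D i))"
      by (simp only:) (intro sum_mono msq_add_le nice_reflect nH nD l, auto)
    also have "\<dots> = (l + 1) / l * (\<Sum>i<?d. msq (H i)) + (l + 1) * (\<Sum>i<?d. msq (D i))"
      by (simp only: sum.distrib sum_distrib_left[symmetric] msq_reflect[OF nH])
    finally have "real N * (\<Sum>i<?d. msq (\<lambda>x. reflect N w (fst f) i x - poly_reflect k w (snd f) i x)) \<le> real N * \<dots>"
      by (rule mult_left_mono) simp
    also have "\<dots> = (l + 1) / l * (real N * (\<Sum>i<?d. msq (H i))) + (l + 1) * (real N * (\<Sum>i<?d. msq (D i)))"
      by (simp add: algebra_simps)
    also have "\<dots> \<le> (l + 1) / l * (real N * (\<Sum>i<?d. msq (H i))) + (l + 1) * (4 * (\<Sum>i<?d. msq (snd f i)))"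
      using l unfolding D_def by (intro add_left_mono mult_left_mono msq_reflect_diff G f) auto
    finally show ?thesis unfolding H_def .
  qed
  have "real N * (\<Sum>f\<leftarrow>?fs. \<Sum>i<?d. msq (\<lambda>x. fst f i x - snd f i x))
      = (\<Sum>f\<leftarrow>fs. real N * (\<Sum>i<?d. msq (\<lambda>x. reflect N w (fst f) i x - poly_reflect k w (snd f) i x)))"
    by (simp add: comp_def sum_list_const_mult)
  also have "\<dots> \<le> (\<Sum>f\<leftarrow>fs. (l + 1) / l * (real N * (\<Sum>i<?d. msq (\<lambda>x. fst f i x - snd f i x))) + (l + 1) * (4 * (\<Sum>i<?d. msq (snd f i))))"
    by (intro sum_list_mono step)
  also have "\<dots> = (l + 1) / l * (real N * (\<Sum>f\<leftarrow>fs. \<Sum>i<?d. msq (\<lambda>x. fst f i x - snd f i x))) + (l + 1) * (4 * (\<Sum>f\<leftarrow>fs. \<Sum>i<?d. msq (snd f i)))"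
    by (simp only: sum_list_addf sum_list_const_mult)
  also have "\<dots> \<le> (l + 1) / l * (4 * real t * (real t + 1)) + (l + 1) * (4 * 1)"
    using tr' l by (intro add_mono mult_left_mono) auto
  also have "\<dots> = 4 * real (Suc t) * (real (Suc t) + 1)"
    using l by (simp add: l_def field_simps)
  finally show "real N * (\<Sum>f\<leftarrow>?fs. \<Sum>i<?d. msq (\<lambda>x. fst f i x - snd f i x)) \<le> 4 * real (Suc t) * (real (Suc t) + 1)" .
qed

section \<open>Success probability of an arbitrary algorithm\<close>

lemma msq_tpow: "(\<Sum>I<N ^ k. msq (\<lambda>x. tpow N x k I)) = 1"
proof -
  have "(\<Sum>I<N ^ k. msq (\<lambda>x. tpow N x k I)) = (\<integral>\<psi>. (\<Sum>I<N ^ k. (cmod (tpow N (vec_index \<psi>) k I))\<^sup>2) \<partial>\<mu>)"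
    unfolding msq_def by (rule Bochner_Integration.integral_sum[symmetric]) (auto intro!: integrable_msq nice_tpow)
  also have "\<dots> = (\<integral>\<psi>. 1 \<partial>\<mu>)"
    by (intro Bochner_Integration.integral_cong refl) (simp add: space_haar tpow_norm)
  finally show ?thesis by (simp add: prob_space)
qed

lemma tracked_init:
  "tracked k 0 (N ^ k) (\<lambda>\<psi>. tensor_power (ket_bra \<psi>) k) [(\<lambda>I x. tpow N x k I, \<lambda>I x. tpow N x k I)]"
  unfolding tracked_def
  by (auto simp: tensor_power_ket_bra[OF unit_vecs_carrier] msq_tpow intro: nice_tpow hpoly_tpow)

lemma oracle_alg_tracked:
  assumes "oracle_alg N (N ^ k) t b A"
  shows "\<exists>fs. tracked k t b (\<lambda>\<psi>. A \<psi> (tensor_power (ket_bra \<psi>) k)) fs"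
  using assms
proof (induction rule: oracle_alg.induct)
  case (no_query b E)
  then obtain Ks where "kraus_family (N ^ k) b Ks" "E = kraus_op Ks b"
    unfolding quantum_op_iff by blast
  then show ?case using tracked_kraus[OF tracked_init] by blast
next
  case (query t w A b E)
  then obtain Ks where "kraus_family (2 * N * w) b Ks" "E = kraus_op Ks b"
    unfolding quantum_op_iff by blast
  moreover obtain fs where "tracked k t (2 * N * w) (\<lambda>\<psi>. A \<psi> (tensor_power (ket_bra \<psi>) k)) fs"
    using query by blast
  ultimately show ?case using tracked_kraus[OF tracked_oracle] by blast
qed

lemma trace_tensor_power:
  assumes psi: "\<psi> \<in> unit_vecs N" and R: "R \<in> carrier_mat (N ^ m) (N ^ m)"
    and ent: "\<And>i j. i < N ^ m \<Longrightarrow> j < N ^ m \<Longrightarrow> R $$ (i, j) = (\<Sum>f\<leftarrow>fs. F f i * cnj (F f j))"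
  shows "mat_trace (tensor_power (ket_bra \<psi>) m * R) =
    complex_of_real (\<Sum>f\<leftarrow>fs. (cmod (\<Sum>J<N ^ m. cnj (tpow N (vec_index \<psi>) m J) * F f J))\<^sup>2)"
proof -
  define u where "u = tpow N (vec_index \<psi>) m"
  note T = tensor_power_ket_bra[OF unit_vecs_carrier[OF psi], where k = m]
  have "mat_trace (tensor_power (ket_bra \<psi>) m * R) = (\<Sum>i<N ^ m. \<Sum>j<N ^ m. u i * cnj (u j) * R $$ (j, i))"
  proof -
    have d: "dim_row (tensor_power (ket_bra \<psi>) m) = N ^ m" "dim_col (tensor_power (ket_bra \<psi>) m) = N ^ m"
      "dim_row R = N ^ m" "dim_col R = N ^ m" using T(1) R by auto
    show ?thesis unfolding mat_trace_def index_mult_mat(2) d u_def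
      by (rule sum.cong[OF refl], simp only: index_mult_mat_sum d lessThan_iff,
          rule sum.cong[OF refl], simp only: T(2) lessThan_iff)
  qed
  also have "\<dots> = (\<Sum>i<N ^ m. \<Sum>j<N ^ m. \<Sum>n<length fs. (cnj (u j) * F (fs ! n) j) * cnj (cnj (u i) * F (fs ! n) i))"
    by (intro sum.cong refl) (simp add: ent sum_list_map_nth sum_distrib_left mult_ac)
  also have "\<dots> = (\<Sum>n<length fs. \<Sum>i<N ^ m. \<Sum>j<N ^ m. (cnj (u j) * F (fs ! n) j) * cnj (cnj (u i) * F (fs ! n) i))"
    by (simp only: sum.swap[where A = "{..<N ^ m}" and B = "{..<length fs}"])
  also have "\<dots> = (\<Sum>n<length fs. (\<Sum>j<N ^ m. cnj (u j) * F (fs ! n) j) * cnj (\<Sum>i<N ^ m. cnj (u i) * F (fs ! n) i))"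
    unfolding cnj_sum sum_product by (rule sum.cong[OF refl], rule sum.swap)
  finally show ?thesis
    by (simp only: sum_list_map_nth complex_norm_square[symmetric] of_real_sum[symmetric] u_def)
qed

text \<open>The overlap of a branch is that of its polynomial vector plus that of the error. The
  first is subject to \<open>cloning_bound\<close>, and the second is at most the norm of the
  error.\<close>

lemma cloner_bound:
  assumes "cloner N k T A"
  shows "avg_success \<mu> k A \<le> 16 * (real T ^ 2 / real N + (real k + 1) / real N)"
proof -
  obtain t where t: "t \<le> T" "oracle_alg N (N ^ k) t (N ^ (k + 1)) A"
    using assms unfolding cloner_def by blast
  obtain fs where fs: "tracked k t (N ^ Suc k) (output_state k A) fs"
    using oracle_alg_tracked[OF t(2)] by (auto simp: output_state_def[abs_def])
  let ?M = "N ^ Suc k"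
  have F: "nice (fst f y)" and G: "hpoly N k (snd f y)" if "f \<in> set fs" "y < ?M" for f y
    using fs that unfolding tracked_def by blast+
  note nG = nice_hpoly[OF G]
  define ov where "ov F x = (\<Sum>J<?M. cnj (tpow N x (Suc k) J) * F J x)" for F :: "nat \<Rightarrow> (nat \<Rightarrow> complex) \<Rightarrow> complex" and x
  have nov: "nice (ov F)" if "\<And>y. y < ?M \<Longrightarrow> nice (F y)" for F
    unfolding ov_def using that by (intro nice_intros nice_tpow) auto
  have tr: "Re (mat_trace (tensor_power (ket_bra \<psi>) (k + 1) * output_state k A \<psi>))
      = (\<Sum>n<length fs. (cmod (ov (fst (fs ! n)) (vec_index \<psi>)))\<^sup>2)" if psi: "\<psi> \<in> unit_vecs N" for \<psi>
  proof -
    have R: "output_state k A \<psi> \<in> carrier_mat ?M ?M" "\<And>i j. i < ?M \<Longrightarrow> j < ?M \<Longrightarrow>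
      output_state k A \<psi> $$ (i, j) = (\<Sum>f\<leftarrow>fs. fst f i (vec_index \<psi>) * cnj (fst f j (vec_index \<psi>)))"
      using fs psi unfolding tracked_def by blast+
    show ?thesis
      using trace_tensor_power[OF psi R(1), of "\<lambda>f i. fst f i (vec_index \<psi>)" fs] R(2)
      by (simp add: sum_list_map_nth ov_def del: power_Suc)
  qed
  have "avg_success \<mu> k A = (\<integral>\<psi>. (\<Sum>n<length fs. (cmod (ov (fst (fs ! n)) (vec_index \<psi>)))\<^sup>2) \<partial>\<mu>)"
    unfolding avg_success_def by (intro Bochner_Integration.integral_cong refl tr) (simp add: space_haar)
  also have "\<dots> = (\<Sum>f\<leftarrow>fs. msq (ov (fst f)))"
    unfolding msq_def sum_list_map_nth
    by (rule Bochner_Integration.integral_sum) (auto intro!: integrable_msq nov F simp del: power_Suc)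
  finally have avg: "avg_success \<mu> k A = (\<Sum>f\<leftarrow>fs. msq (ov (fst f)))" .
  have step: "real N * msq (ov (fst f)) \<le> 2 * (real (Suc k) * (\<Sum>J<?M. msq (snd f J))) +
      2 * (real N * (\<Sum>J<?M. msq (\<lambda>x. fst f J x - snd f J x)))" if f: "f \<in> set fs" for f
  proof -
    define D where "D J x = fst f J x - snd f J x" for J x
    have nD: "nice (D J)" if "J < ?M" for J unfolding D_def by (intro nice_diff F nG f that)
    have "ov (fst f) = (\<lambda>x. ov (snd f) x + ov D x)"
      by (simp add: ov_def D_def fun_eq_iff right_diff_distrib sum_subtractf)
    then have "msq (ov (fst f)) \<le> (1 + 1) / 1 * msq (ov (snd f)) + (1 + 1) * msq (ov D)"
      by (simp only:) (intro msq_add_le nov nG nD f, auto)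
    then have "real N * msq (ov (fst f)) \<le> real N * (2 * msq (ov (snd f)) + 2 * msq (ov D))"
      by (intro mult_left_mono) auto
    also have "\<dots> = 2 * (real N * msq (ov (snd f))) + 2 * (real N * msq (ov D))" by (simp add: algebra_simps)
    also have "\<dots> \<le> 2 * (real (Suc k) * (\<Sum>J<?M. msq (snd f J))) + 2 * (real N * (\<Sum>J<?M. msq (D J)))"
      unfolding ov_def by (intro add_mono mult_left_mono cloning_bound msq_project_tpow G nD f) auto
    finally show ?thesis unfolding D_def .
  qed
  have "real N * avg_success \<mu> k A = (\<Sum>f\<leftarrow>fs. real N * msq (ov (fst f)))"
    by (simp add: avg sum_list_const_mult)
  also have "\<dots> \<le> (\<Sum>f\<leftarrow>fs. 2 * (real (Suc k) * (\<Sum>J<?M. msq (snd f J))) +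
      2 * (real N * (\<Sum>J<?M. msq (\<lambda>x. fst f J x - snd f J x))))"
    by (intro sum_list_mono step)
  also have "\<dots> = 2 * (real (Suc k) * (\<Sum>f\<leftarrow>fs. \<Sum>J<?M. msq (snd f J))) +
      2 * (real N * (\<Sum>f\<leftarrow>fs. \<Sum>J<?M. msq (\<lambda>x. fst f J x - snd f J x)))"
    by (simp only: sum_list_addf sum_list_const_mult)
  also have "\<dots> \<le> 2 * (real (Suc k) * 1) + 2 * (4 * real t * (real t + 1))"
    using fs unfolding tracked_def by (intro add_mono mult_left_mono) auto
  \<comment> \<open>Since \<open>t \<le> t^2\<close> for natural numbers,
    \<open>8 * t * (t + 1)\<close> is at most \<open>16 * t^2\<close>; this is the origin of the
    constant.\<close>
  also have "\<dots> \<le> 16 * (real T ^ 2 + (real k + 1))"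
  proof -
    have "real t \<le> real t * real t" by (cases t) auto
    moreover have "real t * real t \<le> real T * real T" using t(1) by (intro mult_mono) auto
    ultimately show ?thesis by (simp add: power2_eq_square algebra_simps)
  qed
  finally have "avg_success \<mu> k A \<le> 16 * (real T ^ 2 + (real k + 1)) / real N"
    using N_pos by (subst pos_le_divide_eq) (simp_all add: mult.commute)
  then show ?thesis by (simp add: add_divide_distrib distrib_left)
qed

section \<open>Amplitude amplification\<close>

text \<open>A single branch is enough in the tightness part, where every operation before the last
  one has only one Kraus operator.\<close>

definition pure_family :: "nat \<Rightarrow> (complex vec \<Rightarrow> complex mat) \<Rightarrow> (nat \<Rightarrow> (nat \<Rightarrow> complex) \<Rightarrow> complex) \<Rightarrow> bool" where
  "pure_family a \<rho> F \<longleftrightarrow> (\<forall>\<psi>\<in>unit_vecs N. \<rho> \<psi> \<in> carrier_mat a a \<and>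
    (\<forall>i<a. \<forall>j<a. \<rho> \<psi> $$ (i, j) = F i (vec_index \<psi>) * cnj (F j (vec_index \<psi>))))"

lemma pure_family_cong:
  assumes "pure_family a \<rho> F" "\<And>\<psi> i. \<psi> \<in> unit_vecs N \<Longrightarrow> i < a \<Longrightarrow> F i (vec_index \<psi>) = G i (vec_index \<psi>)"
  shows "pure_family a \<rho> G"
  using assms unfolding pure_family_def by simp

lemma pure_family_input: "pure_family (N ^ k) (\<lambda>\<psi>. tensor_power (ket_bra \<psi>) k) (\<lambda>I x. tpow N x k I)"
  unfolding pure_family_def by (auto simp: tensor_power_ket_bra[OF unit_vecs_carrier])

lemma pure_family_isometry:
  assumes P: "pure_family a \<rho> F" and V: "V \<in> carrier_mat b a"
  shows "pure_family b (\<lambda>\<psi>. kraus_op [V] b (\<rho> \<psi>)) (mv V F)"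
  unfolding pure_family_def
proof
  fix \<psi> assume "\<psi> \<in> unit_vecs N"
  with P have R: "\<rho> \<psi> \<in> carrier_mat a a"
    "\<And>l m. l < a \<Longrightarrow> m < a \<Longrightarrow> \<rho> \<psi> $$ (l, m) = (\<Sum>f\<leftarrow>[(F, F)]. fst f l (vec_index \<psi>) * cnj (fst f m (vec_index \<psi>)))"
    unfolding pure_family_def by auto
  have "set [V] \<subseteq> carrier_mat b a" using V by simp
  from kraus_op_index[OF this R]
  show "kraus_op [V] b (\<rho> \<psi>) \<in> carrier_mat b b \<and>
    (\<forall>i<b. \<forall>j<b. kraus_op [V] b (\<rho> \<psi>) $$ (i, j)
      = mv V F i (vec_index \<psi>) * cnj (mv V F j (vec_index \<psi>)))" by simp
qed

lemma pure_family_oracle: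
  assumes P: "pure_family (2 * N * w) \<rho> F"
  shows "pure_family (2 * N * w) (\<lambda>\<psi>. apply_oracle N w \<psi> (\<rho> \<psi>)) (reflect N w F)"
  unfolding pure_family_def
proof
  let ?d = "2 * N * w"
  fix \<psi> assume psi: "\<psi> \<in> unit_vecs N"
  have cv: "\<psi> \<in> carrier_vec N" using psi by (simp add: unit_vecs_def)
  have R: "\<rho> \<psi> \<in> carrier_mat ?d ?d"
    "\<And>l m. l < ?d \<Longrightarrow> m < ?d \<Longrightarrow> \<rho> \<psi> $$ (l, m) = (\<Sum>f\<leftarrow>[(F, F)]. fst f l (vec_index \<psi>) * cnj (fst f m (vec_index \<psi>)))"
    using P psi unfolding pure_family_def by auto
  show "apply_oracle N w \<psi> (\<rho> \<psi>) \<in> carrier_mat ?d ?d \<and> (\<forall>i<?d. \<forall>j<?d.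
     apply_oracle N w \<psi> (\<rho> \<psi>) $$ (i, j) = reflect N w F i (vec_index \<psi>) * cnj (reflect N w F j (vec_index \<psi>)))"
    using apply_oracle_index[OF cv R] by simp
qed

text \<open>Both constructions below succeed with the same probability \<open>p\<close> for every
  \<open>\<psi>\<close>, so the average reduces to a pointwise computation.\<close>

lemma avg_success_pure:
  assumes P: "pure_family a \<rho> F" and Ks: "set Ks \<subseteq> carrier_mat (N ^ Suc k) a"
    and A: "\<And>\<psi>. output_state k A \<psi> = kraus_op Ks (N ^ Suc k) (\<rho> \<psi>)"
    and p: "\<And>\<psi>. \<psi> \<in> unit_vecs N \<Longrightarrow>
      (\<Sum>K\<leftarrow>Ks. (cmod (\<Sum>J<N ^ Suc k. cnj (tpow N (vec_index \<psi>) (Suc k) J) * mv K F J (vec_index \<psi>)))\<^sup>2) = p"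
  shows "avg_success \<mu> k A = p"
proof -
  have "Re (mat_trace (tensor_power (ket_bra \<psi>) (k + 1) * output_state k A \<psi>)) = p" if psi: "\<psi> \<in> unit_vecs N" for \<psi>
  proof -
    let ?x = "vec_index \<psi>" and ?M = "N ^ Suc k"
    have R: "\<rho> \<psi> \<in> carrier_mat a a"
      "\<And>l m. l < a \<Longrightarrow> m < a \<Longrightarrow> \<rho> \<psi> $$ (l, m) = (\<Sum>f\<leftarrow>[(F, F)]. fst f l ?x * cnj (fst f m ?x))"
      using P psi unfolding pure_family_def by auto
    have ent: "output_state k A \<psi> $$ (i, j) = (\<Sum>K\<leftarrow>Ks. mv K F i ?x * cnj (mv K F j ?x))"
      if "i < ?M" "j < ?M" for i j
      using kraus_op_index(2)[OF Ks R that] unfolding A by simp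
    have c: "output_state k A \<psi> \<in> carrier_mat ?M ?M"
      unfolding A by (rule kraus_op_index(1)[OF Ks R])
    have "mat_trace (tensor_power (ket_bra \<psi>) (Suc k) * output_state k A \<psi>) = complex_of_real p"
      using trace_tensor_power[OF psi c, of "\<lambda>K i. mv K F i ?x" Ks] ent p[OF psi] by simp
    then show ?thesis by simp
  qed
  then have "avg_success \<mu> k A = (\<integral>\<psi>. p \<partial>\<mu>)"
    unfolding avg_success_def by (intro Bochner_Integration.integral_cong refl) (simp add: space_haar)
  then show ?thesis by (simp add: prob_space)
qed

end

text \<open>The query register starts maximally entangled with a copy of itself, so that the initial overlap
  with the marked subspace is \<open>g1 / sqrt N\<close> for every \<open>\<psi>\<close>; the weights \<open>g0\<close>, \<open>g1\<close> of the control qubit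
  serve to tune the angle so that the rotation ends exactly on the target. A basis index is
  \<open>((c * N + i) * N + j) * M + q\<close> with control bit \<open>c\<close>, query register \<open>i\<close>, its partner \<open>j\<close> and the given
  copies \<open>q\<close>.\<close>

locale grover = haar_states +
  fixes k :: nat and g0 g1 :: real
  assumes weights: "g0\<^sup>2 + g1\<^sup>2 = 1"
begin

abbreviation M :: nat where "M \<equiv> N ^ k"
abbreviation w :: nat where "w \<equiv> N * M"

definition start :: "nat \<Rightarrow> real" where
  "start p = (if p div N mod N = p mod N then (if p div N div N = 1 then g1 else g0) / sqrt (real N) else 0)"

text \<open>The vector \<open>(a |start\<rangle> + b |1\<rangle>|x\<rangle>|cnj x\<rangle>) \<otimes> x\<^bsup>\<otimes>k\<^esup>\<close>.\<close>

definition amp :: "real \<Rightarrow> real \<Rightarrow> nat \<Rightarrow> (nat \<Rightarrow> complex) \<Rightarrow> complex" where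
  "amp a b y x = (let p = y div M in complex_of_real (a * start p) +
     (if p div N div N = 1 then complex_of_real b * (x (p div N mod N) * cnj (x (p mod N))) else 0)) * tpow N x k (y mod M)"

lemma M_pos: "M > 0" using N_pos by simp

lemma start_index:
  assumes "c < 2" "i < N" "j < N"
  shows "start ((c * N + i) * N + j) = (if i = j then (if c = 1 then g1 else g0) / sqrt (real N) else 0)"
  using assms by (simp only: start_def div_mult_add mod_mult_add)

lemma sum_pairs: "(\<Sum>p<2 * N * N. h p) = (\<Sum>i<N. \<Sum>j<N. h ((0 * N + i) * N + j)) + (\<Sum>i<N. \<Sum>j<N. h ((1 * N + i) * N + j))"
  for h :: "nat \<Rightarrow> 'a::comm_monoid_add"
  unfolding sum_lessThan_mult by (simp add: numeral_2_eq_2)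

lemma sum_dim: "(\<Sum>y<2 * N * w. h y) = (\<Sum>p<2 * N * N. \<Sum>q<M. h (p * M + q))"
  for h :: "nat \<Rightarrow> 'a::comm_monoid_add"
  using sum_lessThan_mult[of h "2 * N * N" M] by (simp add: mult.assoc)

lemma sum_start_sq: "(\<Sum>p<2 * N * N. (start p)\<^sup>2) = 1"
proof -
  have "(\<Sum>j<N. (start ((c * N + i) * N + j))\<^sup>2) = (if c = 1 then g1 else g0)\<^sup>2 / real N" if "c < 2" "i < N" for c i
  proof -
    have "(\<Sum>j<N. (start ((c * N + i) * N + j))\<^sup>2) = (\<Sum>j<N. if i = j then (if c = 1 then g1 else g0)\<^sup>2 / real N else 0)"
      using that by (intro sum.cong refl) (auto simp: start_index power_divide)
    then show ?thesis using that by simp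
  qed
  then have "(\<Sum>i<N. \<Sum>j<N. (start ((c * N + i) * N + j))\<^sup>2) = (if c = 1 then g1 else g0)\<^sup>2" if "c < 2" for c
    using that N_pos by simp
  from this[of 0] this[of 1] show ?thesis unfolding sum_pairs using weights by simp
qed

lemma amp_index:
  assumes "c < 2" "i < N" "j < N" "q < M"
  shows "amp a b ((c * N + i) * w + (j * M + q)) x =
    ((if i = j then complex_of_real (a * ((if c = 1 then g1 else g0) / sqrt (real N))) else 0) +
      (if c = 1 then complex_of_real b * (x i * cnj (x j)) else 0)) * tpow N x k q"
proof -
  have "(c * N + i) * w + (j * M + q) = ((c * N + i) * N + j) * M + q" by (simp add: algebra_simps)
  then show ?thesis
    using assms start_index[OF assms(1-3)] by (simp only: amp_def div_mult_add mod_mult_add Let_def) simp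
qed

text \<open>The overlap of \<open>start\<close> with the marked vector, hence the sine of half the
  rotation angle per round.\<close>

definition sigma :: real where "sigma = g1 / sqrt (real N)"

text \<open>Projecting the register of \<open>start\<close> with control 1 onto \<open>x\<close>
  leaves the partner in the state \<open>cnj x\<close>. The query therefore preserves the plane of
  \<open>start\<close> and the marked vector and acts there by reversing the marked
  direction.\<close>

lemma reflect_amp:
  assumes x: "(\<Sum>i<N. x i * cnj (x i)) = 1" and y: "y < 2 * N * w"
  shows "reflect N w (amp a b) y x = amp a (- (2 * sigma * a + b)) y x"
proof -
  obtain c i r where y1: "y = (c * N + i) * w + r" "c < 2" "i < N" "r < w"
    using index_decompose[OF y] .
  define j q where "j = r div M" and "q = r mod M"
  have r: "r = j * M + q" by (simp only: j_def q_def div_mult_mod_eq)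
  have jq: "j < N" "q < M"
    using y1(4) M_pos by (simp_all add: j_def q_def less_mult_imp_div_less)
  have "(\<Sum>l<N. cnj (x l) * amp a b ((N + l) * w + r) x) = (a * sigma + b) * cnj (x j) * tpow N x k q"
  proof -
    have "(\<Sum>l<N. cnj (x l) * amp a b ((N + l) * w + r) x)
      = (\<Sum>l<N. (if l = j then cnj (x l) * (a * sigma) * tpow N x k q else 0) + of_real b * cnj (x j) * tpow N x k q * (x l * cnj (x l)))"
    proof (intro sum.cong refl)
      fix l assume "l \<in> {..<N}"
      then show "cnj (x l) * amp a b ((N + l) * w + r) x
        = (if l = j then cnj (x l) * (a * sigma) * tpow N x k q else 0) + of_real b * cnj (x j) * tpow N x k q * (x l * cnj (x l))"
        using amp_index[of 1 l j q a b x] r jq by (auto simp: sigma_def algebra_simps)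
    qed
    also have "\<dots> = (a * sigma + b) * cnj (x j) * tpow N x k q"
      unfolding sum.distrib sum_distrib_left[symmetric] x using jq by (simp add: algebra_simps)
    finally show ?thesis .
  qed
  then show ?thesis
    unfolding y1(1) reflect_index[OF y1(2-4)] unfolding r amp_index[OF y1(2,3) jq]
    by (auto simp: sigma_def algebra_simps)
qed

definition prep :: "complex mat" where
  "prep = Matrix.mat (2 * N * w) M (\<lambda>(y, q). if y mod M = q then complex_of_real (start (y div M)) else 0)"

definition diffusion :: "complex mat" where
  "diffusion = Matrix.mat (2 * N * w) (2 * N * w) (\<lambda>(y, z). if y mod M = z mod M
     then complex_of_real (2 * start (y div M) * start (z div M) - (if y div M = z div M then 1 else 0)) else 0)"

text \<open>Tracing out the control bit \<open>c\<close> and the partner \<open>j\<close> takes one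
  Kraus operator for each value \<open>m = c * N + j\<close>; the output is the query register
  followed by the \<open>k\<close> copies.\<close>

definition discard :: "nat \<Rightarrow> complex mat" where
  "discard m = Matrix.mat w (2 * N * w) (\<lambda>(z, y).
     if y = (m div N * N + z div M) * w + (m mod N * M + z mod M) then 1 else 0)"

lemma dim_split:
  assumes "y < 2 * N * w"
  obtains p q where "y = p * M + q" "p < 2 * N * N" "q < M"
proof (rule that[of "y div M" "y mod M"])
  show "y div M < 2 * N * N" using assms by (intro less_mult_imp_div_less) (simp add: mult_ac)
  show "y = y div M * M + y mod M" by (simp only: div_mult_mod_eq)
  show "y mod M < M" using M_pos by simp
qed

lemma dim_less: "p < 2 * N * N \<Longrightarrow> q < M \<Longrightarrow> p * M + q < 2 * N * w"
  using mult_add_less[of p "2 * N * N" q M] by (simp add: mult.assoc)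

lemma kraus_prep: "kraus_family M (2 * N * w) [prep]"
proof -
  have "set [prep] \<subseteq> carrier_mat (2 * N * w) M" by (simp add: prep_def)
  moreover have "(\<Sum>y<2 * N * w. cnj (prep $$ (y, q1)) * prep $$ (y, q2)) = (if q1 = q2 then 1 else 0)"
    if q: "q1 < M" "q2 < M" for q1 q2
  proof -
    have "(\<Sum>y<2 * N * w. cnj (prep $$ (y, q1)) * prep $$ (y, q2))
      = (\<Sum>p<2 * N * N. \<Sum>q<M. if q = q1 then (if q1 = q2 then of_real ((start p)\<^sup>2) else 0) else 0)"
      unfolding sum_dim using q
      by (intro sum.cong refl) (auto simp: prep_def dim_less power2_eq_square div_mult_add)
    also have "\<dots> = (if q1 = q2 then 1 else 0)"
      using q sum_start_sq by (simp del: of_real_power flip: of_real_sum)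
    finally show ?thesis .
  qed
  ultimately show ?thesis by (subst kraus_family_iff) auto
qed

lemma kraus_diffusion: "kraus_family (2 * N * w) (2 * N * w) [diffusion]"
proof -
  let ?D = "\<lambda>p p'. 2 * start p * start p' - (if p = p' then 1 else 0)"
  have D: "(\<Sum>p<2 * N * N. ?D p p1 * ?D p p2) = (if p1 = p2 then 1 else 0)" if p: "p1 < 2 * N * N" "p2 < 2 * N * N" for p1 p2
  proof -
    have "(\<Sum>p<2 * N * N. ?D p p1 * ?D p p2) = (\<Sum>p<2 * N * N. 4 * start p1 * start p2 * (start p)\<^sup>2
       - (if p = p2 then 2 * start p * start p1 else 0) - (if p = p1 then 2 * start p * start p2 else 0)
       + (if p = p1 then (if p1 = p2 then 1 else 0) else 0))"
      by (intro sum.cong refl) (auto simp: algebra_simps power2_eq_square)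
    then show ?thesis using p sum_start_sq
      by (simp add: sum.distrib sum_subtractf flip: sum_distrib_left)
  qed
  have "set [diffusion] \<subseteq> carrier_mat (2 * N * w) (2 * N * w)" by (simp add: diffusion_def)
  moreover have "(\<Sum>y<2 * N * w. cnj (diffusion $$ (y, z1)) * diffusion $$ (y, z2)) = (if z1 = z2 then 1 else 0)"
    if z: "z1 < 2 * N * w" "z2 < 2 * N * w" for z1 z2
  proof -
    obtain p1 q1 where z1: "z1 = p1 * M + q1" "p1 < 2 * N * N" "q1 < M" using dim_split[OF z(1)] .
    obtain p2 q2 where z2: "z2 = p2 * M + q2" "p2 < 2 * N * N" "q2 < M" using dim_split[OF z(2)] .
    have dm: "z1 div M = p1" "z2 div M = p2" "z1 mod M = q1" "z2 mod M = q2"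
      using z1 z2 by (simp_all add: div_mult_add)
    have zz: "z1 = z2 \<longleftrightarrow> p1 = p2 \<and> q1 = q2" using z1 z2 dm by metis
    have "(\<Sum>y<2 * N * w. cnj (diffusion $$ (y, z1)) * diffusion $$ (y, z2))
      = (\<Sum>p<2 * N * N. \<Sum>q<M. if q = q1 then (if q1 = q2 then of_real (?D p p1 * ?D p p2) else 0) else 0)"
      unfolding sum_dim using z
      by (intro sum.cong refl) (auto simp: diffusion_def dim_less dm div_mult_add)
    also have "\<dots> = (if q1 = q2 then of_real (\<Sum>p<2 * N * N. ?D p p1 * ?D p p2) else 0)"
      using z1 by (simp del: of_real_mult of_real_diff)
    also have "\<dots> = (if z1 = z2 then 1 else 0)" unfolding D[OF z1(2) z2(2)] using zz by simp
    finally show ?thesis .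
  qed
  ultimately show ?thesis by (subst kraus_family_iff) auto
qed

lemma discard_index:
  assumes "c < 2" "j < N" "i < N" "q < M" "y < 2 * N * w"
  shows "discard (c * N + j) $$ (i * M + q, y) = (if y = (c * N + i) * w + (j * M + q) then 1 else 0)"
proof -
  have "i * M + q < w" using assms by (intro mult_add_less)
  then show ?thesis using assms by (simp add: discard_def div_mult_add)
qed

lemma sum_discard: "(\<Sum>m<2 * N. \<Sum>z<w. h m z) = (\<Sum>c<2. \<Sum>i<N. \<Sum>j<N. \<Sum>q<M. h (c * N + j) (i * M + q))"
  for h :: "nat \<Rightarrow> nat \<Rightarrow> 'a::comm_monoid_add"
  unfolding sum_lessThan_mult by (rule sum.cong[OF refl], rule sum.swap)

lemma kraus_discard: "kraus_family (2 * N * w) (N ^ Suc k) (map discard [0..<2 * N])"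
proof -
  have "set (map discard [0..<2 * N]) \<subseteq> carrier_mat (N ^ Suc k) (2 * N * w)" by (auto simp: discard_def)
  moreover have "(\<Sum>K\<leftarrow>map discard [0..<2 * N]. \<Sum>z<N ^ Suc k. cnj (K $$ (z, y1)) * K $$ (z, y2)) = (if y1 = y2 then 1 else 0)"
    if y: "y1 < 2 * N * w" "y2 < 2 * N * w" for y1 y2
  proof -
    have "(\<Sum>K\<leftarrow>map discard [0..<2 * N]. \<Sum>z<N ^ Suc k. cnj (K $$ (z, y1)) * K $$ (z, y2))
      = (\<Sum>m<2 * N. \<Sum>z<w. cnj (discard m $$ (z, y1)) * discard m $$ (z, y2))"
      by (simp add: interv_sum_list_conv_sum_set_nat atLeast0LessThan)
    also have "\<dots> = (\<Sum>c<2. \<Sum>i<N. \<Sum>j<N. \<Sum>q<M. if (c * N + i) * w + (j * M + q) = y1 then (if y1 = y2 then 1 else 0) else 0)"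
      unfolding sum_discard using y by (intro sum.cong refl) (auto simp: discard_index)
    also have "\<dots> = (\<Sum>y<2 * N * w. if y = y1 then (if y1 = y2 then 1 else 0) else 0)"
      unfolding sum_lessThan_mult[of _ "2 * N" w] sum_lessThan_mult ..
    finally show ?thesis using y by simp
  qed
  ultimately show ?thesis by (subst kraus_family_iff) auto
qed

end

text \<open>Write \<open>sin u\<close> as \<open>2 * sin (u / 2) * cos (u / 2)\<close>. Up to
  \<open>pi / 4\<close> the cosine is at least \<open>sqrt 2 / 2\<close>, which bounds one factor
  directly and the other by the mean value theorem; together they lose a factor 2.\<close>

lemma sin_ge_half:
  fixes u :: real
  assumes "0 \<le> u" "u \<le> pi / 2"
  shows "u / 2 \<le> sin u"
proof (cases "u = 0")
  case False
  then have u: "0 < u" "u / 2 \<le> pi / 4" using assms by auto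
  have c: "sqrt 2 / 2 \<le> cos v" if "0 \<le> v" "v \<le> u / 2" for v
    unfolding cos_45[symmetric] using that u by (intro cos_monotone_0_pi_le) auto
  obtain v where v: "0 < v" "v < u / 2" "sin (u / 2) - sin 0 = (u / 2 - 0) * cos v"
    using MVT2[of 0 "u / 2" sin cos] u(1) by (auto intro: DERIV_sin)
  have "(u / 2) * (sqrt 2 / 2) \<le> (u / 2) * cos v"
    using v c[of v] u(1) by (intro mult_left_mono) auto
  then have "(u / 2) * (sqrt 2 / 2) \<le> sin (u / 2)" using v(3) by simp
  then have "(u / 2) * (sqrt 2 / 2) * (sqrt 2 / 2) \<le> sin (u / 2) * cos (u / 2)"
    using c[of "u / 2"] u(1) by (intro mult_mono') auto
  moreover have "sin u = 2 * (sin (u / 2) * cos (u / 2))" using sin_double[of "u / 2"] by simp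
  moreover have "(u / 2) * (sqrt 2 / 2) * (sqrt 2 / 2) = u / 4" by (simp add: mult.assoc)
  ultimately show ?thesis by linarith
qed simp

section \<open>Rotation in the plane of the start vector and the marked vector\<close>

context grover begin

lemma mv_prep: "y < 2 * N * w \<Longrightarrow> mv prep (\<lambda>I x. tpow N x k I) y x = amp 1 0 y x"
proof -
  assume y: "y < 2 * N * w"
  have "mv prep (\<lambda>I x. tpow N x k I) y x = (\<Sum>q<M. if q = y mod M then complex_of_real (start (y div M)) * tpow N x k q else 0)"
    unfolding mv_def using y by (intro sum.cong) (auto simp: prep_def)
  then show ?thesis using M_pos by (simp add: amp_def Let_def)
qed

lemma amp_index': "p < 2 * N * N \<Longrightarrow> q < M \<Longrightarrow> amp a b (p * M + q) x = (complex_of_real (a * start p) +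
     (if p div N div N = 1 then complex_of_real b * (x (p div N mod N) * cnj (x (p mod N))) else 0)) * tpow N x k q"
  by (simp only: amp_def div_mult_add mod_mult_add Let_def)

lemma start_amp:
  assumes x: "(\<Sum>i<N. x i * cnj (x i)) = 1" and q: "q < M"
  shows "(\<Sum>p<2 * N * N. complex_of_real (start p) * amp a b (p * M + q) x) = complex_of_real (a + b * sigma) * tpow N x k q"
proof -
  define g where "g p = (if p div N div N = 1 then x (p div N mod N) * cnj (x (p mod N)) else 0)" for p
  have g: "g ((c * N + i) * N + j) = (if c = 1 then x i * cnj (x j) else 0)" if "i < N" "j < N" for c i j
    using that by (simp only: g_def div_mult_add mod_mult_add)
  have "(\<Sum>p<2 * N * N. complex_of_real (start p) * g p) = (\<Sum>i<N. \<Sum>j<N. 0) + (\<Sum>i<N. \<Sum>j<N. if i = j then sigma * (x i * cnj (x i)) else 0)"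
    unfolding sum_pairs
    by (intro arg_cong2[where f = "(+)"] sum.cong refl) (simp_all only: g start_index lessThan_iff, auto simp: sigma_def)
  also have "\<dots> = sigma" using x by (simp flip: sum_distrib_left)
  finally have sg: "(\<Sum>p<2 * N * N. complex_of_real (start p) * g p) = sigma" .
  have "(\<Sum>p<2 * N * N. complex_of_real (start p) * amp a b (p * M + q) x)
     = (\<Sum>p<2 * N * N. a * tpow N x k q * complex_of_real ((start p)\<^sup>2) + b * tpow N x k q * (complex_of_real (start p) * g p))"
    using q by (intro sum.cong refl) (simp only: amp_index' lessThan_iff, simp add: g_def algebra_simps power2_eq_square)
  also have "\<dots> = a * tpow N x k q * 1 + b * tpow N x k q * sigma"
    unfolding sum.distrib sum_distrib_left[symmetric] sg of_real_sum[symmetric] sum_start_sq by simp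
  finally show ?thesis by (simp add: algebra_simps)
qed

lemma mv_diffusion:
  assumes x: "(\<Sum>i<N. x i * cnj (x i)) = 1" and y: "y < 2 * N * w"
  shows "mv diffusion (amp a b) y x = amp (a + 2 * b * sigma) (- b) y x"
proof -
  obtain p q where pq: "y = p * M + q" "p < 2 * N * N" "q < M" using dim_split[OF y] .
  have dm: "y div M = p" "y mod M = q" using pq by (simp_all add: div_mult_add)
  have "mv diffusion (amp a b) y x = (\<Sum>z<2 * N * w. diffusion $$ (y, z) * amp a b z x)"
    by (simp add: mv_def diffusion_def)
  also have "\<dots> = (\<Sum>p'<2 * N * N. \<Sum>q'<M. if q' = q then
      complex_of_real (2 * start p * start p' - (if p = p' then 1 else 0)) * amp a b (p' * M + q) x else 0)"
    unfolding sum_dim using y dm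
    by (intro sum.cong refl) (auto simp: diffusion_def dim_less div_mult_add)
  also have "\<dots> = (\<Sum>p'<2 * N * N. 2 * start p * (complex_of_real (start p') * amp a b (p' * M + q) x)
      - (if p' = p then amp a b (p' * M + q) x else 0))"
    using pq by (intro sum.cong refl) (simp add: algebra_simps)
  also have "\<dots> = 2 * start p * (complex_of_real (a + b * sigma) * tpow N x k q) - amp a b y x"
    unfolding sum_subtractf sum_distrib_left[symmetric] start_amp[OF x pq(3)] using pq by simp
  also have "\<dots> = amp (a + 2 * b * sigma) (- b) y x"
    unfolding pq(1) amp_index'[OF pq(2,3)] by (auto simp: algebra_simps)
  finally show ?thesis .
qed

text \<open>Coefficients of \<open>start\<close> and of the marked vector after \<open>t\<close>
  rounds, obtained by applying \<open>reflect_amp\<close> and then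
  \<open>mv_diffusion\<close>.\<close>

primrec coeffs :: "nat \<Rightarrow> real \<times> real" where
  "coeffs 0 = (1, 0)"
| "coeffs (Suc t) = (let (a, b) = coeffs t in (a - 2 * sigma * (2 * sigma * a + b), 2 * sigma * a + b))"

primrec rounds :: "nat \<Rightarrow> complex vec \<Rightarrow> complex mat \<Rightarrow> complex mat" where
  "rounds 0 = (\<lambda>\<psi> \<rho>. kraus_op [prep] (2 * N * w) \<rho>)"
| "rounds (Suc t) = (\<lambda>\<psi> \<rho>. kraus_op [diffusion] (2 * N * w) (apply_oracle N w \<psi> (rounds t \<psi> \<rho>)))"

text \<open>In the rule \<open>query\<close> an operation follows an oracle call, so discarding the
  ancillas comes with one more query. That query merely changes the sign of the overlap with the
  marked vector.\<close>

definition search :: "nat \<Rightarrow> complex vec \<Rightarrow> complex mat \<Rightarrow> complex mat" where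
  "search t = (\<lambda>\<psi> \<rho>. kraus_op (map discard [0..<2 * N]) (N ^ Suc k) (apply_oracle N w \<psi> (rounds t \<psi> \<rho>)))"

lemma oracle_alg_rounds: "oracle_alg N M t (2 * N * w) (rounds t)"
proof (induction t)
  case 0
  show ?case unfolding rounds.simps
    by (rule oracle_alg.no_query[OF quantum_op_kraus[OF kraus_prep]])
next
  case (Suc t)
  show ?case unfolding rounds.simps
    by (rule oracle_alg.query[OF Suc quantum_op_kraus[OF kraus_diffusion]])
qed

lemma cloner_search: "cloner N k (Suc t) (search t)"
  unfolding cloner_def search_def Suc_eq_plus1[of k, symmetric]
  using oracle_alg.query[OF oracle_alg_rounds quantum_op_kraus[OF kraus_discard]] by blast

lemma pure_reflect_amp:
  assumes "pure_family (2 * N * w) \<rho> (amp a b)"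
  shows "pure_family (2 * N * w) (\<lambda>\<psi>. apply_oracle N w \<psi> (\<rho> \<psi>)) (amp a (- (2 * sigma * a + b)))"
  by (rule pure_family_cong[OF pure_family_oracle[OF assms]]) (rule reflect_amp, simp_all add: unit_vec_norm)

lemma pure_rounds:
  "pure_family (2 * N * w) (\<lambda>\<psi>. rounds t \<psi> (tensor_power (ket_bra \<psi>) k)) (amp (fst (coeffs t)) (snd (coeffs t)))"
proof (induction t)
  case 0
  have "prep \<in> carrier_mat (2 * N * w) M" by (simp add: prep_def)
  from pure_family_isometry[OF pure_family_input this]
  show ?case unfolding rounds.simps
    by (rule pure_family_cong) (simp add: mv_prep)
next
  case (Suc t)
  obtain a b where ab: "coeffs t = (a, b)" by (cases "coeffs t")
  have "diffusion \<in> carrier_mat (2 * N * w) (2 * N * w)" by (simp add: diffusion_def)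
  from pure_family_isometry[OF pure_reflect_amp[OF Suc] this]
  show ?case unfolding rounds.simps
    by (rule pure_family_cong) (subst mv_diffusion, simp_all add: unit_vec_norm ab algebra_simps)
qed

text \<open>In the orthonormal basis of the plane whose second vector is the marked one, the state
  with coefficients \<open>a\<close> and \<open>b\<close> has the coordinates
  \<open>cos \<theta> * a\<close> and \<open>sin \<theta> * a + b\<close>. A round is a product of
  two reflections and turns it by \<open>2 * \<theta>\<close>.\<close>

lemma coeffs_angle:
  assumes "sigma = sin \<theta>"
  shows "cos \<theta> * fst (coeffs t) = cos ((2 * real t + 1) * \<theta>) \<and>
    sin \<theta> * fst (coeffs t) + snd (coeffs t) = sin ((2 * real t + 1) * \<theta>)"
proof (induction t)
  case (Suc t)
  obtain a b where ab: "coeffs t = (a, b)" by (cases "coeffs t")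
  define y where "y = sin \<theta> * a + b"
  have IH: "cos \<theta> * a = cos ((2 * real t + 1) * \<theta>)" "y = sin ((2 * real t + 1) * \<theta>)"
    using Suc by (simp_all add: ab y_def)
  have e: "(2 * real (Suc t) + 1) * \<theta> = (2 * real t + 1) * \<theta> + 2 * \<theta>" by (simp add: algebra_simps)
  have b: "b = y - sin \<theta> * a" by (simp add: y_def)
  have c2: "cos (2 * \<theta>) = 1 - 2 * (sin \<theta>)\<^sup>2" by (rule cos_double_sin)
  have cc: "(cos \<theta>)\<^sup>2 = 1 - (sin \<theta>)\<^sup>2" by (rule cos_squared_eq)
  have "cos \<theta> * (a - 2 * sin \<theta> * (2 * sin \<theta> * a + b)) = (cos \<theta> * a) * cos (2 * \<theta>) - y * sin (2 * \<theta>)"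
    unfolding b c2 sin_double by (simp add: algebra_simps power2_eq_square)
  moreover have "sin \<theta> * (a - 2 * sin \<theta> * (2 * sin \<theta> * a + b)) + (2 * sin \<theta> * a + b)
      = y * cos (2 * \<theta>) + (2 * sin \<theta> * (cos \<theta>)\<^sup>2) * a"
    unfolding b c2 cc by (simp add: algebra_simps power2_eq_square)
  moreover have "(2 * sin \<theta> * (cos \<theta>)\<^sup>2) * a = (cos \<theta> * a) * sin (2 * \<theta>)"
    unfolding sin_double by (simp add: power2_eq_square)
  ultimately show ?case
    unfolding e cos_add sin_add IH(1)[symmetric] IH(2)[symmetric] by (simp add: ab assms)
qed simp

lemma search_success:
  assumes "sigma = sin \<theta>"
  shows "(sin ((2 * real t + 1) * \<theta>))\<^sup>2 \<le> avg_success \<mu> k (search t)"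
proof -
  obtain a b where ab: "coeffs t = (a, b)" by (cases "coeffs t")
  define b' where "b' = - (2 * sigma * a + b)"
  have P: "pure_family (2 * N * w) (\<lambda>\<psi>. apply_oracle N w \<psi> (rounds t \<psi> (tensor_power (ket_bra \<psi>) k))) (amp a b')"
    using pure_reflect_amp[OF pure_rounds, of t] by (simp add: ab b'_def)
  \<comment> \<open>The product \<open>h c * cnj (x j)\<close> is the overlap with the target when
    control bit \<open>c\<close> and partner \<open>j\<close> are discarded; summing over
    \<open>j\<close> removes the dependence on \<open>x\<close>.\<close>
  define h where "h c = a * ((if c = 1 then g1 else g0) / sqrt (real N)) + (if c = 1 then b' else 0)" for c :: nat
  have "avg_success \<mu> k (search t) = (\<Sum>c<2. (h c)\<^sup>2)"
  proof (rule avg_success_pure[OF P])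
    show "set (map discard [0..<2 * N]) \<subseteq> carrier_mat (N ^ Suc k) (2 * N * w)" by (auto simp: discard_def)
    show "output_state k (search t) \<psi> = kraus_op (map discard [0..<2 * N]) (N ^ Suc k)
        (apply_oracle N w \<psi> (rounds t \<psi> (tensor_power (ket_bra \<psi>) k)))" for \<psi>
      by (simp only: output_state_def search_def)
    fix \<psi> assume psi: "\<psi> \<in> unit_vecs N"
    let ?x = "vec_index \<psi>"
    have dd: "mv (discard (c * N + j)) (amp a b') (i * M + q) ?x = amp a b' ((c * N + i) * w + (j * M + q)) ?x"
      if "c < 2" "j < N" "i < N" "q < M" for c j i q
    proof -
      have "(c * N + i) * w + (j * M + q) < 2 * N * w"
        using that by (intro mult_add_less)
      moreover have "mv (discard (c * N + j)) (amp a b') (i * M + q) ?x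
        = (\<Sum>y<2 * N * w. if y = (c * N + i) * w + (j * M + q) then amp a b' y ?x else 0)"
      proof -
        have "dim_col (discard (c * N + j)) = 2 * N * w" by (simp add: discard_def)
        then show ?thesis unfolding mv_def using that by (intro sum.cong) (simp_all add: discard_index)
      qed
      ultimately show ?thesis by simp
    qed
    have n1: "(\<Sum>i<N. ?x i * cnj (?x i)) = 1" using unit_vec_norm(2)[OF psi] .
    have t1: "(\<Sum>q<M. tpow N ?x k q * cnj (tpow N ?x k q)) = 1"
      unfolding sum_tpow n1 by simp
    have ov: "(\<Sum>J<N ^ Suc k. cnj (tpow N ?x (Suc k) J) * mv (discard (c * N + j)) (amp a b') J ?x) = h c * cnj (?x j)"
      if "c < 2" "j < N" for c j
    proof -
      have "(\<Sum>J<N ^ Suc k. cnj (tpow N ?x (Suc k) J) * mv (discard (c * N + j)) (amp a b') J ?x)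
        = (\<Sum>i<N. \<Sum>q<M. ((if i = j then complex_of_real (a * ((if c = 1 then g1 else g0) / sqrt (real N))) * cnj (?x j) else 0) +
           (if c = 1 then complex_of_real b' else 0) * cnj (?x j) * (?x i * cnj (?x i))) * (tpow N ?x k q * cnj (tpow N ?x k q)))"
        unfolding power_Suc sum_lessThan_mult
      proof (intro sum.cong refl)
        fix i q assume iq: "i \<in> {..<N}" "q \<in> {..<M}"
        show "cnj (tpow N ?x (Suc k) (i * M + q)) * mv (discard (c * N + j)) (amp a b') (i * M + q) ?x =
          ((if i = j then complex_of_real (a * ((if c = 1 then g1 else g0) / sqrt (real N))) * cnj (?x j) else 0) +
           (if c = 1 then complex_of_real b' else 0) * cnj (?x j) * (?x i * cnj (?x i))) * (tpow N ?x k q * cnj (tpow N ?x k q))"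
          using iq that by (simp add: dd amp_index tpow_Suc_index del: tpow.simps) (auto simp: algebra_simps)
      qed
      also have "\<dots> = (\<Sum>i<N. (if i = j then complex_of_real (a * ((if c = 1 then g1 else g0) / sqrt (real N))) * cnj (?x j) else 0) +
           (if c = 1 then complex_of_real b' else 0) * cnj (?x j) * (?x i * cnj (?x i)))"
        by (simp only: sum_distrib_left[symmetric] t1 mult_1_right)
      also have "\<dots> = h c * cnj (?x j)"
        unfolding sum.distrib sum_distrib_left[symmetric] n1 using that by (auto simp: h_def algebra_simps)
      finally show ?thesis .
    qed
    have "(\<Sum>K\<leftarrow>map discard [0..<2 * N]. (cmod (\<Sum>J<N ^ Suc k. cnj (tpow N ?x (Suc k) J) * mv K (amp a b') J ?x))\<^sup>2)
      = (\<Sum>m<2 * N. (cmod (\<Sum>J<N ^ Suc k. cnj (tpow N ?x (Suc k) J) * mv (discard m) (amp a b') J ?x))\<^sup>2)"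
      by (simp add: interv_sum_list_conv_sum_set_nat atLeast0LessThan)
    also have "\<dots> = (\<Sum>c<2. \<Sum>j<N. (h c)\<^sup>2 * (cmod (?x j))\<^sup>2)"
      unfolding sum_lessThan_mult by (intro sum.cong refl) (simp only: ov lessThan_iff norm_mult complex_mod_cnj power_mult_distrib norm_of_real power2_abs)
    also have "\<dots> = (\<Sum>c<2. (h c)\<^sup>2)"
      using unit_vec_norm(1)[OF psi] by (simp only: sum_distrib_left[symmetric] mult_1_right)
    finally show "(\<Sum>K\<leftarrow>map discard [0..<2 * N]. (cmod (\<Sum>J<N ^ Suc k. cnj (tpow N ?x (Suc k) J) * mv K (amp a b') J ?x))\<^sup>2)
      = (\<Sum>c<2. (h c)\<^sup>2)" .
  qed
  \<comment> \<open>Successes with control bit 0 are dropped; hence an inequality.\<close>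
  also have "\<dots> \<ge> (h 1)\<^sup>2" by (simp add: numeral_2_eq_2)
  also have "h 1 = - (sin \<theta> * a + b)" by (simp add: h_def b'_def sigma_def assms[unfolded sigma_def, symmetric])
  also have "\<dots> = - sin ((2 * real t + 1) * \<theta>)" using coeffs_angle[OF assms, of t] by (simp add: ab)
  finally show ?thesis by simp
qed

end

section \<open>Choice of the rotation angle\<close>

context haar_states begin

text \<open>The weight \<open>g1 = sqrt N * sin \<theta>\<close> realises every angle up to the one
  with sine \<open>1 / sqrt N\<close>, which is the case of control bit 1 throughout.\<close>

lemma grover_search_angle:
  assumes "0 \<le> sin \<theta>" "sin \<theta> \<le> 1 / sqrt (real N)"
  shows "\<exists>A. cloner N k (Suc t) A \<and> (sin ((2 * real t + 1) * \<theta>))\<^sup>2 \<le> avg_success \<mu> k A"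
proof -
  define g1 where "g1 = sqrt (real N) * sin \<theta>"
  have "0 \<le> g1" "g1 \<le> 1" using assms N_pos by (auto simp: g1_def field_simps)
  then have "g1\<^sup>2 \<le> 1" by (simp add: power_le_one)
  then interpret grover N \<mu> k "sqrt (1 - g1\<^sup>2)" g1 by unfold_locales simp
  have "sigma = sin \<theta>" unfolding sigma_def using N_pos by (simp add: g1_def)
  then show ?thesis using cloner_search search_success by blast
qed

text \<open>With \<open>n = 2 * t + 1\<close> the angle \<open>pi / (2 * n)\<close> ends exactly on
  the target. If its sine exceeds \<open>1 / sqrt N\<close>, the largest available angle
  \<open>\<phi>\<close> is taken instead; then \<open>n * \<phi>\<close> does not pass
  \<open>pi / 2\<close>, and \<open>sin_ge_half\<close> gives the amplitude
  \<open>T / (2 * sqrt N)\<close>.\<close>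

lemma grover_search:
  assumes "T \<ge> 1"
  shows "\<exists>A. cloner N k T A \<and> min 1 (real T ^ 2 / (4 * real N)) \<le> avg_success \<mu> k A"
proof -
  obtain t where T: "T = Suc t" using assms by (cases T) auto
  define n where "n = 2 * real t + 1"
  have n: "n \<ge> 1" "n \<ge> real T" by (auto simp: n_def T)
  define \<theta> where "\<theta> = pi / (2 * n)"
  have th: "0 < \<theta>" "\<theta> \<le> pi / 2" using n by (auto simp: \<theta>_def field_simps)
  have sq: "0 < 1 / sqrt (real N)" "1 / sqrt (real N) \<le> 1" using N_pos by auto
  show ?thesis
  proof (cases "sin \<theta> \<le> 1 / sqrt (real N)")
    case True
    moreover have "0 \<le> sin \<theta>" using th by (intro sin_ge_zero) auto
    ultimately obtain A where A: "cloner N k (Suc t) A" "(sin (n * \<theta>))\<^sup>2 \<le> avg_success \<mu> k A"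
      using grover_search_angle unfolding n_def by blast
    moreover have "n * \<theta> = pi / 2" using n by (simp add: \<theta>_def)
    ultimately show ?thesis unfolding T by (intro exI[of _ A]) auto
  next
    case False
    define \<phi> where "\<phi> = arcsin (1 / sqrt (real N))"
    have sq': "- 1 \<le> 1 / sqrt (real N)" using sq by linarith
    have sphi: "sin \<phi> = 1 / sqrt (real N)" unfolding \<phi>_def by (rule sin_arcsin[OF sq' sq(2)])
    have p1: "\<phi> \<le> pi / 2" unfolding \<phi>_def by (rule arcsin_ubound[OF sq' sq(2)])
    have p0: "0 \<le> \<phi>"
      using arcsin_le_arcsin[of 0 "1 / sqrt (real N)"] sq unfolding \<phi>_def arcsin_0 by linarith
    have "\<phi> \<le> \<theta>"
    proof (rule ccontr)
      assume "\<not> \<phi> \<le> \<theta>"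
      then have "sin \<theta> \<le> sin \<phi>" using th p1 by (intro sin_monotone_2pi_le) auto
      then show False using False sphi by simp
    qed
    then have u: "n * \<phi> \<le> pi / 2" using n mult_left_mono[of \<phi> \<theta> n] by (simp add: \<theta>_def)
    obtain A where A: "cloner N k (Suc t) A" "(sin (n * \<phi>))\<^sup>2 \<le> avg_success \<mu> k A"
      using grover_search_angle[of \<phi>] sphi sq unfolding n_def by force
    have "real T / sqrt (real N) \<le> n * \<phi>"
      using mult_mono[of "real T" n "1 / sqrt (real N)" \<phi>] n sin_x_le_x[OF p0] sphi sq by auto
    then have "real T / sqrt (real N) / 2 \<le> sin (n * \<phi>)"
      using sin_ge_half[of "n * \<phi>"] u n p0 by auto
    then have "(real T / sqrt (real N) / 2)\<^sup>2 \<le> (sin (n * \<phi>))\<^sup>2"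
      by (intro power_mono) auto
    then have "real T ^ 2 / (4 * real N) \<le> avg_success \<mu> k A"
      using A(2) N_pos by (simp add: power_divide)
    with A(1) show ?thesis unfolding T by (intro exI[of _ A]) auto
  qed
qed

end

section \<open>Optimal cloning without queries\<close>

abbreviation words :: "nat \<Rightarrow> nat \<Rightarrow> (nat \<Rightarrow> nat) set" where
  "words N m \<equiv> (\<Pi>\<^sub>E i\<in>{..<m}. {..<N})"

text \<open>The least significant digit comes first, while \<open>tpow\<close> splits off the most
  significant one. A product of coordinates does not depend on the order of its factors, and
  \<open>tpow_low_digit\<close> carries out the change of convention.\<close>

definition digits :: "nat \<Rightarrow> nat \<Rightarrow> nat \<Rightarrow> nat \<Rightarrow> nat" where
  "digits N m I = (\<lambda>i\<in>{..<m}. I div N ^ i mod N)"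

lemma div_less_power: "I < N ^ Suc m \<Longrightarrow> I div N < N ^ m" for I N :: nat
  by (rule less_mult_imp_div_less) (simp only: power_Suc2)

lemma digits_inj:
  "I < N ^ m \<Longrightarrow> J < N ^ m \<Longrightarrow> (\<forall>i<m. I div N ^ i mod N = J div N ^ i mod N) \<Longrightarrow> I = J"
  for I J N :: nat
proof (induction m arbitrary: I J)
  case (Suc m)
  have "I div N = J div N"
  proof (rule Suc.IH)
    show "I div N < N ^ m" "J div N < N ^ m" by (rule div_less_power[OF Suc.prems(1)], rule div_less_power[OF Suc.prems(2)])
    show "\<forall>i<m. I div N div N ^ i mod N = J div N div N ^ i mod N"
    proof (intro allI impI)
      fix i assume "i < m"
      then have "I div N ^ Suc i mod N = J div N ^ Suc i mod N" using Suc.prems(3) by blast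
      then show "I div N div N ^ i mod N = J div N div N ^ i mod N"
        by (simp add: div_mult2_eq)
    qed
  qed
  moreover have "I mod N = J mod N" using Suc.prems(3)[rule_format, of 0] by simp
  ultimately show ?case by (metis div_mult_mod_eq)
qed simp

lemma digits_in_words: "N > 0 \<Longrightarrow> digits N m I \<in> words N m"
  unfolding digits_def by (rule restrict_PiE_iff[THEN iffD2]) auto

lemma digits_bij:
  assumes "N > 0" shows "bij_betw (digits N m) {..<N ^ m} (words N m)"
proof -
  have inj: "inj_on (digits N m) {..<N ^ m}"
  proof (rule inj_onI)
    fix I J assume IJ: "I \<in> {..<N ^ m}" "J \<in> {..<N ^ m}" "digits N m I = digits N m J"
    have "I div N ^ i mod N = J div N ^ i mod N" if "i < m" for i
      using fun_cong[OF IJ(3), of i] that by (simp add: digits_def)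
    then show "I = J" using IJ digits_inj[of I N m J] by simp
  qed
  have sub: "digits N m ` {..<N ^ m} \<subseteq> words N m" using digits_in_words[OF assms] by blast
  have "digits N m ` {..<N ^ m} = words N m"
    using sub by (rule card_subset_eq[rotated]) (simp_all add: finite_PiE card_image[OF inj] card_PiE)
  with inj show ?thesis by (simp add: bij_betw_def)
qed

lemma sum_digits: "N > 0 \<Longrightarrow> (\<Sum>I<N ^ m. h (digits N m I)) = (\<Sum>e\<in>words N m. h e)"
  by (rule sum.reindex_bij_betw[OF digits_bij])

lemma digits_eq_iff: "N > 0 \<Longrightarrow> I < N ^ m \<Longrightarrow> J < N ^ m \<Longrightarrow> digits N m I = digits N m J \<longleftrightarrow> I = J"
  using digits_bij[of N m] by (auto simp: bij_betw_def inj_on_def)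

lemma tpow_low_digit: "tpow N x (Suc k) I = x (I mod N) * tpow N x k (I div N)" if "I < N ^ Suc k" "N > 0"
  using that(1)
proof (induction k arbitrary: I)
  case (Suc k)
  let ?J = "I mod N ^ Suc k"
  have "?J < N ^ Suc k" using that(2) by simp
  from Suc.IH[OF this] have "tpow N x (Suc (Suc k)) I = x (I div N ^ Suc k) * (x (?J mod N) * tpow N x k (?J div N))"
    by (simp only: tpow.simps(2)[of N x "Suc k" I])
  also have "?J mod N = I mod N" by (simp add: mod_mult2_eq)
  also have "?J div N = I div N mod N ^ k" using that(2) by (simp add: mod_mult2_eq)
  also have "I div N ^ Suc k = I div N div N ^ k" by (simp add: div_mult2_eq)
  finally show ?case by simp
qed simp

lemma tpow_digits: "N > 0 \<Longrightarrow> I < N ^ k \<Longrightarrow> tpow N x k I = (\<Prod>i<k. x (digits N k I i))"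
proof (induction k arbitrary: I)
  case (Suc k)
  have "I div N < N ^ k" using Suc.prems(2) by (rule div_less_power)
  then have "tpow N x k (I div N) = (\<Prod>i<k. x (digits N k (I div N) i))" using Suc by simp
  also have "\<dots> = (\<Prod>i<k. x (digits N (Suc k) I (Suc i)))"
    by (intro prod.cong refl) (simp add: digits_def div_mult2_eq)
  finally show ?case
    unfolding tpow_low_digit[OF Suc.prems(2,1)] prod.lessThan_Suc_shift by (simp add: digits_def)
qed simp

text \<open>The gap is filled with the last letter instead of moving the later letters up, and
  \<open>insert_at\<close> undoes this. Inserting at one position and deleting at another then leads
  to a transposition, never to a longer cycle.\<close>

definition remove :: "nat \<Rightarrow> nat \<Rightarrow> (nat \<Rightarrow> nat) \<Rightarrow> nat \<Rightarrow> nat" where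
  "remove k p D = (\<lambda>m\<in>{..<k}. if m = p then D k else D m)"

definition insert_at :: "nat \<Rightarrow> nat \<Rightarrow> (nat \<Rightarrow> nat) \<Rightarrow> nat \<Rightarrow> nat \<Rightarrow> nat" where
  "insert_at k p e a = (\<lambda>m\<in>{..<Suc k}. if m = p then a else if m = k then e p else e m)"

definition swap_at :: "nat \<Rightarrow> nat \<Rightarrow> nat \<Rightarrow> (nat \<Rightarrow> nat) \<Rightarrow> nat \<Rightarrow> nat" where
  "swap_at k p q e = (\<lambda>m\<in>{..<k}. if m = p then e q else if m = q then e p else e m)"

lemma insert_at_in_words: "e \<in> words N k \<Longrightarrow> p \<le> k \<Longrightarrow> a < N \<Longrightarrow> insert_at k p e a \<in> words N (Suc k)"
  by (auto simp: insert_at_def PiE_def Pi_def)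

lemma remove_in_words: "D \<in> words N (Suc k) \<Longrightarrow> remove k p D \<in> words N k"
  by (auto simp: remove_def PiE_def Pi_def)

lemma swap_at_in_words: "e \<in> words N k \<Longrightarrow> p < k \<Longrightarrow> q < k \<Longrightarrow> swap_at k p q e \<in> words N k"
  by (auto simp: swap_at_def PiE_def Pi_def)

lemma words_eqI: "e \<in> words N k \<Longrightarrow> e' \<in> words N k \<Longrightarrow> (\<And>m. m < k \<Longrightarrow> e m = e' m) \<Longrightarrow> e = e'"
  by (rule PiE_ext) auto

lemma remove_insert_at: "e \<in> words N k \<Longrightarrow> p \<le> k \<Longrightarrow> a < N \<Longrightarrow> remove k p (insert_at k p e a) = e"
  by (rule words_eqI[OF remove_in_words[OF insert_at_in_words]]) (auto simp: remove_def insert_at_def)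

lemma insert_at_remove: "D \<in> words N (Suc k) \<Longrightarrow> p \<le> k \<Longrightarrow> insert_at k p (remove k p D) (D p) = D"
  by (rule words_eqI[OF insert_at_in_words[OF remove_in_words]]) (auto simp: remove_def insert_at_def PiE_def Pi_def)

lemma insert_at_same: "p \<le> k \<Longrightarrow> insert_at k p e a p = a"
  by (simp add: insert_at_def)

lemma sum_remove_eq:
  assumes e: "e \<in> words N k" and p: "p \<le> k"
  shows "(\<Sum>D\<in>words N (Suc k). if remove k p D = e then h D else 0) = (\<Sum>a<N. h (insert_at k p e a))"
proof -
  have set: "{D \<in> words N (Suc k). remove k p D = e} = insert_at k p e ` {..<N}"
  proof (intro equalityI subsetI)
    fix D assume "D \<in> {D \<in> words N (Suc k). remove k p D = e}"
    then have D: "D \<in> words N (Suc k)" "remove k p D = e" by auto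
    have "D = insert_at k p e (D p)" using insert_at_remove[OF D(1) p] D(2) by simp
    moreover have "D p < N" using D(1) p by (auto simp: PiE_def Pi_def)
    ultimately show "D \<in> insert_at k p e ` {..<N}" by blast
  qed (use insert_at_in_words[OF e p] remove_insert_at[OF e p] in auto)
  have inj: "inj_on (insert_at k p e) {..<N}"
    by (rule inj_onI) (metis insert_at_same[OF p])
  have "(\<Sum>D\<in>words N (Suc k). if remove k p D = e then h D else 0) = (\<Sum>D\<in>{D \<in> words N (Suc k). remove k p D = e}. h D)"
    by (rule sum.inter_filter[symmetric]) (simp add: finite_PiE)
  then show ?thesis unfolding set by (simp add: sum.reindex[OF inj])
qed

lemma swap_at_swap_at: "e \<in> words N k \<Longrightarrow> p < k \<Longrightarrow> q < k \<Longrightarrow> swap_at k p q (swap_at k p q e) = e"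
  by (rule words_eqI[OF swap_at_in_words[OF swap_at_in_words]]) (auto simp: swap_at_def)

lemma swap_at_same: "e \<in> words N k \<Longrightarrow> p < k \<Longrightarrow> swap_at k p p e = e"
  by (rule words_eqI[OF swap_at_in_words]) (auto simp: swap_at_def)

text \<open>When insertions of a common letter at \<open>p\<close> and at \<open>q\<close> are
  compared, that letter must be the one found at \<open>q\<close>. Deleting it there returns the
  original word up to one transposition, which disappears if \<open>p\<close> or \<open>q\<close> is
  the last position.\<close>

lemma remove_insert_at_diff:
  assumes e: "e \<in> words N k" and p: "p \<le> k" and q: "q \<le> k" and pq: "p \<noteq> q"
  defines "a \<equiv> (if q = k then e p else e q)"
  shows "a < N" "insert_at k p e b q = a"
    "remove k q (insert_at k p e a) = (if p < k \<and> q < k then swap_at k p q e else e)"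
proof -
  have lt: "\<And>m. m < k \<Longrightarrow> e m < N" using e by (auto simp: PiE_def Pi_def)
  show a: "a < N" using lt p q pq by (auto simp: a_def)
  show "insert_at k p e b q = a" using p q pq by (auto simp: a_def insert_at_def)
  show "remove k q (insert_at k p e a) = (if p < k \<and> q < k then swap_at k p q e else e)"
  proof (rule words_eqI[OF remove_in_words[OF insert_at_in_words[OF e p a]]])
    show "(if p < k \<and> q < k then swap_at k p q e else e) \<in> words N k" using e swap_at_in_words[OF e] by auto
    fix m assume "m < k"
    then show "remove k q (insert_at k p e a) m = (if p < k \<and> q < k then swap_at k p q e else e) m"
      using p q pq by (auto simp: a_def remove_def insert_at_def swap_at_def)
  qed
qed

lemma prod_insert_at:
  fixes x :: "nat \<Rightarrow> complex"
  assumes "p \<le> k"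
  shows "(\<Prod>m<Suc k. x (insert_at k p e a m)) = x a * (\<Prod>m<k. x (e m))"
proof (cases "p = k")
  case True
  then show ?thesis by (simp add: insert_at_def mult.commute)
next
  case False
  then have p: "p < k" using assms by simp
  have "(\<Prod>m<k. x (insert_at k p e a m)) = x a * (\<Prod>m\<in>{..<k} - {p}. x (e m))"
    using p by (subst prod.remove[of _ p]) (auto simp: insert_at_def intro!: prod.cong)
  moreover have "(\<Prod>m<k. x (e m)) = x (e p) * (\<Prod>m\<in>{..<k} - {p}. x (e m))"
    using p by (subst prod.remove[of _ p]) auto
  moreover have "insert_at k p e a k = e p" using p by (simp add: insert_at_def)
  ultimately show ?thesis by (simp add: mult_ac)
qed

lemma prod_swap_at:
  fixes x :: "nat \<Rightarrow> complex"
  assumes pq: "p < k" "q < k"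
  shows "(\<Prod>m<k. x (swap_at k p q e m)) = (\<Prod>m<k. x (e m))"
proof -
  define s where "s m = (if m = p then q else if m = q then p else m)" for m
  have "bij_betw s {..<k} {..<k}"
    by (rule bij_betw_byWitness[where f' = s]) (use pq in \<open>auto simp: s_def\<close>)
  then have "(\<Prod>m<k. x (e (s m))) = (\<Prod>m<k. x (e m))" by (rule prod.reindex_bij_betw)
  moreover have "(\<Prod>m<k. x (swap_at k p q e m)) = (\<Prod>m<k. x (e (s m)))"
    by (intro prod.cong refl) (simp add: swap_at_def s_def)
  ultimately show ?thesis by simp
qed

lemma sum_words_Suc:
  assumes p: "p \<le> k"
  shows "(\<Sum>D\<in>words N (Suc k). h D) = (\<Sum>e\<in>words N k. \<Sum>a<N. h (insert_at k p e a))"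
proof -
  have "(\<Sum>e\<in>words N k. \<Sum>a<N. h (insert_at k p e a)) = (\<Sum>e\<in>words N k. \<Sum>D\<in>words N (Suc k). if remove k p D = e then h D else 0)"
    by (intro sum.cong refl sum_remove_eq[symmetric] p)
  also have "\<dots> = (\<Sum>D\<in>words N (Suc k). \<Sum>e\<in>words N k. if remove k p D = e then h D else 0)"
    by (rule sum.swap)
  also have "\<dots> = (\<Sum>D\<in>words N (Suc k). h D)"
    by (intro sum.cong refl) (simp add: remove_in_words finite_PiE)
  finally show ?thesis ..
qed

section \<open>Kraus operators of the optimal cloner\<close>

locale optimal_cloner = haar_states +
  fixes k :: nat
begin

definition alpha :: real where "alpha = 1 / sqrt (real (Suc k) * real (N + k))"

lemma alpha_sq: "alpha * alpha * (real (Suc k) * real (N + k)) = 1"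
proof -
  define m where "m = real (Suc k) * real (N + k)"
  have "m > 0" using N_pos by (simp add: m_def)
  then show ?thesis unfolding alpha_def m_def[symmetric] by simp
qed

text \<open>Up to the factor \<open>alpha\<close>, \<open>sym_kraus j\<close> inserts the basis state \<open>j\<close> in all \<open>k + 1\<close> positions in
  superposition (a creation operator). The operators \<open>asym_kraus p q\<close>, which vanish on symmetric
  states, complete the family: \<open>\<Sum>\<^sub>j sym_kraus j\<^sup>* sym_kraus j\<close> is a combination of the identity and the
  swaps \<open>S\<^sub>p\<^sub>q\<close>, and \<open>I - S = (I - S)\<^sup>2 / 2\<close>.\<close>

definition sym_kraus :: "nat \<Rightarrow> complex mat" where
  "sym_kraus j = Matrix.mat (N ^ Suc k) (N ^ k) (\<lambda>(D, I). complex_of_real alpha *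
     (\<Sum>p<Suc k. if remove k p (digits N (Suc k) D) = digits N k I \<and> digits N (Suc k) D p = j then 1 else 0))"

definition asym_kraus :: "nat \<Rightarrow> nat \<Rightarrow> complex mat" where
  "asym_kraus p q = Matrix.mat (N ^ Suc k) (N ^ k) (\<lambda>(D, I). complex_of_real (alpha / sqrt 2) *
     (if digits N (Suc k) D k = 0 then (if remove k k (digits N (Suc k) D) = digits N k I then 1 else 0)
        - (if remove k k (digits N (Suc k) D) = swap_at k p q (digits N k I) then 1 else 0) else 0))"

definition cloner_kraus :: "complex mat list" where
  "cloner_kraus = map sym_kraus [0..<N] @ map (\<lambda>n. asym_kraus (n div k) (n mod k)) [0..<k * k]"

lemma sum_cloner_kraus: "(\<Sum>K\<leftarrow>cloner_kraus. h K) = (\<Sum>j<N. h (sym_kraus j)) + (\<Sum>p<k. \<Sum>q<k. h (asym_kraus p q))"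
  for h :: "complex mat \<Rightarrow> 'a::comm_monoid_add"
proof -
  have "(\<Sum>K\<leftarrow>cloner_kraus. h K) = (\<Sum>j<N. h (sym_kraus j)) + (\<Sum>n<k * k. h (asym_kraus (n div k) (n mod k)))"
    by (simp add: cloner_kraus_def comp_def interv_sum_list_conv_sum_set_nat atLeast0LessThan)
  also have "(\<Sum>n<k * k. h (asym_kraus (n div k) (n mod k))) = (\<Sum>p<k. \<Sum>q<k. h (asym_kraus p q))"
    unfolding sum_lessThan_mult by (intro sum.cong refl) (simp only: div_mult_add mod_mult_add lessThan_iff)
  finally show ?thesis .
qed

text \<open>For \<open>p = q\<close> the inserted letter is free, which gives \<open>N\<close>
  words; for \<open>p \<noteq> q\<close> it is forced, and \<open>remove_insert_at_diff\<close>
  decides whether the single candidate fits.\<close>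

lemma overlap_count:
  assumes e: "e \<in> words N k" and p: "p \<le> k" "q \<le> k"
  shows "(\<Sum>D\<in>words N (Suc k). if remove k p D = e then (if remove k q D = e' \<and> D p = D q then 1 else 0) else 0) =
    (if p = q then (if e = e' then of_nat N else 0)
     else if p < k \<and> q < k then (if swap_at k p q e = e' then 1 else 0) else (if e = e' then 1 else (0 :: complex)))"
proof -
  have 1: "(\<Sum>D\<in>words N (Suc k). if remove k p D = e then (if remove k q D = e' \<and> D p = D q then 1 else 0) else 0)
    = (\<Sum>a<N. if remove k q (insert_at k p e a) = e' \<and> a = insert_at k p e a q then 1 else (0 :: complex))"
    unfolding sum_remove_eq[OF e p(1)] insert_at_same[OF p(1)] ..
  show ?thesis
  proof (cases "p = q")
    case True
    have "(\<Sum>a<N. if remove k q (insert_at k p e a) = e' \<and> a = insert_at k p e a q then 1 else (0 :: complex)) = (\<Sum>a<N. if e = e' then 1 else 0)"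
      using True p by (intro sum.cong refl) (simp add: remove_insert_at[OF e p(2)] insert_at_same)
    then show ?thesis unfolding 1 using True by simp
  next
    case False
    define b where "b = (if q = k then e p else e q)"
    note d = remove_insert_at_diff[OF e p False, folded b_def]
    have "(\<Sum>a<N. if remove k q (insert_at k p e a) = e' \<and> a = insert_at k p e a q then 1 else (0 :: complex))
      = (\<Sum>a<N. if a = b then (if remove k q (insert_at k p e b) = e' then 1 else 0) else 0)"
      by (intro sum.cong refl) (auto simp: d(2))
    also have "\<dots> = (if remove k q (insert_at k p e b) = e' then 1 else 0)" using d(1) by simp
    finally show ?thesis unfolding 1 d(3) using False by simp
  qed
qed

lemma sym_gram:
  assumes I: "I < N ^ k" "I' < N ^ k"
  defines "e \<equiv> digits N k I" and "e' \<equiv> digits N k I'"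
  shows "(\<Sum>j<N. \<Sum>D<N ^ Suc k. cnj (sym_kraus j $$ (D, I)) * sym_kraus j $$ (D, I')) =
    complex_of_real (alpha * alpha) * ((\<Sum>p<k. \<Sum>q<k. if swap_at k p q e = e' then 1 else 0) +
      (if e = e' then of_nat k * (of_nat N - 1) + 2 * of_nat k + of_nat N else 0))"
proof -
  have ew: "e \<in> words N k" unfolding e_def by (rule digits_in_words[OF N_pos])
  define R where "R p D f j \<longleftrightarrow> remove k p D = f \<and> D p = j" for p j :: nat and D f :: "nat \<Rightarrow> nat"
  have "(\<Sum>j<N. \<Sum>D<N ^ Suc k. cnj (sym_kraus j $$ (D, I)) * sym_kraus j $$ (D, I'))
    = (\<Sum>j<N. \<Sum>D\<in>words N (Suc k). of_real (alpha * alpha) *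
        ((\<Sum>p<Suc k. if R p D e j then 1 else 0) * (\<Sum>q<Suc k. if R q D e' j then 1 else 0)))"
    unfolding sum_digits[OF N_pos, symmetric]
    using I by (intro sum.cong refl) (simp add: sym_kraus_def R_def e_def e'_def if_distrib[of cnj] del: sum.lessThan_Suc cong: if_cong)
  also have "\<dots> = of_real (alpha * alpha) * (\<Sum>j<N. \<Sum>D\<in>words N (Suc k). \<Sum>p<Suc k. \<Sum>q<Suc k.
        if R p D e j \<and> R q D e' j then 1 else 0)"
    unfolding sum_distrib_left[symmetric] sum_product
    by (intro arg_cong2[where f = "(*)"] sum.cong refl) simp
  also have "(\<Sum>j<N. \<Sum>D\<in>words N (Suc k). \<Sum>p<Suc k. \<Sum>q<Suc k. if R p D e j \<and> R q D e' j then 1 else (0 :: complex))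
    = (\<Sum>p<Suc k. \<Sum>q<Suc k. \<Sum>D\<in>words N (Suc k). \<Sum>j<N. if R p D e j \<and> R q D e' j then 1 else 0)"
    by (subst sum.swap, subst sum.swap[of _ "{..<N}"], subst sum.swap[of _ "{..<N}" "{..<Suc k}"],
        subst sum.swap[of _ "words N (Suc k)"], subst sum.swap[of _ "words N (Suc k)" "{..<Suc k}"]) (rule refl)
  also have "\<dots> = (\<Sum>p<Suc k. \<Sum>q<Suc k. \<Sum>D\<in>words N (Suc k).
      if remove k p D = e then (if remove k q D = e' \<and> D p = D q then 1 else 0) else 0)"
  proof (intro sum.cong refl)
    fix p q D assume "p \<in> {..<Suc k}" "q \<in> {..<Suc k}" "D \<in> words N (Suc k)"
    then have "D p < N" by (auto simp: PiE_def Pi_def)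
    have "(\<Sum>j<N. if R p D e j \<and> R q D e' j then 1 else (0::complex))
      = (\<Sum>j<N. if D p = j then (if remove k p D = e then (if remove k q D = e' \<and> D p = D q then 1 else 0) else 0) else 0)"
      by (intro sum.cong refl) (auto simp: R_def)
    then show "(\<Sum>j<N. if R p D e j \<and> R q D e' j then 1 else (0::complex))
      = (if remove k p D = e then (if remove k q D = e' \<and> D p = D q then 1 else 0) else 0)"
      using \<open>D p < N\<close> by simp
  qed
  also have "\<dots> = (\<Sum>p<Suc k. \<Sum>q<Suc k. (if p = q then (if e = e' then of_nat N else 0)
     else if p < k \<and> q < k then (if swap_at k p q e = e' then 1 else 0) else (if e = e' then 1 else 0)))"
    by (intro sum.cong refl overlap_count[OF ew]) auto
  \<comment> \<open>For \<open>p = q\<close> the swap is the identity and accounts for 1 of the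
    \<open>N\<close>; the pairs with \<open>p = k\<close> or \<open>q = k\<close> supply
    \<open>2 * k + N\<close> if \<open>e = e'\<close>.\<close>
  also have "\<dots> = (\<Sum>p<k. \<Sum>q<k. (if swap_at k p q e = e' then 1 else 0) + (if p = q then (if e = e' then of_nat N - 1 else 0) else 0))
     + (if e = e' then 2 * of_nat k + of_nat N else 0)"
  proof -
    define f where "f p q = (if p = q then (if e = e' then of_nat N else 0)
     else if p < k \<and> q < k then (if swap_at k p q e = e' then 1 else 0) else (if e = e' then 1 else (0::complex)))" for p q
    have "(\<Sum>p<k. \<Sum>q<k. f p q) = (\<Sum>p<k. \<Sum>q<k. (if swap_at k p q e = e' then 1 else 0)
        + (if p = q then (if e = e' then of_nat N - 1 else 0) else 0))"
      using swap_at_same[OF ew] by (intro sum.cong refl) (auto simp: f_def)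
    moreover have "(\<Sum>p<k. f p k) = (\<Sum>p<k. if e = e' then 1 else 0)" "(\<Sum>q<k. f k q) = (\<Sum>q<k. if e = e' then 1 else 0)"
      by (intro sum.cong refl; auto simp: f_def)+
    moreover have "f k k = (if e = e' then of_nat N else 0)" by (simp add: f_def)
    moreover have "(\<Sum>p<Suc k. \<Sum>q<Suc k. f p q) = (\<Sum>p<k. \<Sum>q<k. f p q) + (\<Sum>p<k. f p k) + (\<Sum>q<k. f k q) + f k k"
      by (simp add: sum.distrib algebra_simps)
    ultimately show ?thesis unfolding f_def[symmetric] by simp
  qed
  also have "\<dots> = (\<Sum>p<k. \<Sum>q<k. if swap_at k p q e = e' then 1 else 0) +
      (if e = e' then of_nat k * (of_nat N - 1) + 2 * of_nat k + of_nat N else 0)"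
    by (simp add: sum.distrib)
  finally show ?thesis .
qed

text \<open>Apart from the factor \<open>alpha / sqrt 2\<close>, the operator is
  \<open>I - S\<close> followed by appending the fixed letter 0, which does not affect inner
  products. As \<open>(I - S)^2 = 2 * (I - S)\<close>, the factor \<open>1 / 2\<close>
  cancels.\<close>

lemma asym_gram:
  assumes I: "I < N ^ k" "I' < N ^ k" and pq: "p < k" "q < k"
  defines "e \<equiv> digits N k I" and "e' \<equiv> digits N k I'"
  shows "(\<Sum>D<N ^ Suc k. cnj (asym_kraus p q $$ (D, I)) * asym_kraus p q $$ (D, I')) =
    complex_of_real (alpha * alpha) * ((if e = e' then 1 else 0) - (if swap_at k p q e = e' then 1 else 0))"
proof -
  have ew: "e \<in> words N k" "e' \<in> words N k" unfolding e_def e'_def by (rule digits_in_words[OF N_pos])+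
  define s where "s = swap_at k p q"
  have sw: "s f \<in> words N k" if "f \<in> words N k" for f unfolding s_def using that pq by (rule swap_at_in_words)
  have ss: "s (s f) = f" if "f \<in> words N k" for f unfolding s_def using that pq by (rule swap_at_swap_at)
  define g where "g f f0 = (if f0 = f then 1 else 0) - (if f0 = s f then 1 else (0 :: complex))" for f f0
  have "(\<Sum>D<N ^ Suc k. cnj (asym_kraus p q $$ (D, I)) * asym_kraus p q $$ (D, I'))
    = (\<Sum>D\<in>words N (Suc k). of_real (alpha * alpha / 2) * (if D k = 0 then g e (remove k k D) * g e' (remove k k D) else 0))"
  proof -
    have c: "complex_of_real (alpha / sqrt 2) * complex_of_real (alpha / sqrt 2) = complex_of_real (alpha * alpha / 2)"
      by (simp flip: of_real_mult)
    have ent: "asym_kraus p q $$ (D, J) = complex_of_real (alpha / sqrt 2) *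
        (if digits N (Suc k) D k = 0 then g (digits N k J) (remove k k (digits N (Suc k) D)) else 0)"
      if "D < N ^ Suc k" "J < N ^ k" for D J
      using that by (simp add: asym_kraus_def g_def s_def)
    have cg: "cnj (g f f0) = g f f0" for f f0 by (simp add: g_def)
    have "cnj (asym_kraus p q $$ (D, I)) * asym_kraus p q $$ (D, I') = of_real (alpha * alpha / 2) *
       (if digits N (Suc k) D k = 0 then g e (remove k k (digits N (Suc k) D)) * g e' (remove k k (digits N (Suc k) D)) else 0)"
      if "D < N ^ Suc k" for D
      unfolding ent[OF that I(1)] ent[OF that I(2)] c[symmetric] e_def e'_def by (simp add: cg)
    then show ?thesis
      unfolding sum_digits[OF N_pos, symmetric] by (intro sum.cong refl) (simp only: lessThan_iff)
  qed
  also have "\<dots> = (\<Sum>f\<in>words N k. \<Sum>a<N. if a = 0 then of_real (alpha * alpha / 2) * (g e f * g e' f) else 0)"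
    unfolding sum_words_Suc[OF order_refl[of k]]
    by (intro sum.cong refl) (simp add: insert_at_same remove_insert_at)
  also have "\<dots> = of_real (alpha * alpha / 2) * (\<Sum>f\<in>words N k. g e f * g e' f)"
    using N_pos by (simp add: sum_distrib_left)
  also have "(\<Sum>f\<in>words N k. g e f * g e' f) = (\<Sum>f\<in>words N k. (if f = e then g e' e else 0) - (if f = s e then g e' (s e) else 0))"
    by (intro sum.cong refl) (auto simp: g_def)
  also have "\<dots> = g e' e - g e' (s e)"
    using ew sw[OF ew(1)] by (simp add: sum_subtractf finite_PiE)
  also have "\<dots> = 2 * ((if e = e' then 1 else 0) - (if s e = e' then 1 else 0))"
  proof -
    have "e = s e' \<longleftrightarrow> s e = e'" "s e = s e' \<longleftrightarrow> e = e'"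
      using ss[OF ew(1)] ss[OF ew(2)] by metis+
    then show ?thesis unfolding g_def by simp
  qed
  finally have fin: "(\<Sum>D<N ^ Suc k. cnj (asym_kraus p q $$ (D, I)) * asym_kraus p q $$ (D, I')) =
     complex_of_real (alpha * alpha / 2) * (2 * ((if e = e' then 1 else 0) - (if s e = e' then 1 else 0)))" .
  have "complex_of_real (r / 2) * (2 * z) = complex_of_real r * z" for r z by simp
  then show ?thesis unfolding fin s_def .
qed

text \<open>The swap terms of the two Gram matrices cancel. What remains is
  \<open>k^2 + k * (N - 1) + 2 * k + N = (k + 1) * (N + k)\<close> times the identity, and this is
  what \<open>alpha\<close> normalises.\<close>

lemma kraus_cloner: "kraus_family (N ^ k) (N ^ Suc k) cloner_kraus"
proof -
  have "set cloner_kraus \<subseteq> carrier_mat (N ^ Suc k) (N ^ k)"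
    by (auto simp: cloner_kraus_def sym_kraus_def asym_kraus_def)
  moreover have "(\<Sum>K\<leftarrow>cloner_kraus. \<Sum>D<N ^ Suc k. cnj (K $$ (D, I)) * K $$ (D, I')) = (if I = I' then 1 else 0)"
    if I: "I < N ^ k" "I' < N ^ k" for I I'
  proof -
    define e e' where "e = digits N k I" and "e' = digits N k I'"
    have ee: "e = e' \<longleftrightarrow> I = I'" unfolding e_def e'_def by (rule digits_eq_iff[OF N_pos I])
    define X where "X = (\<Sum>p<k. \<Sum>q<k. if swap_at k p q e = e' then 1 else (0 :: complex))"
    define c where "c = (if e = e' then 1 else (0 :: complex))"
    have "(\<Sum>p<k. \<Sum>q<k. \<Sum>D<N ^ Suc k. cnj (asym_kraus p q $$ (D, I)) * asym_kraus p q $$ (D, I'))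
      = (\<Sum>p<k. \<Sum>q<k. complex_of_real (alpha * alpha) * (c - (if swap_at k p q e = e' then 1 else 0)))"
      unfolding c_def e_def e'_def by (intro sum.cong refl asym_gram[OF I]) auto
    also have "\<dots> = complex_of_real (alpha * alpha) * (of_nat k * of_nat k * c - X)"
      unfolding X_def sum_distrib_left[symmetric] by (simp add: sum_subtractf)
    finally have as: "(\<Sum>p<k. \<Sum>q<k. \<Sum>D<N ^ Suc k. cnj (asym_kraus p q $$ (D, I)) * asym_kraus p q $$ (D, I')) = \<dots>" .
    have sy: "(\<Sum>j<N. \<Sum>D<N ^ Suc k. cnj (sym_kraus j $$ (D, I)) * sym_kraus j $$ (D, I')) =
      complex_of_real (alpha * alpha) * (X + (of_nat k * (of_nat N - 1) + 2 * of_nat k + of_nat N) * c)"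
      unfolding sym_gram[OF I] X_def c_def e_def e'_def by simp
    have "(\<Sum>K\<leftarrow>cloner_kraus. \<Sum>D<N ^ Suc k. cnj (K $$ (D, I)) * K $$ (D, I')) =
      complex_of_real (alpha * alpha * (real (Suc k) * real (N + k))) * c"
      unfolding sum_cloner_kraus as sy by (simp add: algebra_simps)
    then show ?thesis unfolding alpha_sq c_def ee by simp
  qed
  ultimately show ?thesis by (subst kraus_family_iff) auto
qed

text \<open>After an insertion of \<open>j\<close> the product over all letters factors, and the
  word part contributes the norm 1 of the input. Each of the \<open>k + 1\<close> positions thus
  contributes the same amount, so the amplitudes add coherently.\<close>

lemma sym_overlap:
  assumes psi: "\<psi> \<in> unit_vecs N" and j: "j < N"
  shows "(\<Sum>D<N ^ Suc k. cnj (tpow N (vec_index \<psi>) (Suc k) D) * mv (sym_kraus j) (\<lambda>I x. tpow N x k I) D (vec_index \<psi>))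
    = complex_of_real (alpha * real (Suc k)) * cnj (\<psi> $ j)"
proof -
  let ?x = "vec_index \<psi>"
  define P where "P m e = (\<Prod>i<m. ?x (e i))" for m and e :: "nat \<Rightarrow> nat"
  have tp: "tpow N ?x m I = P m (digits N m I)" if "I < N ^ m" for m I
    unfolding P_def by (rule tpow_digits[OF N_pos that])
  have "(\<Sum>I<N ^ k. tpow N ?x k I * cnj (tpow N ?x k I)) = 1"
    unfolding sum_tpow using unit_vec_norm(2)[OF psi] by simp
  moreover have "(\<Sum>I<N ^ k. tpow N ?x k I * cnj (tpow N ?x k I)) = (\<Sum>I<N ^ k. P k (digits N k I) * cnj (P k (digits N k I)))"
    by (intro sum.cong refl) (simp only: tp lessThan_iff)
  ultimately have "(\<Sum>I<N ^ k. P k (digits N k I) * cnj (P k (digits N k I))) = 1" by simp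
  then have P1: "(\<Sum>e\<in>words N k. P k e * cnj (P k e)) = 1"
    by (simp only: sum_digits[OF N_pos, where h = "\<lambda>e. P k e * cnj (P k e)"])
  have "(\<Sum>D<N ^ Suc k. cnj (tpow N ?x (Suc k) D) * mv (sym_kraus j) (\<lambda>I x. tpow N x k I) D ?x)
    = (\<Sum>D\<in>words N (Suc k). cnj (P (Suc k) D) * (\<Sum>e\<in>words N k. of_real alpha *
        (\<Sum>p<Suc k. if remove k p D = e \<and> D p = j then 1 else 0) * P k e))"
  proof -
    have "mv (sym_kraus j) (\<lambda>I x. tpow N x k I) D ?x = (\<Sum>I<N ^ k. of_real alpha *
        (\<Sum>p<Suc k. if remove k p (digits N (Suc k) D) = digits N k I \<and> digits N (Suc k) D p = j then 1 else 0) * P k (digits N k I))"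
      if "D < N ^ Suc k" for D
      unfolding mv_def using that by (intro sum.cong) (simp_all add: sym_kraus_def tp del: sum.lessThan_Suc)
    then show ?thesis
      unfolding sum_digits[OF N_pos, symmetric]
      by (intro sum.cong refl) (simp only: tp lessThan_iff)
  qed
  also have "\<dots> = (\<Sum>D\<in>words N (Suc k). \<Sum>e\<in>words N k. \<Sum>p<Suc k.
       of_real alpha * P k e * (if remove k p D = e then (if D p = j then cnj (P (Suc k) D) else 0) else 0))"
    unfolding sum_distrib_left sum_distrib_right
    by (intro sum.cong refl) auto
  also have "\<dots> = (\<Sum>p<Suc k. \<Sum>e\<in>words N k. \<Sum>D\<in>words N (Suc k).
       of_real alpha * P k e * (if remove k p D = e then (if D p = j then cnj (P (Suc k) D) else 0) else 0))"
    by (subst sum.swap, subst sum.swap[of _ "words N (Suc k)"], subst sum.swap[of _ "words N k"]) (rule refl)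
  also have "\<dots> = (\<Sum>p<Suc k. \<Sum>e\<in>words N k. of_real alpha * P k e * (\<Sum>a<N. if a = j then cnj (?x a) * cnj (P k e) else 0))"
  proof (intro sum.cong refl)
    fix p e assume "p \<in> {..<Suc k}" and e: "e \<in> words N k"
    then have p: "p \<le> k" by auto
    show "(\<Sum>D\<in>words N (Suc k). of_real alpha * P k e * (if remove k p D = e then (if D p = j then cnj (P (Suc k) D) else 0) else 0))
      = of_real alpha * P k e * (\<Sum>a<N. if a = j then cnj (?x a) * cnj (P k e) else 0)"
      unfolding sum_distrib_left[symmetric] sum_remove_eq[OF e p] insert_at_same[OF p] P_def prod_insert_at[OF p] complex_cnj_mult ..
  qed
  also have "\<dots> = (\<Sum>p<Suc k. of_real alpha * cnj (?x j) * (\<Sum>e\<in>words N k. P k e * cnj (P k e)))"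
    using j by (simp add: sum_distrib_left mult_ac del: sum.lessThan_Suc sum_constant)
  finally show ?thesis by (simp add: P1 algebra_simps)
qed

text \<open>A tensor power is invariant under swaps, so \<open>I - S\<close> annihilates it.\<close>

lemma asym_vanishes:
  assumes pq: "p < k" "q < k" and D: "D < N ^ Suc k"
  shows "mv (asym_kraus p q) (\<lambda>I x. tpow N x k I) D x = 0"
proof -
  define P where "P e = (\<Prod>i<k. x (e i))" for e :: "nat \<Rightarrow> nat"
  have tp: "tpow N x k I = P (digits N k I)" if "I < N ^ k" for I
    unfolding P_def by (rule tpow_digits[OF N_pos that])
  define d where "d = digits N (Suc k) D"
  define r where "r = remove k k d"
  have r: "r \<in> words N k" unfolding r_def d_def by (intro remove_in_words digits_in_words N_pos)
  define s where "s = swap_at k p q"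
  have sw: "s f \<in> words N k" if "f \<in> words N k" for f unfolding s_def using that pq by (rule swap_at_in_words)
  have ss: "s (s f) = f" if "f \<in> words N k" for f unfolding s_def using that pq by (rule swap_at_swap_at)
  have iff: "r = s e \<longleftrightarrow> e = s r" if "e \<in> words N k" for e using ss[OF that] ss[OF r] by auto
  have "mv (asym_kraus p q) (\<lambda>I x. tpow N x k I) D x = (\<Sum>e\<in>words N k. of_real (alpha / sqrt 2) *
     (if d k = 0 then (if r = e then 1 else 0) - (if r = s e then 1 else 0) else 0) * P e)"
    unfolding sum_digits[OF N_pos, symmetric] mv_def
    using D by (intro sum.cong) (simp_all add: asym_kraus_def tp d_def r_def s_def)
  also have "\<dots> = (\<Sum>e\<in>words N k. if d k = 0 then of_real (alpha / sqrt 2) * ((if e = r then P r else 0) - (if e = s r then P (s r) else 0)) else 0)"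
    by (intro sum.cong refl) (auto simp: iff)
  also have "\<dots> = (if d k = 0 then of_real (alpha / sqrt 2) * (P r - P (s r)) else 0)"
  proof (cases "d k = 0")
    case True
    have "(\<Sum>e\<in>words N k. if e = r then P r else 0) = P r" "(\<Sum>e\<in>words N k. if e = s r then P (s r) else 0) = P (s r)"
      by (simp_all only: sum.delta finite_PiE finite_lessThan r sw[OF r] if_True)
    then show ?thesis unfolding if_P[OF True] sum_distrib_left[symmetric] sum_subtractf by (simp only:)
  qed simp
  also have "P (s r) = P r" unfolding P_def s_def by (rule prod_swap_at[OF pq])
  finally show ?thesis by simp
qed

lemma cloner_without_queries:
  "\<exists>A. cloner N k 0 A \<and> avg_success \<mu> k A = real (Suc k) / real (N + k)"
proof (intro exI conjI)
  let ?A = "\<lambda>\<psi> \<rho>. kraus_op cloner_kraus (N ^ Suc k) \<rho>"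
  show "cloner N k 0 ?A"
    unfolding cloner_def Suc_eq_plus1[of k, symmetric]
    using oracle_alg.no_query[OF quantum_op_kraus[OF kraus_cloner]] by blast
  show "avg_success \<mu> k ?A = real (Suc k) / real (N + k)"
  proof (rule avg_success_pure[OF pure_family_input])
    show "set cloner_kraus \<subseteq> carrier_mat (N ^ Suc k) (N ^ k)"
      by (auto simp: cloner_kraus_def sym_kraus_def asym_kraus_def)
    show "output_state k ?A \<psi> = kraus_op cloner_kraus (N ^ Suc k) (tensor_power (ket_bra \<psi>) k)" for \<psi>
      by (simp only: output_state_def)
    fix \<psi> assume psi: "\<psi> \<in> unit_vecs N"
    let ?x = "vec_index \<psi>"
    define ov where "ov K = (\<Sum>J<N ^ Suc k. cnj (tpow N ?x (Suc k) J) * mv K (\<lambda>I x. tpow N x k I) J ?x)" for K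
    have s: "(cmod (ov (sym_kraus j)))\<^sup>2 = (alpha * real (Suc k))\<^sup>2 * (cmod (\<psi> $ j))\<^sup>2" if "j < N" for j
      unfolding ov_def sym_overlap[OF psi that] by (simp only: norm_mult complex_mod_cnj power_mult_distrib norm_of_real power2_abs)
    have a: "ov (asym_kraus p q) = 0" if "p < k" "q < k" for p q
      unfolding ov_def by (intro sum.neutral ballI) (simp add: asym_vanishes[OF that] del: tpow.simps power_Suc)
    have "(\<Sum>K\<leftarrow>cloner_kraus. (cmod (ov K))\<^sup>2) = (\<Sum>j<N. (alpha * real (Suc k))\<^sup>2 * (cmod (\<psi> $ j))\<^sup>2)"
    proof -
      have "(\<Sum>p<k. \<Sum>q<k. (cmod (ov (asym_kraus p q)))\<^sup>2) = 0"
        by (intro sum.neutral ballI) (simp add: a)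
      moreover have "(\<Sum>j<N. (cmod (ov (sym_kraus j)))\<^sup>2) = (\<Sum>j<N. (alpha * real (Suc k))\<^sup>2 * (cmod (\<psi> $ j))\<^sup>2)"
        by (intro sum.cong refl s) simp
      ultimately show ?thesis unfolding sum_cloner_kraus by simp
    qed
    also have "\<dots> = (alpha * real (Suc k))\<^sup>2"
      unfolding sum_distrib_left[symmetric] unit_vec_norm(1)[OF psi] by simp
    also have "\<dots> = real (Suc k) / real (N + k)"
    proof -
      have "(alpha * real (Suc k))\<^sup>2 * real (N + k) = alpha * alpha * (real (Suc k) * real (N + k)) * real (Suc k)"
        by (simp add: power2_eq_square)
      then show ?thesis unfolding alpha_sq using N_pos by (simp add: field_simps del: of_nat_add of_nat_Suc)
    qed
    finally show "(\<Sum>K\<leftarrow>cloner_kraus. (cmod (\<Sum>J<N ^ Suc k. cnj (tpow N ?x (Suc k) J) * mv K (\<lambda>I x. tpow N x k I) J ?x))\<^sup>2)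
      = real (Suc k) / real (N + k)" unfolding ov_def .
  qed
qed

end

section \<open>Query complexity\<close>

lemma (in haar_states) cloner_mono: "cloner N k T A \<Longrightarrow> T \<le> T' \<Longrightarrow> cloner N k T' A"
  unfolding cloner_def by (meson order_trans)

text \<open>The sum is at most twice its larger term, and \<open>grover_search\<close> loses a
  factor 4; this makes the 8. For the cloner a factor 2 covers \<open>N + k < 2 * N\<close>, and for
  \<open>k \<ge> N\<close> its success probability exceeds \<open>1 / 8\<close> anyway.\<close>

lemma (in haar_states) cloner_lower_bound:
  "\<exists>A. cloner N k T A \<and> avg_success \<mu> k A \<ge> 1 / 8 * min 1 (real T ^ 2 / real N + (real k + 1) / real N)"
proof (cases "real T ^ 2 \<ge> real k + 1")
  case True
  then have "T \<ge> 1" by (cases T) auto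
  then obtain A where A: "cloner N k T A" "min 1 (real T ^ 2 / (4 * real N)) \<le> avg_success \<mu> k A"
    using grover_search by blast
  have "(real k + 1) / real N \<le> real T ^ 2 / real N"
    using True by (intro divide_right_mono) auto
  then have "1 / 8 * min 1 (real T ^ 2 / real N + (real k + 1) / real N) \<le> min 1 (real T ^ 2 / (4 * real N))"
    by (auto simp: min_def)
  with A show ?thesis by (intro exI[of _ A]) auto
next
  case False
  interpret optimal_cloner N \<mu> k by unfold_locales
  obtain A where A: "cloner N k 0 A" "avg_success \<mu> k A = real (Suc k) / real (N + k)"
    using cloner_without_queries by blast
  have "1 / 8 * min 1 (real T ^ 2 / real N + (real k + 1) / real N) \<le> real (Suc k) / real (N + k)"
  proof (cases "Suc k \<le> N")
    case True
    have TN: "real T ^ 2 / real N \<le> (real k + 1) / real N"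
      using False by (intro divide_right_mono) auto
    have min_le: "1 / 8 * min 1 (v + u) \<le> u / 2" if "v \<le> u" "0 \<le> u" for u v :: real
      using that by (auto simp: min_def)
    have "1 / 8 * min 1 (real T ^ 2 / real N + (real k + 1) / real N) \<le> (real k + 1) / real N / 2"
      by (rule min_le[OF TN]) simp
    also have "(real k + 1) / real N / 2 = (real k + 1) / (2 * real N)" by simp
    also have "(real k + 1) / (2 * real N) \<le> (real k + 1) / real (N + k)"
      using True N_pos by (intro divide_left_mono) auto
    finally show ?thesis by (simp only: of_nat_Suc add.commute[of 1 "real k"])
  next
    case False
    then have "1 / 8 \<le> real (Suc k) / real (N + k)"
      using N_pos by (subst pos_le_divide_eq) auto
    then show ?thesis by (auto simp: min_def)
  qed
  with A cloner_mono[OF A(1), of T] show ?thesis by (intro exI[of _ A]) auto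
qed

lemma (in haar_states) queries_suffice_sqrt:
  assumes "real T \<ge> 2 * sqrt (real N)"
  shows "queries_suffice \<mu> N k T"
proof -
  have "sqrt (real N) \<ge> 1" using N_pos by simp
  then have "real T \<ge> 1" using assms by linarith
  then have "T \<ge> 1" by simp
  then obtain A where A: "cloner N k T A" "min 1 (real T ^ 2 / (4 * real N)) \<le> avg_success \<mu> k A"
    using grover_search by blast
  have "(2 * sqrt (real N)) ^ 2 \<le> real T ^ 2" using assms by (intro power_mono) auto
  then have "1 \<le> real T ^ 2 / (4 * real N)" using N_pos by (simp add: field_simps)
  with A show ?thesis unfolding queries_suffice_def by (intro exI[of _ A]) auto
qed

text \<open>The existence of a sufficient \<open>T\<close> belongs to the second claim because
  \<open>query_complexity\<close> is a least element. The third claim carries \<open>min 1\<close>,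
  as no probability exceeds 1; its constant, like that of the first, is uniform in \<open>n\<close>,
  \<open>k\<close> and \<open>T\<close>.\<close>

theorem theorem1p1:
  fixes \<mu> :: "nat \<Rightarrow> complex vec measure"
  assumes haar: "\<And>n. haar_state_measure (2 ^ n) (\<mu> n)"
  shows
    "(\<exists>C>0. \<forall>n k T A. cloner (2 ^ n) k T A \<longrightarrow>
        avg_success (\<mu> n) k A \<le> C * (real T ^ 2 / 2 ^ n + (real k + 1) / 2 ^ n))
   \<and> (\<forall>k :: nat \<Rightarrow> nat. (\<lambda>n. real (k n)) \<in> o(\<lambda>n. 2 ^ n) \<longrightarrow>
        (\<forall>n. \<exists>T. queries_suffice (\<mu> n) (2 ^ n) (k n) T) \<and>
        (\<lambda>n. real (query_complexity (\<mu> n) (2 ^ n) (k n))) \<in> \<Theta>(\<lambda>n. sqrt (2 ^ n)))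
   \<and> (\<exists>c>0. \<forall>n k T. \<exists>A. cloner (2 ^ n) k T A \<and>
        avg_success (\<mu> n) k A \<ge> c * min 1 (real T ^ 2 / 2 ^ n + (real k + 1) / 2 ^ n))"
proof (intro conjI allI impI)
  have loc: "haar_states (2 ^ n) (\<mu> n)" for n
    by unfold_locales (use haar in auto)
  have upper: "avg_success (\<mu> n) k A \<le> 16 * (real T ^ 2 / 2 ^ n + (real k + 1) / 2 ^ n)"
    if "cloner (2 ^ n) k T A" for n k T A
    using haar_states.cloner_bound[OF loc that] by simp
  show "\<exists>C>0. \<forall>n k T A. cloner (2 ^ n) k T A \<longrightarrow>
        avg_success (\<mu> n) k A \<le> C * (real T ^ 2 / 2 ^ n + (real k + 1) / 2 ^ n)"
    using upper by (intro exI[of _ 16]) auto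
  show "\<exists>c>0. \<forall>n k T. \<exists>A. cloner (2 ^ n) k T A \<and>
        avg_success (\<mu> n) k A \<ge> c * min 1 (real T ^ 2 / 2 ^ n + (real k + 1) / 2 ^ n)"
    using haar_states.cloner_lower_bound[OF loc] by (intro exI[of _ "1 / 8"]) auto
  have suff: "queries_suffice (\<mu> n) (2 ^ n) k (nat \<lceil>2 * sqrt (2 ^ n)\<rceil>)" for n k
    using haar_states.queries_suffice_sqrt[OF loc, of n "nat \<lceil>2 * sqrt (2 ^ n)\<rceil>" k]
      real_nat_ceiling_ge[of "2 * sqrt (2 ^ n)"] by simp
  fix k :: "nat \<Rightarrow> nat"
  assume k: "(\<lambda>n. real (k n)) \<in> o(\<lambda>n. 2 ^ n)"
  show "\<exists>T. queries_suffice (\<mu> n) (2 ^ n) (k n) T" for n using suff by blast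
  define q where "q n = query_complexity (\<mu> n) (2 ^ n) (k n)" for n
  have q_suff: "queries_suffice (\<mu> n) (2 ^ n) (k n) (q n)" for n
    unfolding q_def query_complexity_def by (rule LeastI[of "queries_suffice (\<mu> n) (2 ^ n) (k n)"]) (rule suff)
  \<comment> \<open>The constant 3 is 2 plus 1 for the ceiling, absorbed because
    \<open>sqrt (2 ^ n) \<ge> 1\<close>.\<close>
  have q_le: "real (q n) \<le> 3 * sqrt (2 ^ n)" for n
  proof -
    have "q n \<le> nat \<lceil>2 * sqrt (2 ^ n)\<rceil>"
      unfolding q_def query_complexity_def by (rule Least_le) (rule suff)
    then have "real (q n) \<le> real (nat \<lceil>2 * sqrt (2 ^ n)\<rceil>)" by (simp only: of_nat_le_iff)
    also have "\<dots> \<le> 2 * sqrt (2 ^ n) + 1"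
      using of_int_ceiling_le_add_one[of "2 * sqrt (2 ^ n)"] by simp
    also have "1 \<le> sqrt (2 ^ n :: real)" by simp
    finally show ?thesis by simp
  qed
  have q_ge: "eventually (\<lambda>n. sqrt (2 ^ n) \<le> 8 * real (q n)) at_top"
  proof -
    \<comment> \<open>With \<open>k\<close> and 1 each at most \<open>N / 96\<close>, the term
      \<open>16 * (k + 1)\<close> is at most \<open>N / 3\<close>, half of the required
      \<open>2 / 3 * N\<close>. The queries must supply the rest, so
      \<open>N \<le> 48 * q^2\<close>, which is below \<open>(8 * q)^2\<close>.\<close>
    have "eventually (\<lambda>n. norm (real (k n)) \<le> 1 / 96 * norm (2 ^ n :: real)) at_top"
      using landau_o.smallD[OF k, of "1 / 96"] by simp
    moreover have "eventually (\<lambda>n. 96 \<le> (2 ^ n :: real)) at_top"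
      by (rule eventually_at_top_linorderI[of 7]) (rule order_trans[OF _ power_increasing[of 7 _ "2 :: real"]], simp_all)
    ultimately show ?thesis
    proof eventually_elim
      case (elim n)
      define N where "N = (2 ^ n :: real)"
      have N: "N > 0" by (simp add: N_def)
      obtain A where A: "cloner (2 ^ n) (k n) (q n) A" "2 / 3 \<le> avg_success (\<mu> n) (k n) A"
        using q_suff[of n] unfolding queries_suffice_def by blast
      have "2 / 3 \<le> 16 * (real (q n) ^ 2 / N + (real (k n) + 1) / N)"
        using upper[OF A(1)] A(2) unfolding N_def by linarith
      then have "2 / 3 * N \<le> 16 * (real (q n) ^ 2 + (real (k n) + 1))"
        using N by (simp add: pos_le_divide_eq flip: add_divide_distrib)
      moreover have "real (k n) + 1 \<le> N / 48" using elim by (simp add: N_def)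
      ultimately have "N \<le> (8 * real (q n)) ^ 2" by (simp add: power_mult_distrib)
      then have "sqrt N \<le> 8 * real (q n)" by (intro real_le_lsqrt) simp_all
      then show ?case by (simp only: N_def)
    qed
  qed
  have "(\<lambda>n. real (q n)) \<in> O(\<lambda>n. sqrt (2 ^ n))"
    by (rule bigoI[of _ 3]) (use q_le in auto)
  moreover have "(\<lambda>n. real (q n)) \<in> \<Omega>(\<lambda>n. sqrt (2 ^ n))"
    by (rule landau_omega.bigI[of "1 / 8"]) (use q_ge in \<open>auto elim: eventually_mono\<close>)
  ultimately show "(\<lambda>n. real (query_complexity (\<mu> n) (2 ^ n) (k n))) \<in> \<Theta>(\<lambda>n. sqrt (2 ^ n))"
    unfolding q_def[symmetric] by (rule bigthetaI)
qed

end
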